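(* Let $R>0$, $\Omega=B_R=B_R(0)\subset\mathbb{R}^2$, $D\ge1$ an integer, $g(Re^{i\theta})=e^{iD\theta}$, and $\varepsilon>0$. Then the map $re^{i\theta}\mapsto\left(\frac rR\right)^{D\varepsilon}e^{iD\theta}$ is a minimizer of $E_\varepsilon$ over $H^1_g(B_R;\mathbb{R}^2)$.
   Context: $E_\varepsilon(u)=\int_\Omega\big(|\nabla u|^2+(\tfrac1{\varepsilon^2}-1)|\nabla|u||^2\big)$ and $H^1_g(\Omega;\mathbb{R}^2)=\{u\in H^1(\Omega;\mathbb{R}^2):u=g\text{ on }\partial\Omega\}$; $\mathbb{R}^2$ is identified with $\mathbb{C}$. *)

theory Defs
  imports "HOL-Analysis.Analysis"
begin

section \<open>Smooth functions and test functions\<close>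

primrec Ck :: "nat \<Rightarrow> ('a::euclidean_space \<Rightarrow> 'b::euclidean_space) \<Rightarrow> bool" where
  "Ck 0 f \<longleftrightarrow> continuous_on UNIV f"
| "Ck (Suc k) f \<longleftrightarrow> f differentiable_on UNIV \<and>
     (\<forall>e\<in>Basis. Ck k (\<lambda>x. frechet_derivative f (at x) e))"

definition smooth :: "('a::euclidean_space \<Rightarrow> 'b::euclidean_space) \<Rightarrow> bool" where
  "smooth f \<longleftrightarrow> (\<forall>k. Ck k f)"

definition test_functions :: "'a::euclidean_space set \<Rightarrow> ('a \<Rightarrow> real) set" where
  "test_functions \<Omega> =
     {\<phi>. smooth \<phi> \<and> compact (closure {x. \<phi> x \<noteq> 0}) \<and> closure {x. \<phi> x \<noteq> 0} \<subseteq> \<Omega>}"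

section \<open>Weak derivatives and the Sobolev space H1\<close>

definition locally_integrable ::
    "'a::euclidean_space set \<Rightarrow> ('a \<Rightarrow> 'b::euclidean_space) \<Rightarrow> bool" where
  "locally_integrable \<Omega> u \<longleftrightarrow>
     (\<forall>K. compact K \<and> K \<subseteq> \<Omega> \<longrightarrow> u absolutely_integrable_on K)"

definition is_weak_deriv ::
    "'a::euclidean_space set \<Rightarrow> 'a \<Rightarrow> ('a \<Rightarrow> 'b::euclidean_space) \<Rightarrow> ('a \<Rightarrow> 'b) \<Rightarrow> bool" where
  "is_weak_deriv \<Omega> e u v \<longleftrightarrow>
     locally_integrable \<Omega> u \<and> locally_integrable \<Omega> v \<and>
     (\<forall>\<phi>\<in>test_functions \<Omega>.
        (LINT x|lebesgue_on \<Omega>. frechet_derivative \<phi> (at x) e *\<^sub>R u x) =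
        - (LINT x|lebesgue_on \<Omega>. \<phi> x *\<^sub>R v x))"

text \<open>A chosen representative: weak derivatives are only unique up to null sets. The integral
  quantities below do not depend on the choice.\<close>

definition weak_deriv ::
    "'a::euclidean_space set \<Rightarrow> 'a \<Rightarrow> ('a \<Rightarrow> 'b::euclidean_space) \<Rightarrow> 'a \<Rightarrow> 'b" where
  "weak_deriv \<Omega> e u = (SOME v. is_weak_deriv \<Omega> e u v)"

definition weak_grad_sq ::
    "'a::euclidean_space set \<Rightarrow> ('a \<Rightarrow> 'b::euclidean_space) \<Rightarrow> 'a \<Rightarrow> real" where
  "weak_grad_sq \<Omega> u x = (\<Sum>e\<in>Basis. (norm (weak_deriv \<Omega> e u x))\<^sup>2)"

definition L2_on :: "'a::euclidean_space set \<Rightarrow> ('a \<Rightarrow> 'b::euclidean_space) set" where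
  "L2_on \<Omega> = {u. u \<in> borel_measurable (lebesgue_on \<Omega>) \<and>
                 integrable (lebesgue_on \<Omega>) (\<lambda>x. (norm (u x))\<^sup>2)}"

definition H1 :: "'a::euclidean_space set \<Rightarrow> ('a \<Rightarrow> 'b::euclidean_space) set" where
  "H1 \<Omega> = {u \<in> L2_on \<Omega>. \<forall>e\<in>Basis. \<exists>v\<in>L2_on \<Omega>. is_weak_deriv \<Omega> e u v}"

definition H1_norm :: "'a::euclidean_space set \<Rightarrow> ('a \<Rightarrow> 'b::euclidean_space) \<Rightarrow> real" where
  "H1_norm \<Omega> u = sqrt (LINT x|lebesgue_on \<Omega>. (norm (u x))\<^sup>2 + weak_grad_sq \<Omega> u x)"

section \<open>Boundary values on a circle\<close>

text \<open>The circle of radius \<open>R\<close> carries arc length, parametrized by the angle.\<close>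

definition circle_L2 :: "real \<Rightarrow> (complex \<Rightarrow> complex) set" where
  "circle_L2 R = {h. (\<lambda>\<theta>. h (rcis R \<theta>)) \<in> L2_on {0..2*pi}}"

definition circle_L2_norm :: "real \<Rightarrow> (complex \<Rightarrow> complex) \<Rightarrow> real" where
  "circle_L2_norm R h = sqrt (LINT \<theta>|lebesgue_on {0..2*pi}. (norm (h (rcis R \<theta>)))\<^sup>2 * R)"

text \<open>The trace operator is the continuous extension, from \<open>H1\<close> of the disc to \<open>L2\<close> of its
  boundary circle, of the restriction map on functions smooth up to the boundary.\<close>

definition has_trace :: "real \<Rightarrow> (complex \<Rightarrow> complex) \<Rightarrow> (complex \<Rightarrow> complex) \<Rightarrow> bool" where
  "has_trace R u g \<longleftrightarrow> g \<in> circle_L2 R \<and>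
     (\<exists>U :: nat \<Rightarrow> complex \<Rightarrow> complex.
        (\<forall>k. smooth (U k)) \<and>
        (\<lambda>k. H1_norm (ball 0 R) (\<lambda>x. U k x - u x)) \<longlonglongrightarrow> 0 \<and>
        (\<lambda>k. circle_L2_norm R (\<lambda>x. U k x - g x)) \<longlonglongrightarrow> 0)"

definition H1_boundary :: "real \<Rightarrow> (complex \<Rightarrow> complex) \<Rightarrow> (complex \<Rightarrow> complex) set" where
  "H1_boundary R g = {u \<in> H1 (ball 0 R). has_trace R u g}"

section \<open>The energy\<close>

definition energy ::
    "real \<Rightarrow> 'a::euclidean_space set \<Rightarrow> ('a \<Rightarrow> 'b::euclidean_space) \<Rightarrow> real" where
  "energy \<epsilon> \<Omega> u = (LINT x|lebesgue_on \<Omega>.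
     weak_grad_sq \<Omega> u x + (1 / \<epsilon>\<^sup>2 - 1) * weak_grad_sq \<Omega> (\<lambda>y. norm (u y)) x)"

end

theory Submission
  imports Defs
begin

text \<open>
The idea is a calibration. Write \<open>p\<close>, \<open>q\<close> for the two partial derivatives of a competitor \<open>v\<close> and
split them, at points where \<open>v\<close> does not vanish, into their components along the unit vector
\<open>v / |v|\<close> and perpendicular to it. The components along \<open>v / |v|\<close> are exactly the derivatives of \<open>|v|\<close>,
so the energy density equals
\<open>(p\<^sub>n\<^sup>2 + q\<^sub>n\<^sup>2) / \<epsilon>\<^sup>2 + p\<^sub>t\<^sup>2 + q\<^sub>t\<^sup>2\<close>, and completing squares gives
\<open>2/\<epsilon> det Dv + (p\<^sub>n/\<epsilon> - q\<^sub>t)\<^sup>2 + (q\<^sub>n/\<epsilon> + p\<^sub>t)\<^sup>2\<close>, where \<open>det Dv = p\<^sub>n q\<^sub>t - q\<^sub>n p\<^sub>t\<close>.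
Hence the energy of \<open>v\<close> is at least \<open>2/\<epsilon>\<close> times the integral of \<open>det Dv\<close>. For the map \<open>u\<close> of the
theorem both squares vanish: its logarithmic radial derivative is \<open>D \<epsilon> / r\<close> and its
angular speed is \<open>D / r\<close>. Finally \<open>det Dv\<close> is a null Lagrangian, so that its integral
over the disc is the same for all maps with the same trace. Therefore every competitor has at least the energy of \<open>u\<close>.

Three points need analysis.

\<^item> The chain rule for \<open>|v|\<close> (\<open>weak_deriv_norm\<close>), and the fact that the derivatives of \<open>v\<close> vanish almost
  everywhere on the zero set of \<open>v\<close> (\<open>weak_deriv_zero_set\<close>), where the splitting above makes no sense.
  Since the definitions choose some weak derivative, uniqueness (\<open>weak_deriv_unique\<close>) comes first.

\<^item> The invariance of the integral of \<open>det Dv\<close> (\<open>jacobian_null_Lagrangian\<close>). The boundary values of the smooth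
  approximations converge only in the square mean, so that the boundary integral of \<open>v \<and> \<partial>v/\<partial>\<theta>\<close> has no evident
  limit. Instead, the integrand is multiplied by a cutoff function that vanishes on the circle. Integration by parts
  leaves an integral over a thin annulus, where the difference of two competitors is controlled by its values on
  the circle and by its gradient on that annulus (\<open>boundary_layer_estimate\<close>).

\<^item> The map \<open>u\<close>, whose gradient may be singular at the origin, belongs to the admissible class
  (\<open>smooth_approx_radial\<close>, \<open>radial_trace\<close>). It is approximated by replacing \<open>|z|\<^sup>2\<close> in its modulus by \<open>|z|\<^sup>2 + d\<close>.
\<close>

section \<open>Calculus of continuously differentiable functions\<close>

text \<open>The directional derivative in the form in which the definition of weak derivatives mentions it.
  As \<^const>\<open>frechet_derivative\<close> is a choice, it is evaluated only through \<open>pd_eq\<close> below.\<close>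

abbreviation pd :: "('a::euclidean_space \<Rightarrow> 'b::euclidean_space) \<Rightarrow> 'a \<Rightarrow> 'a \<Rightarrow> 'b" where
  "pd f e \<equiv> \<lambda>x. frechet_derivative f (at x) e"

lemma pd_eq: "(f has_derivative f') (at x) \<Longrightarrow> pd f e x = f' e"
  using frechet_derivative_at by metis

lemma Ck_has_derivative:
  assumes "Ck (Suc k) f"
  shows "(f has_derivative frechet_derivative f (at x)) (at x)"
  using assms by (auto simp: differentiable_on_def frechet_derivative_works)

lemma CkI:
  assumes "\<And>x. (f has_derivative f' x) (at x)" and "\<And>e. e \<in> Basis \<Longrightarrow> Ck k (\<lambda>x. f' x e)"
  shows "Ck (Suc k) f"
proof -
  have "frechet_derivative f (at x) = f' x" for x
    using frechet_derivative_at[OF assms(1)] by simp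
  then show ?thesis
    using assms by (auto simp: differentiable_on_def differentiable_def intro: has_derivative_at_withinI)
qed

lemma Ck_Suc_imp: "Ck (Suc k) f \<Longrightarrow> Ck k f"
proof (induction k arbitrary: f)
  case 0
  then show ?case by (simp add: differentiable_imp_continuous_on)
next
  case (Suc k)
  then show ?case by (metis Ck.simps(2))
qed

lemma Ck_le: "Ck k f \<Longrightarrow> j \<le> k \<Longrightarrow> Ck j f"
  by (induction k) (use Ck_Suc_imp le_Suc_eq in blast)+

lemma Ck_pd: "Ck (Suc k) f \<Longrightarrow> e \<in> Basis \<Longrightarrow> Ck k (pd f e)"
  by simp

lemma Ck_continuous: "Ck k f \<Longrightarrow> continuous_on UNIV f"
  using Ck_le[of k f 0] by simp

lemma Ck_pd_continuous: "Ck (Suc k) f \<Longrightarrow> e \<in> Basis \<Longrightarrow> continuous_on UNIV (pd f e)"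
  using Ck_continuous Ck_pd by blast

lemma Ck_const: "Ck k (\<lambda>x. c)"
proof (induction k arbitrary: c)
  case (Suc k)
  show ?case by (rule CkI[where f' = "\<lambda>x e. 0"]) (auto intro!: derivative_eq_intros Suc)
qed simp

lemma Ck_bounded_linear: "bounded_linear L \<Longrightarrow> Ck k L"
proof (cases k)
  case 0
  assume "bounded_linear L" then show ?thesis by (simp add: 0 linear_continuous_on)
next
  case (Suc j)
  assume L: "bounded_linear L"
  show ?thesis unfolding Suc
    by (rule CkI[where f' = "\<lambda>x. L"]) (auto intro: bounded_linear_imp_has_derivative L Ck_const)
qed

lemma Ck_add: "Ck k f \<Longrightarrow> Ck k g \<Longrightarrow> Ck k (\<lambda>x. f x + g x)"
proof (induction k arbitrary: f g)
  case 0
  then show ?case by (simp add: continuous_on_add)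
next
  case (Suc k)
  show ?case
    by (rule CkI[OF has_derivative_add[OF Ck_has_derivative[OF Suc.prems(1)] Ck_has_derivative[OF Suc.prems(2)]]])
      (use Suc Ck_pd in blast)
qed

text \<open>By the product rule and induction on the order; one statement serves products of scalars, scalar multiples
  and every other bilinear operation.\<close>

lemma Ck_bilinear:
  fixes p :: "'b::euclidean_space \<Rightarrow> 'c::euclidean_space \<Rightarrow> 'd::euclidean_space"
  assumes p: "bounded_bilinear p"
  shows "Ck k f \<Longrightarrow> Ck k g \<Longrightarrow> Ck k (\<lambda>x. p (f x) (g x))"
proof (induction k arbitrary: f g)
  case 0
  then show ?case by (simp add: bounded_bilinear.continuous_on[OF p])
next
  case (Suc k)
  show ?case
  proof (rule CkI[OF bounded_bilinear.FDERIV[OF p Ck_has_derivative[OF Suc.prems(1)] Ck_has_derivative[OF Suc.prems(2)]]])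
    fix e :: 'a assume e: "e \<in> Basis"
    show "Ck k (\<lambda>x. p (f x) (pd g e x) + p (pd f e x) (g x))"
      using Suc.IH[OF Ck_Suc_imp[OF Suc.prems(1)] Ck_pd[OF Suc.prems(2) e]]
        Suc.IH[OF Ck_pd[OF Suc.prems(1) e] Ck_Suc_imp[OF Suc.prems(2)]] by (rule Ck_add)
  qed
qed

lemmas Ck_scaleR = Ck_bilinear[OF bounded_bilinear_scaleR]
lemmas Ck_mult = Ck_bilinear[OF bounded_bilinear_mult]

lemma Ck_linear_image:
  assumes L: "bounded_linear L"
  shows "Ck k f \<Longrightarrow> Ck k (\<lambda>x. L (f x))"
proof (induction k arbitrary: f)
  case 0
  then show ?case by (simp add: bounded_linear.continuous_on[OF L])
next
  case (Suc k)
  show ?case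
    by (rule CkI[OF bounded_linear.has_derivative[OF L Ck_has_derivative[OF Suc.prems(1)]]])
      (use Suc Ck_pd in blast)
qed

lemma Ck_uminus: "Ck k f \<Longrightarrow> Ck k (\<lambda>x. - f x)"
  by (rule Ck_linear_image[OF bounded_linear_minus[OF bounded_linear_ident]])

lemma Ck_diff: "Ck k f \<Longrightarrow> Ck k g \<Longrightarrow> Ck k (\<lambda>x. f x - g x)"
  using Ck_add[OF _ Ck_uminus] by force

lemma has_derivative_shift:
  assumes "(f has_derivative f') (at (x + a))"
  shows "((\<lambda>x. f (x + a)) has_derivative f') (at x)"
proof -
  have "((\<lambda>x. x + a) has_derivative (\<lambda>x. x)) (at x)"
    by (auto intro!: derivative_eq_intros)
  from has_derivative_compose[OF this assms] show ?thesis by simp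
qed

lemma Ck_shift:
  assumes "Ck k f" shows "Ck k (\<lambda>x. f (x + a))"
  using assms
proof (induction k arbitrary: f)
  case 0
  then show ?case by (auto intro!: continuous_on_compose2[of UNIV f] continuous_intros)
next
  case (Suc k)
  have "((\<lambda>x. f (x + a)) has_derivative frechet_derivative f (at (x + a))) (at x)" for x
    using Ck_has_derivative[OF Suc.prems] by (rule has_derivative_shift)
  then show ?case
    by (rule CkI) (use Suc Ck_pd in blast)
qed

lemma pd_diff:
  assumes "Ck (Suc k) f" "Ck (Suc k) g"
  shows "pd (\<lambda>x. f x - g x) e x = pd f e x - pd g e x"
  by (rule pd_eq) (rule has_derivative_diff[OF assms[THEN Ck_has_derivative]])

lemma pd_add:
  assumes "Ck (Suc k) f" "Ck (Suc k) g"
  shows "pd (\<lambda>x. f x + g x) e x = pd f e x + pd g e x"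
  by (rule pd_eq) (rule has_derivative_add[OF assms[THEN Ck_has_derivative]])

lemma pd_bilinear:
  assumes "bounded_bilinear p" "Ck (Suc k) f" "Ck (Suc k) g"
  shows "pd (\<lambda>x. p (f x) (g x)) e x = p (f x) (pd g e x) + p (pd f e x) (g x)"
  by (rule pd_eq) (rule bounded_bilinear.FDERIV[OF assms(1) assms(2,3)[THEN Ck_has_derivative]])

section \<open>Difference quotients and integration by parts\<close>

lemma has_vector_derivative_line:
  assumes "Ck (Suc k) f"
  shows "((\<lambda>t. f (x + t *\<^sub>R e)) has_vector_derivative pd f e (x + t *\<^sub>R e)) (at t within S)"
proof -
  have "((\<lambda>t. f (x + t *\<^sub>R e)) has_derivative (\<lambda>h. frechet_derivative f (at (x + t *\<^sub>R e)) (h *\<^sub>R e))) (at t within S)"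
    by (rule has_derivative_compose[of _ _ _ _ f, OF _ Ck_has_derivative[OF assms]])
      (auto intro!: derivative_eq_intros)
  moreover have "frechet_derivative f (at (x + t *\<^sub>R e)) (h *\<^sub>R e) = h *\<^sub>R pd f e (x + t *\<^sub>R e)" for h
    using has_derivative_linear[OF Ck_has_derivative[OF assms]] linear_cmul by blast
  ultimately show ?thesis by (simp add: has_vector_derivative_def)
qed

lemma difference_quotient_tendsto:
  assumes "Ck (Suc k) f"
  shows "((\<lambda>h. (f (x + h *\<^sub>R e) - f x) /\<^sub>R h) \<longlongrightarrow> pd f e x) (at 0)"
proof -
  have "((\<lambda>t. f (x + t *\<^sub>R e)) has_vector_derivative pd f e x) (at 0)"
    using has_vector_derivative_line[OF assms, of x e 0 UNIV] by simp
  then have "(\<lambda>h. norm (f (x + h *\<^sub>R e) - f x - h *\<^sub>R pd f e x) / norm h) \<midarrow>0\<rightarrow> 0"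
    by (simp add: has_vector_derivative_def has_derivative_at)
  then have "(\<lambda>h. norm ((f (x + h *\<^sub>R e) - f x) /\<^sub>R h - pd f e x)) \<midarrow>0\<rightarrow> 0"
  proof (rule Lim_transform_eventually)
    show "\<forall>\<^sub>F h in at 0. norm (f (x + h *\<^sub>R e) - f x - h *\<^sub>R pd f e x) / norm h
        = norm ((f (x + h *\<^sub>R e) - f x) /\<^sub>R h - pd f e x)"
    proof (rule eventually_at_filter[THEN iffD2], rule always_eventually, intro allI impI)
      fix h :: real assume "h \<noteq> 0"
      then have "(f (x + h *\<^sub>R e) - f x) /\<^sub>R h - pd f e x = (f (x + h *\<^sub>R e) - f x - h *\<^sub>R pd f e x) /\<^sub>R h"
        by (simp add: algebra_simps)
      then show "norm (f (x + h *\<^sub>R e) - f x - h *\<^sub>R pd f e x) / norm h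
        = norm ((f (x + h *\<^sub>R e) - f x) /\<^sub>R h - pd f e x)"
        by (simp add: divide_inverse)
    qed
  qed
  then show ?thesis
    using tendsto_norm_zero_iff LIM_zero_iff by blast
qed

lemma increment_bound:
  assumes "Ck (Suc k) f" and "\<And>t. \<bar>t\<bar> \<le> \<bar>h\<bar> \<Longrightarrow> norm (pd f e (x + t *\<^sub>R e)) \<le> L"
  shows "norm (f (x + h *\<^sub>R e) - f x) \<le> L * \<bar>h\<bar>"
proof -
  have "norm (f (x + h *\<^sub>R e) - f (x + 0 *\<^sub>R e)) \<le> L * norm (h - 0)"
  proof (rule differentiable_bound[where f = "\<lambda>t. f (x + t *\<^sub>R e)" and S = "{t. \<bar>t\<bar> \<le> \<bar>h\<bar>}"
        and f' = "\<lambda>t s. s *\<^sub>R pd f e (x + t *\<^sub>R e)"])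
    show "convex {t. \<bar>t\<bar> \<le> \<bar>h\<bar>}"
    proof -
      have "{t. \<bar>t\<bar> \<le> \<bar>h\<bar>} = cball 0 \<bar>h\<bar>" by (auto simp: dist_norm)
      then show ?thesis by simp
    qed
    show "((\<lambda>t. f (x + t *\<^sub>R e)) has_derivative (\<lambda>s. s *\<^sub>R pd f e (x + t *\<^sub>R e)))
        (at t within {t. \<bar>t\<bar> \<le> \<bar>h\<bar>})" for t
      using has_vector_derivative_line[OF assms(1)] by (simp add: has_vector_derivative_def)
    show "onorm (\<lambda>s. s *\<^sub>R pd f e (x + t *\<^sub>R e)) \<le> L" if "t \<in> {t. \<bar>t\<bar> \<le> \<bar>h\<bar>}" for t
      using assms(2)[of t] that by (intro onorm_le) (simp add: mult.commute[of L] mult_left_mono)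
  qed auto
  then show ?thesis by simp
qed

lemma continuous_bounded_on_cball:
  fixes f :: "'a::euclidean_space \<Rightarrow> 'b::real_normed_vector"
  assumes "continuous_on UNIV f"
  obtains L where "L > 0" "\<And>x. norm x \<le> r \<Longrightarrow> norm (f x) \<le> L"
proof -
  have "compact (f ` cball 0 r)"
    using assms continuous_on_subset by (intro compact_continuous_image) auto
  then have "bounded (f ` cball 0 r)" by (rule compact_imp_bounded)
  then show thesis using that by (auto simp: bounded_pos)
qed

lemma integrable_continuous_bounded_support:
  fixes f :: "'a::euclidean_space \<Rightarrow> 'b::euclidean_space"
  assumes "continuous_on UNIV f" and "\<And>x. norm x > r \<Longrightarrow> f x = 0"
  shows "integrable lborel f"
proof -
  have "integrable lborel (\<lambda>x. indicator (cball 0 r) x *\<^sub>R f x)"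
    by (rule borel_integrable_compact) (auto intro: continuous_on_subset[OF assms(1)])
  moreover have "(\<lambda>x. indicator (cball 0 r) x *\<^sub>R f x) = f"
    using assms(2) by (auto simp: indicator_def fun_eq_iff not_le)
  ultimately show ?thesis by simp
qed

lemma pd_bounded_support:
  assumes "\<And>x. norm x > r \<Longrightarrow> f x = 0" and "norm x > r"
  shows "pd f e x = 0"
proof (rule pd_eq)
  have "open {x::'a. norm x > r}" by (intro open_Collect_less continuous_intros)
  then show "(f has_derivative (\<lambda>_. 0)) (at x)"
    by (rule has_derivative_transform_within_open[OF has_derivative_const[of 0]]) (use assms in auto)
qed

text \<open>Dominated convergence: on a bounded set the difference quotients of \<open>f\<close> are bounded by the maximum of the
  derivative on a slightly larger set.\<close>

lemma integral_difference_quotient_tendsto: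
  fixes p :: "'b::euclidean_space \<Rightarrow> 'c::euclidean_space \<Rightarrow> 'd::euclidean_space"
    and m :: "'a::euclidean_space \<Rightarrow> 'b"
  assumes p: "bounded_bilinear p" and f: "Ck (Suc k) f" and e: "e \<in> Basis"
    and m: "continuous_on (cball 0 r) m" "\<And>x. norm x > r \<Longrightarrow> m x = 0"
    and h: "h \<longlonglongrightarrow> 0" "\<And>n. h n \<noteq> 0" "\<And>n. \<bar>h n\<bar> \<le> (1::real)"
  shows "(\<lambda>n. LINT x|lborel. p (m x) ((f (x + h n *\<^sub>R e) - f x) /\<^sub>R h n))
     \<longlonglongrightarrow> (LINT x|lborel. p (m x) (pd f e x))"
proof -
  interpret bounded_bilinear p by fact
  obtain K where K: "K > 0" "\<And>a b. norm (p a b) \<le> norm a * norm b * K"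
    using pos_bounded by blast
  obtain L where L: "L > 0" "\<And>x. norm x \<le> r + 1 \<Longrightarrow> norm (pd f e x) \<le> L"
    using continuous_bounded_on_cball[OF Ck_pd_continuous[OF f e]] by blast
  have "compact (m ` cball 0 r)"
    using m(1) by (intro compact_continuous_image) auto
  then obtain M where M: "M > 0" "\<And>x. norm x \<le> r \<Longrightarrow> norm (m x) \<le> M"
    using compact_imp_bounded bounded_pos by (metis imageI mem_cball_0)
  have mm: "m \<in> borel_measurable borel"
  proof -
    have "(\<lambda>x. indicator (cball 0 r) x *\<^sub>R m x) \<in> borel_measurable borel"
      by (rule borel_measurable_continuous_on_indicator) (use m(1) in auto)
    moreover have "(\<lambda>x. indicator (cball 0 r) x *\<^sub>R m x) = m"
      using m(2) by (auto simp: indicator_def fun_eq_iff not_le)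
    ultimately show ?thesis by simp
  qed
  have pm: "(\<lambda>x. p (m x) (g x)) \<in> borel_measurable borel" if "continuous_on UNIV g" for g
  proof -
    have c: "continuous_on UNIV (\<lambda>z. p (fst z) (snd z))"
      by (intro continuous_on continuous_intros)
    have "g \<in> borel_measurable borel" using that by (rule borel_measurable_continuous_onI)
    then show ?thesis
      using borel_measurable_continuous_Pair[OF mm _ c] by blast
  qed
  show ?thesis
  proof (rule integral_dominated_convergence[where w = "\<lambda>x. indicator (cball 0 r) x *\<^sub>R (M * L * K)"])
    show "(\<lambda>x. p (m x) (pd f e x)) \<in> borel_measurable lborel"
      using pm[OF Ck_pd_continuous[OF f e]] by simp
    show "(\<lambda>x. p (m x) ((f (x + h n *\<^sub>R e) - f x) /\<^sub>R h n)) \<in> borel_measurable lborel" for n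
    proof -
      have "continuous_on UNIV (\<lambda>x. (f (x + h n *\<^sub>R e) - f x) /\<^sub>R h n)"
        using Ck_continuous[OF f] Ck_continuous[OF Ck_shift[OF f]] by (intro continuous_intros) auto
      from pm[OF this] show ?thesis by simp
    qed
    show "integrable lborel (\<lambda>x::'a. indicator (cball 0 r) x *\<^sub>R (M * L * K))"
      by (rule borel_integrable_compact) auto
    show "AE x in lborel. (\<lambda>n. p (m x) ((f (x + h n *\<^sub>R e) - f x) /\<^sub>R h n)) \<longlonglongrightarrow> p (m x) (pd f e x)"
    proof (rule AE_I2)
      fix x
      have "filterlim h (at 0) sequentially"
        using h by (auto simp: filterlim_at)
      from filterlim_compose[OF difference_quotient_tendsto[OF f] this]
      show "(\<lambda>n. p (m x) ((f (x + h n *\<^sub>R e) - f x) /\<^sub>R h n)) \<longlonglongrightarrow> p (m x) (pd f e x)"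
        by (intro tendsto) auto
    qed
    show "AE x in lborel. norm (p (m x) ((f (x + h n *\<^sub>R e) - f x) /\<^sub>R h n))
        \<le> indicator (cball 0 r) x *\<^sub>R (M * L * K)" for n
    proof (rule AE_I2)
      fix x :: 'a
      show "norm (p (m x) ((f (x + h n *\<^sub>R e) - f x) /\<^sub>R h n)) \<le> indicator (cball 0 r) x *\<^sub>R (M * L * K)"
      proof (cases "norm x \<le> r")
        case True
        have "norm (f (x + h n *\<^sub>R e) - f x) \<le> L * \<bar>h n\<bar>"
        proof (rule increment_bound[OF f])
          fix t assume t: "\<bar>t\<bar> \<le> \<bar>h n\<bar>"
          have "norm (x + t *\<^sub>R e) \<le> norm x + \<bar>t\<bar>"
            using norm_triangle_ineq[of x "t *\<^sub>R e"] e by simp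
          then show "norm (pd f e (x + t *\<^sub>R e)) \<le> L"
            using t h(3)[of n] True by (intro L) linarith
        qed
        then have "norm ((f (x + h n *\<^sub>R e) - f x) /\<^sub>R h n) \<le> L"
          using h(2)[of n] by (simp add: inverse_eq_divide pos_divide_le_eq)
        then have "norm (m x) * norm ((f (x + h n *\<^sub>R e) - f x) /\<^sub>R h n) * K \<le> M * L * K"
          using M L K(1) True by (intro mult_mono mult_right_mono) auto
        then show ?thesis
          using K(2)[of "m x" "(f (x + h n *\<^sub>R e) - f x) /\<^sub>R h n"] True by simp
      next
        case False
        then show ?thesis using m(2) by (simp add: zero_left)
      qed
    qed
  qed
qed

lemma integral_shift:
  fixes f :: "'a::euclidean_space \<Rightarrow> 'b::euclidean_space"
  assumes "f \<in> borel_measurable borel"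
  shows "(LINT x|lborel. f (x + a)) = (LINT x|lborel. f x)"
proof -
  have "(LINT x|lborel. f x) = (LINT x|distr lborel borel ((+) a). f x)"
    by (simp add: lborel_distr_plus)
  also have "\<dots> = (LINT x|lborel. f (a + x))"
    by (rule integral_distr) (use assms in auto)
  finally show ?thesis by (simp add: add.commute)
qed

text \<open>By translation invariance the integral of every difference quotient of \<open>f\<close> vanishes.\<close>

lemma integral_pd_eq_0:
  fixes f :: "'a::euclidean_space \<Rightarrow> 'b::euclidean_space"
  assumes f: "Ck (Suc k) f" and e: "e \<in> Basis" and supp: "\<And>x. norm x > r \<Longrightarrow> f x = 0"
  shows "(LINT x|lborel. pd f e x) = 0"
proof -
  \<comment> \<open>A weight that is 1 wherever a difference quotient with increment at most 1 can be nonzero.\<close>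
  define m :: "'a \<Rightarrow> real" where "m = indicator (cball 0 (r + 1))"
  define h :: "nat \<Rightarrow> real" where "h = (\<lambda>n. 1 / Suc n)"
  have h: "h \<longlonglongrightarrow> 0" "h n \<noteq> 0" "\<bar>h n\<bar> \<le> 1" for n
    unfolding h_def using LIMSEQ_Suc[OF lim_1_over_n[where 'a=real]] by auto
  have lim: "(\<lambda>n. LINT x|lborel. m x *\<^sub>R ((f (x + h n *\<^sub>R e) - f x) /\<^sub>R h n)) \<longlonglongrightarrow> (LINT x|lborel. m x *\<^sub>R pd f e x)"
  proof (rule integral_difference_quotient_tendsto[OF bounded_bilinear_scaleR f e, where r = "r + 1"])
    show "continuous_on (cball 0 (r + 1)) m"
      by (rule continuous_on_eq[OF continuous_on_const[of _ 1]]) (simp add: m_def)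
  qed (auto simp: m_def h)
  have mo: "m x *\<^sub>R g x = g x" if "\<And>x. norm x > r + 1 \<Longrightarrow> g x = 0" for x and g :: "'a \<Rightarrow> 'b"
    using that by (auto simp: m_def indicator_def not_le)
  have "m x *\<^sub>R ((f (x + h n *\<^sub>R e) - f x) /\<^sub>R h n) = (f (x + h n *\<^sub>R e) - f x) /\<^sub>R h n" for x n
  proof (rule mo)
    fix x :: 'a assume "norm x > r + 1"
    moreover have "norm x \<le> norm (x + h n *\<^sub>R e) + \<bar>h n\<bar>"
      using norm_triangle_ineq4[of "x + h n *\<^sub>R e" "h n *\<^sub>R e"] e by simp
    ultimately have "norm x > r" "norm (x + h n *\<^sub>R e) > r" using h(3)[of n] by auto
    then show "(f (x + h n *\<^sub>R e) - f x) /\<^sub>R h n = 0" using supp by simp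
  qed
  moreover have "(LINT x|lborel. (f (x + h n *\<^sub>R e) - f x) /\<^sub>R h n) = 0" for n
  proof -
    have i: "integrable lborel f"
      using integrable_continuous_bounded_support[OF Ck_continuous[OF f] supp] .
    have i': "integrable lborel (\<lambda>x. f (x + h n *\<^sub>R e))"
    proof (rule integrable_continuous_bounded_support[OF Ck_continuous[OF Ck_shift[OF f]], of "r + 1"])
      fix x :: 'a assume "norm x > r + 1"
      moreover have "norm x \<le> norm (x + h n *\<^sub>R e) + \<bar>h n\<bar>"
        using norm_triangle_ineq4[of "x + h n *\<^sub>R e" "h n *\<^sub>R e"] e by simp
      ultimately have "norm (x + h n *\<^sub>R e) > r" using h(3)[of n] by auto
      then show "f (x + h n *\<^sub>R e) = 0" using supp by simp
    qed
    show ?thesis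
      using i i' integral_shift[of f "h n *\<^sub>R e"] borel_measurable_integrable[OF i] by simp
  qed
  ultimately have "(LINT x|lborel. m x *\<^sub>R ((f (x + h n *\<^sub>R e) - f x) /\<^sub>R h n)) = 0" for n
    by presburger
  then have "(LINT x|lborel. m x *\<^sub>R pd f e x) = 0"
    using lim by (simp only: LIMSEQ_const_iff)
  moreover have "m x *\<^sub>R pd f e x = pd f e x" for x
    by (rule mo) (use pd_bounded_support[of r f, OF supp] in auto)
  ultimately show ?thesis by simp
qed

lemma integral_by_parts:
  fixes p :: "'b::euclidean_space \<Rightarrow> 'c::euclidean_space \<Rightarrow> 'd::euclidean_space"
    and f :: "'a::euclidean_space \<Rightarrow> 'b"
  assumes p: "bounded_bilinear p" and f: "Ck (Suc k) f" and g: "Ck (Suc k) g" and e: "e \<in> Basis"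
    and supp: "\<And>x. norm x > r \<Longrightarrow> f x = 0"
  shows "(LINT x|lborel. p (f x) (pd g e x)) = - (LINT x|lborel. p (pd f e x) (g x))"
proof -
  interpret bounded_bilinear p by fact
  have s: "pd f e x = 0" if "norm x > r" for x
    using pd_bounded_support[of r f, OF supp that] .
  have "(LINT x|lborel. p (f x) (pd g e x) + p (pd f e x) (g x)) = 0"
    using integral_pd_eq_0[OF Ck_bilinear[OF p f g] e, of r] supp
    by (simp add: pd_bilinear[OF p f g] zero_left)
  moreover have "integrable lborel (\<lambda>x. p (f x) (pd g e x))"
    by (rule integrable_continuous_bounded_support[of _ r])
      (auto simp: supp zero_left intro!: continuous_on Ck_continuous[OF f] Ck_pd_continuous[OF g e])
  moreover have "integrable lborel (\<lambda>x. p (pd f e x) (g x))"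
    by (rule integrable_continuous_bounded_support[of _ r])
      (auto simp: s zero_left intro!: continuous_on Ck_continuous[OF g] Ck_pd_continuous[OF f e])
  ultimately show ?thesis by (simp add: eq_neg_iff_add_eq_0)
qed

text \<open>Formally both sides equal minus the integral of \<open>p G (\<partial>\<^sub>a \<partial>\<^sub>b W)\<close>. If the derivative of \<open>W\<close>
  in direction \<open>a\<close> is replaced by a difference quotient, integration by parts in direction \<open>b\<close> and a translation
  move the increment from \<open>W\<close> to \<open>G\<close>; thus second derivatives of \<open>W\<close> are never interchanged.\<close>

lemma integral_cross_derivatives:
  fixes p :: "'b::euclidean_space \<Rightarrow> 'c::euclidean_space \<Rightarrow> 'd::euclidean_space"
    and G :: "'a::euclidean_space \<Rightarrow> 'b"
  assumes p: "bounded_bilinear p" and G: "Ck (Suc 0) G" and W: "Ck (Suc (Suc 0)) W"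
    and a: "a \<in> Basis" and b: "b \<in> Basis"
    and supp: "\<And>x. norm x > r \<Longrightarrow> G x = 0"
  shows "(LINT x|lborel. p (pd G a x) (pd W b x)) = (LINT x|lborel. p (pd G b x) (pd W a x))"
proof -
  interpret bounded_bilinear p by fact
  define h :: "nat \<Rightarrow> real" where "h = (\<lambda>n. 1 / Suc n)"
  have h: "h \<longlonglongrightarrow> 0" "h n \<noteq> 0" "\<bar>h n\<bar> \<le> 1" for n
    unfolding h_def using LIMSEQ_Suc[OF lim_1_over_n[where 'a=real]] by auto
  have W1: "Ck (Suc 0) W" using W Ck_Suc_imp by blast
  have s: "pd G e x = 0" if "norm x > r" for x e
    using pd_bounded_support[of r G, OF supp that] .
  define m where "m = (\<lambda>x. indicat_real (cball 0 (r + 1)) x *\<^sub>R pd W b x)"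
  have shift0: "G (x + c *\<^sub>R a) = 0" if "norm x > r + 1" "\<bar>c\<bar> \<le> 1" for x c
  proof -
    have "norm x \<le> norm (x + c *\<^sub>R a) + \<bar>c\<bar>"
      using norm_triangle_ineq4[of "x + c *\<^sub>R a" "c *\<^sub>R a"] a by simp
    then show ?thesis using supp that by simp
  qed
  have cW: "continuous_on UNIV (pd W b)" using Ck_pd_continuous[OF W b] .
  have lim1: "(\<lambda>n. LINT x|lborel. p (pd G b x) ((W (x + h n *\<^sub>R a) - W x) /\<^sub>R h n))
     \<longlonglongrightarrow> (LINT x|lborel. p (pd G b x) (pd W a x))"
    by (rule integral_difference_quotient_tendsto[OF p W1 a _ s h])
      (auto intro: continuous_on_subset[OF Ck_pd_continuous[OF G b]])
  have lim2: "(\<lambda>n. LINT x|lborel. p ((G (x + - h n *\<^sub>R a) - G x) /\<^sub>R - h n) (m x))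
     \<longlonglongrightarrow> (LINT x|lborel. p (pd G a x) (m x))"
  proof (rule integral_difference_quotient_tendsto[OF bounded_bilinear.flip[OF p] G a, where r = "r + 1"])
    show "continuous_on (cball 0 (r + 1)) m"
      by (rule continuous_on_eq[OF continuous_on_subset[OF cW]]) (auto simp: m_def)
    show "(\<lambda>n. - h n) \<longlonglongrightarrow> 0" using tendsto_minus[OF h(1)] by simp
  qed (auto simp: m_def h)
  have "p (pd G a x) (m x) = p (pd G a x) (pd W b x)" for x
    using s[of x a] by (auto simp: m_def indicator_def zero_left not_le)
  moreover have "(LINT x|lborel. p ((G (x + - h n *\<^sub>R a) - G x) /\<^sub>R - h n) (m x))
      = (LINT x|lborel. p (pd G b x) ((W (x + h n *\<^sub>R a) - W x) /\<^sub>R h n))" for n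
  proof -
    let ?h = "h n"
    define D where "D = (\<lambda>x. (W (x + ?h *\<^sub>R a) - W x) /\<^sub>R ?h)"
    have D: "Ck (Suc 0) D" unfolding D_def
      by (intro Ck_linear_image[OF bounded_linear_scaleR_right] Ck_diff Ck_shift W1)
    have pdD: "pd D b x = (pd W b (x + ?h *\<^sub>R a) - pd W b x) /\<^sub>R ?h" for x
      unfolding D_def
      by (rule pd_eq) (intro bounded_linear.has_derivative[OF bounded_linear_scaleR_right] has_derivative_diff
         has_derivative_shift Ck_has_derivative[OF W1])
    have iG: "integrable lborel (\<lambda>x. p (G (x + c *\<^sub>R a)) (pd W b (x + d *\<^sub>R a)))" if "\<bar>c\<bar> \<le> 1" for c d
      using that by (intro integrable_continuous_bounded_support[of _ "r + 1"] continuous_on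
          Ck_continuous[OF Ck_shift[OF G]] Ck_continuous[OF Ck_shift[OF Ck_pd[OF W b]]])
        (auto simp: shift0 zero_left)
    have "(LINT x|lborel. p (pd G b x) (D x)) = - (LINT x|lborel. p (G x) (pd D b x))"
      using integral_by_parts[OF p G D b supp] by simp
    also have "\<dots> = - ((LINT x|lborel. p (G x) (pd W b (x + ?h *\<^sub>R a))) - (LINT x|lborel. p (G x) (pd W b x))) /\<^sub>R ?h"
      using iG[of 0 "?h"] iG[of 0 0] by (simp add: pdD scaleR_right diff_right scaleR_diff_right)
    also have "(LINT x|lborel. p (G x) (pd W b (x + ?h *\<^sub>R a))) = (LINT x|lborel. p (G (x - ?h *\<^sub>R a)) (pd W b x))"
      using integral_shift[of "\<lambda>x. p (G (x - ?h *\<^sub>R a)) (pd W b x)" "?h *\<^sub>R a"]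
         borel_measurable_integrable[OF iG[of "- ?h" 0]] h(3)[of n] by simp
    also have "- ((LINT x|lborel. p (G (x - ?h *\<^sub>R a)) (pd W b x)) - (LINT x|lborel. p (G x) (pd W b x))) /\<^sub>R ?h
       = (LINT x|lborel. p ((G (x + - ?h *\<^sub>R a) - G x) /\<^sub>R - ?h) (pd W b x))"
      using iG[of "- ?h" 0] iG[of 0 0] h(3)[of n] by (simp add: scaleR_left diff_left minus_left algebra_simps)
    also have "\<dots> = (LINT x|lborel. p ((G (x + - ?h *\<^sub>R a) - G x) /\<^sub>R - ?h) (m x))"
    proof (rule Bochner_Integration.integral_cong[OF refl])
      fix x
      show "p ((G (x + - ?h *\<^sub>R a) - G x) /\<^sub>R - ?h) (pd W b x) = p ((G (x + - ?h *\<^sub>R a) - G x) /\<^sub>R - ?h) (m x)"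
        using shift0[of x "- ?h"] shift0[of x 0] h(3)[of n]
        by (cases "norm x > r + 1") (auto simp: m_def indicator_def not_less zero_left)
    qed
    finally show ?thesis by (simp add: D_def)
  qed
  ultimately show ?thesis
    using lim1 lim2 LIMSEQ_unique by simp
qed

section \<open>Weak derivatives of continuously differentiable functions\<close>

lemma integral_lebesgue_on_support:
  fixes f :: "'a::euclidean_space \<Rightarrow> 'b::euclidean_space"
  assumes "f \<in> borel_measurable borel" "\<Omega> \<in> sets lebesgue" "\<And>x. x \<notin> \<Omega> \<Longrightarrow> f x = 0"
  shows "(LINT x|lebesgue_on \<Omega>. f x) = (LINT x|lborel. f x)"
proof -
  have "indicator \<Omega> x *\<^sub>R f x = f x" for x using assms(3) by (auto simp: indicator_def)
  then show ?thesis
    using assms(1,2) by (simp add: integral_restrict_space integral_completion)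
qed

lemma test_function_Ck: "\<phi> \<in> test_functions \<Omega> \<Longrightarrow> Ck k \<phi>"
  by (simp add: test_functions_def smooth_def)

lemma test_function_zero: "\<phi> \<in> test_functions \<Omega> \<Longrightarrow> x \<notin> \<Omega> \<Longrightarrow> \<phi> x = 0"
  using closure_subset[of "{x. \<phi> x \<noteq> 0}"] by (auto simp: test_functions_def)

lemma test_function_pd_zero:
  assumes "\<phi> \<in> test_functions \<Omega>" "x \<notin> \<Omega>" shows "pd \<phi> e x = 0"
proof (rule pd_eq)
  let ?S = "closure {x. \<phi> x \<noteq> 0}"
  have "open (- ?S)" "x \<in> - ?S" using assms by (auto simp: test_functions_def)
  then show "(\<phi> has_derivative (\<lambda>_. 0)) (at x)"
  proof (rule has_derivative_transform_within_open[OF has_derivative_const[of 0]])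
    show "0 = \<phi> y" if "y \<in> - ?S" for y using that closure_subset[of "{x. \<phi> x \<noteq> 0}"] by auto
  qed
qed

lemma test_function_bounded_support:
  assumes "\<phi> \<in> test_functions \<Omega>"
  obtains r where "\<And>x. norm x > r \<Longrightarrow> \<phi> x = 0"
proof -
  have "bounded (closure {x. \<phi> x \<noteq> 0})"
    using assms by (auto simp: test_functions_def compact_imp_bounded)
  then obtain r where "\<forall>x\<in>closure {x. \<phi> x \<noteq> 0}. norm x \<le> r" by (auto simp: bounded_iff)
  then show thesis using that[of r] closure_subset[of "{x. \<phi> x \<noteq> 0}"] by force
qed

lemma test_function_bounded:
  assumes "\<phi> \<in> test_functions \<Omega>" "e \<in> Basis"
  obtains B where "B > 0" "\<And>x. \<bar>\<phi> x\<bar> \<le> B" "\<And>x. \<bar>pd \<phi> e x\<bar> \<le> B"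
proof -
  obtain r where r: "\<And>x. norm x > r \<Longrightarrow> \<phi> x = 0" by (rule test_function_bounded_support[OF assms(1)]) blast
  obtain B1 where B1: "B1 > 0" "\<And>x. norm x \<le> r \<Longrightarrow> norm (\<phi> x) \<le> B1"
    using continuous_bounded_on_cball[OF Ck_continuous[OF test_function_Ck[OF assms(1)]]] by blast
  obtain B2 where B2: "B2 > 0" "\<And>x. norm x \<le> r \<Longrightarrow> norm (pd \<phi> e x) \<le> B2"
    using continuous_bounded_on_cball[OF Ck_pd_continuous[OF test_function_Ck[OF assms(1)] assms(2)]] by blast
  have "\<bar>\<phi> x\<bar> \<le> B1 + B2 \<and> \<bar>pd \<phi> e x\<bar> \<le> B1 + B2" for x
  proof (cases "norm x > r")
    case True
    then have "\<phi> x = 0" "pd \<phi> e x = 0" using r pd_bounded_support[of r \<phi>, OF r] by auto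
    then show ?thesis using B1(1) B2(1) by simp
  next
    case False
    then have "\<bar>\<phi> x\<bar> \<le> B1" "\<bar>pd \<phi> e x\<bar> \<le> B2" using B1(2)[of x] B2(2)[of x] by auto
    then show ?thesis using B1(1) B2(1) by linarith
  qed
  moreover have "B1 + B2 > 0" using B1(1) B2(1) by linarith
  ultimately show thesis using that by blast
qed

lemma locally_integrable_continuous:
  fixes f :: "'a::euclidean_space \<Rightarrow> 'b::euclidean_space"
  assumes "continuous_on UNIV f" shows "locally_integrable \<Omega> f"
  unfolding locally_integrable_def
proof (intro allI impI)
  fix K :: "'a set" assume "compact K \<and> K \<subseteq> \<Omega>"
  then have "integrable lborel (\<lambda>x. indicator K x *\<^sub>R f x)"
    using continuous_on_subset[OF assms] by (intro borel_integrable_compact) auto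
  then have "integrable lebesgue (\<lambda>x. indicator K x *\<^sub>R f x)"
    using borel_measurable_integrable integrable_completion by blast
  then show "f absolutely_integrable_on K" by (simp add: set_integrable_def)
qed

lemma is_weak_deriv_Ck:
  fixes f :: "'a::euclidean_space \<Rightarrow> 'b::euclidean_space"
  assumes f: "Ck (Suc k) f" and e: "e \<in> Basis" and \<Omega>: "\<Omega> \<in> sets lebesgue"
  shows "is_weak_deriv \<Omega> e f (pd f e)"
  unfolding is_weak_deriv_def
proof (intro conjI ballI)
  let ?M = "lebesgue_on \<Omega>"
  show "locally_integrable \<Omega> f" "locally_integrable \<Omega> (pd f e)"
    using locally_integrable_continuous Ck_continuous[OF f] Ck_pd_continuous[OF f e] by blast+
  fix \<phi> assume \<phi>: "\<phi> \<in> test_functions \<Omega>"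
  obtain r where r: "\<And>x. norm x > r \<Longrightarrow> \<phi> x = 0" by (rule test_function_bounded_support[OF \<phi>]) blast
  have "(LINT x|?M. pd \<phi> e x *\<^sub>R f x) = (LINT x|lborel. pd \<phi> e x *\<^sub>R f x)"
    by (rule integral_lebesgue_on_support[OF _ \<Omega>])
      (auto simp: test_function_pd_zero[OF \<phi>]
        intro!: borel_measurable_continuous_onI continuous_intros Ck_continuous[OF f]
          Ck_pd_continuous[OF test_function_Ck[OF \<phi>] e])
  moreover have "(LINT x|?M. \<phi> x *\<^sub>R pd f e x) = (LINT x|lborel. \<phi> x *\<^sub>R pd f e x)"
    by (rule integral_lebesgue_on_support[OF _ \<Omega>])
      (auto simp: test_function_zero[OF \<phi>]
        intro!: borel_measurable_continuous_onI continuous_intros Ck_pd_continuous[OF f e]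
          Ck_continuous[OF test_function_Ck[OF \<phi>]])
  ultimately show "(LINT x|?M. pd \<phi> e x *\<^sub>R f x) = - (LINT x|?M. \<phi> x *\<^sub>R pd f e x)"
    using integral_by_parts[OF bounded_bilinear_scaleR test_function_Ck[OF \<phi>] f e r] by simp
qed

section \<open>Smooth bump functions\<close>

text \<open>The family \<open>t\<^sup>-\<^sup>n exp (-1/t)\<close> is closed under differentiation up to linear combinations, which makes the
  smoothness of the usual flat function an induction on the order of differentiability.\<close>

definition bump :: "nat \<Rightarrow> real \<Rightarrow> real" where
  "bump n t = (if t > 0 then inverse t ^ n * exp (- inverse t) else 0)"

lemma bump_tendsto_0: "(bump n \<longlongrightarrow> 0) (at 0)"
proof -
  have "((\<lambda>x. x ^ n / exp x) \<longlongrightarrow> (0::real)) at_top" by (rule tendsto_power_div_exp_0)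
  from filterlim_compose[OF this filterlim_inverse_at_top_right]
  have "((\<lambda>t::real. inverse t ^ n / exp (inverse t)) \<longlongrightarrow> 0) (at_right 0)" .
  then have "(bump n \<longlongrightarrow> 0) (at_right 0)"
    by (rule Lim_transform_eventually)
      (auto simp: bump_def eventually_at_filter exp_minus field_simps intro!: always_eventually)
  moreover have "(bump n \<longlongrightarrow> 0) (at_left 0)"
    by (rule Lim_transform_eventually[OF tendsto_const])
      (auto simp: bump_def eventually_at_filter intro!: always_eventually)
  ultimately show ?thesis by (simp add: filterlim_at_split)
qed

lemma DERIV_bump: "(bump n has_real_derivative (- real n * bump (Suc n) t + bump (Suc (Suc n)) t)) (at t)"
proof -
  consider "t < 0" | "t = 0" | "t > 0" by linarith
  then show ?thesis
  proof cases
    case 1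
    have "((\<lambda>_. 0) has_real_derivative 0) (at t)" by simp
    then have "(bump n has_real_derivative 0) (at t)"
      by (rule has_field_derivative_transform_within_open[of _ _ _ "{..<0}"]) (use 1 in \<open>auto simp: bump_def\<close>)
    then show ?thesis using 1 by (simp add: bump_def)
  next
    case 2
    have "((\<lambda>h. (bump n (0 + h) - bump n 0) / h) \<longlongrightarrow> 0) (at 0)"
      by (rule Lim_transform_eventually[OF bump_tendsto_0[of "Suc n"]])
        (auto simp: bump_def eventually_at_filter field_simps intro!: always_eventually)
    then have "(bump n has_real_derivative 0) (at 0)" by (simp add: DERIV_def)
    then show ?thesis using 2 by (simp add: bump_def)
  next
    case 3
    have "((\<lambda>t. inverse t ^ n * exp (- inverse t)) has_real_derivative
       (- real n * bump (Suc n) t + bump (Suc (Suc n)) t)) (at t)"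
    proof (cases n)
      case 0
      then show ?thesis
        using 3 by (auto intro!: derivative_eq_intros simp: bump_def power2_eq_square)
    next
      case (Suc m)
      show ?thesis
      proof -
        have "((\<lambda>t. inverse t ^ Suc m * exp (- inverse t)) has_real_derivative
          (of_nat (Suc m) * (inverse t ^ m * - (inverse t * inverse t)) * exp (- inverse t)
            + inverse t ^ Suc m * (exp (- inverse t) * (inverse t * inverse t)))) (at t)"
          using 3 by (auto intro!: derivative_eq_intros simp: power2_eq_square simp del: of_nat_Suc power_Suc)
        then show ?thesis using 3 Suc by (simp add: bump_def algebra_simps)
      qed
    qed
    then show ?thesis
      by (rule has_field_derivative_transform_within_open[of _ _ _ "{0<..}"]) (use 3 in \<open>auto simp: bump_def\<close>)
  qed
qed

lemma Ck_bump:
  assumes "smooth h"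
  shows "Ck k (\<lambda>x. bump n (h x))"
proof (induction k arbitrary: n)
  case 0
  have "continuous_on UNIV (bump n)"
    by (rule DERIV_continuous_on[OF DERIV_bump[THEN has_field_derivative_at_within]])
  then show ?case
    using assms Ck_continuous by (auto simp: smooth_def intro: continuous_on_compose2)
next
  case (Suc k)
  have h: "Ck j h" for j using assms by (simp add: smooth_def)
  have "((\<lambda>x. bump n (h x)) has_derivative
      (\<lambda>e. (- real n * bump (Suc n) (h x) + bump (Suc (Suc n)) (h x)) * pd h e x)) (at x)" for x
    using has_derivative_compose[OF Ck_has_derivative[OF h] DERIV_bump[unfolded has_field_derivative_def]] .
  then show ?case
    by (rule CkI) (intro Ck_mult[OF Ck_add[OF Ck_mult[OF Ck_const]]] Suc Ck_pd h)
qed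

lemma Ck_prod:
  fixes f :: "'i \<Rightarrow> 'a::euclidean_space \<Rightarrow> real"
  assumes "finite I" "\<And>i. i \<in> I \<Longrightarrow> Ck k (f i)"
  shows "Ck k (\<lambda>x. \<Prod>i\<in>I. f i x)"
  using assms by (induction I) (auto intro: Ck_const Ck_mult)

text \<open>One factor for each face of the box. As \<open>exp (-1/(k t))\<close> tends to 1 for each \<open>t > 0\<close>, these functions
  tend to the indicator of the open box while staying between 0 and 1.\<close>

definition box_bump :: "'a::euclidean_space \<Rightarrow> 'a \<Rightarrow> nat \<Rightarrow> 'a \<Rightarrow> real" where
  "box_bump a b k x = (\<Prod>i\<in>Basis. bump 0 (real (Suc k) * (x \<bullet> i - a \<bullet> i)) * bump 0 (real (Suc k) * (b \<bullet> i - x \<bullet> i)))"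

lemma bump_bounds: "0 \<le> bump 0 t" "bump 0 t \<le> 1" "bump 0 t = 0 \<longleftrightarrow> t \<le> 0"
  by (auto simp: bump_def)

lemma box_bump_bounds: "0 \<le> box_bump a b k x" "box_bump a b k x \<le> 1"
  unfolding box_bump_def by (auto intro!: prod_nonneg prod_le_1 bump_bounds mult_nonneg_nonneg mult_le_one)

lemma box_bump_eq_0_iff: "box_bump a b k x = 0 \<longleftrightarrow> x \<notin> box a b"
proof -
  have "real (Suc k) * t \<le> 0 \<longleftrightarrow> t \<le> 0" for t by (simp add: mult_le_0_iff)
  then show ?thesis unfolding box_bump_def box_def by (auto simp: bump_bounds(3) not_less simp del: of_nat_Suc)
qed

lemma box_bump_tendsto: "(\<lambda>k. box_bump a b k x) \<longlonglongrightarrow> indicator (box a b) x"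
proof (cases "x \<in> box a b")
  case True
  have one: "(\<lambda>k. bump 0 (real (Suc k) * t)) \<longlonglongrightarrow> 1" if "t > 0" for t
  proof -
    have "(\<lambda>k. exp (- (inverse t * inverse (real (Suc k))))) \<longlonglongrightarrow> exp (- (inverse t * 0))"
      by (intro tendsto_intros LIMSEQ_inverse_real_of_nat)
    moreover have "bump 0 (real (Suc k) * t) = exp (- (inverse t * inverse (real (Suc k))))" for k
      using that by (simp add: bump_def)
    ultimately show ?thesis by simp
  qed
  have "(\<lambda>k. box_bump a b k x) \<longlonglongrightarrow> (\<Prod>i\<in>(Basis::'a set). 1 * 1)"
    unfolding box_bump_def
  proof (rule tendsto_prod)
    fix i :: 'a assume "i \<in> Basis"
    then have "x \<bullet> i - a \<bullet> i > 0" "b \<bullet> i - x \<bullet> i > 0" using True by (auto simp: box_def)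
    then show "(\<lambda>k. bump 0 (real (Suc k) * (x \<bullet> i - a \<bullet> i)) * bump 0 (real (Suc k) * (b \<bullet> i - x \<bullet> i))) \<longlonglongrightarrow> 1 * 1"
      by (intro tendsto_mult one)
  qed
  then show ?thesis using True by simp
next
  case False
  then have "box_bump a b k x = 0" for k using box_bump_eq_0_iff by blast
  then show ?thesis using False by simp
qed

lemma box_bump_test_function:
  assumes "cbox a b \<subseteq> \<Omega>"
  shows "box_bump a b k \<in> test_functions \<Omega>"
proof -
  have "smooth (\<lambda>x. real (Suc k) * (x \<bullet> i - a \<bullet> i))" "smooth (\<lambda>x. real (Suc k) * (b \<bullet> i - x \<bullet> i))" for i
    unfolding smooth_def
    by (intro allI Ck_mult Ck_diff Ck_const Ck_bounded_linear bounded_linear_inner_left)+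
  then have "smooth (box_bump a b k)"
    unfolding box_bump_def[abs_def] smooth_def[of "\<lambda>x. \<Prod>i\<in>Basis. _ i x"]
    by (intro allI Ck_prod Ck_mult Ck_bump) auto
  moreover have "{x. box_bump a b k x \<noteq> 0} = box a b" by (auto simp: box_bump_eq_0_iff)
  moreover have "closure (box a b) \<subseteq> cbox a b" by (simp add: closure_minimal box_subset_cbox closed_cbox)
  moreover have "compact (closure (box a b))" by (simp add: bounded_box)
  ultimately show ?thesis using assms by (auto simp: test_functions_def)
qed

section \<open>Uniqueness of weak derivatives\<close>

text \<open>The factor is zero off a compact subset of the domain, on which \<open>f\<close> is integrable.\<close>

lemma integrable_locally_integrable_mult:
  fixes f :: "'a::euclidean_space \<Rightarrow> 'b::euclidean_space"
  assumes f: "locally_integrable \<Omega> f" and K: "compact K" "K \<subseteq> \<Omega>" and \<Omega>: "\<Omega> \<in> sets lebesgue"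
    and m: "m \<in> borel_measurable borel" "\<And>x. x \<notin> K \<Longrightarrow> m x = 0" "\<And>x. \<bar>m x\<bar> \<le> B"
  shows "integrable (lebesgue_on \<Omega>) (\<lambda>x. m x *\<^sub>R f x)"
proof -
  have "integrable lebesgue (\<lambda>x. indicator K x *\<^sub>R f x)"
    using f K by (simp add: locally_integrable_def set_integrable_def)
  then have i: "integrable lebesgue (\<lambda>x. B *\<^sub>R (indicator K x *\<^sub>R f x))"
    by (rule integrable_scaleR_right)
  have mm: "m \<in> borel_measurable lebesgue" using m(1) by (simp add: measurable_completion)
  have "integrable lebesgue (\<lambda>x. m x *\<^sub>R (indicator K x *\<^sub>R f x))"
  proof (rule Bochner_Integration.integrable_bound[OF i])
    show "(\<lambda>x. m x *\<^sub>R (indicator K x *\<^sub>R f x)) \<in> borel_measurable lebesgue"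
      using mm borel_measurable_integrable[OF \<open>integrable lebesgue (\<lambda>x. indicator K x *\<^sub>R f x)\<close>]
      by (rule borel_measurable_scaleR)
    show "AE x in lebesgue. norm (m x *\<^sub>R (indicator K x *\<^sub>R f x)) \<le> norm (B *\<^sub>R (indicator K x *\<^sub>R f x))"
    proof (rule AE_I2)
      fix x
      have "\<bar>m x\<bar> \<le> \<bar>B\<bar>" using m(3)[of x] by linarith
      then show "norm (m x *\<^sub>R (indicator K x *\<^sub>R f x)) \<le> norm (B *\<^sub>R (indicator K x *\<^sub>R f x))"
        unfolding norm_scaleR by (intro mult_right_mono) auto
    qed
  qed
  moreover have "m x *\<^sub>R (indicator K x *\<^sub>R f x) = indicator \<Omega> x *\<^sub>R (m x *\<^sub>R f x)" for x
    using m(2)[of x] K(2) by (auto simp: indicator_def)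
  ultimately show ?thesis
    using \<Omega> by (simp add: integrable_restrict_space del: scaleR_scaleR)
qed

lemma integrable_test_function_mult:
  fixes f :: "'a::euclidean_space \<Rightarrow> 'b::euclidean_space"
  assumes f: "locally_integrable \<Omega> f" and \<phi>: "\<phi> \<in> test_functions \<Omega>" and \<Omega>: "\<Omega> \<in> sets lebesgue"
  shows "integrable (lebesgue_on \<Omega>) (\<lambda>x. \<phi> x *\<^sub>R f x)"
proof -
  obtain e :: 'a where e: "e \<in> Basis" using nonempty_Basis by blast
  obtain B where B: "\<And>x. \<bar>\<phi> x\<bar> \<le> B" by (rule test_function_bounded[OF \<phi> e]) blast
  show ?thesis
  proof (rule integrable_locally_integrable_mult[OF f _ _ \<Omega>, of "closure {x. \<phi> x \<noteq> 0}"])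
    show "\<phi> x = 0" if "x \<notin> closure {x. \<phi> x \<noteq> 0}" for x
      using that closure_subset[of "{x. \<phi> x \<noteq> 0}"] by auto
    show "\<phi> \<in> borel_measurable borel"
      using borel_measurable_continuous_onI[OF Ck_continuous[OF test_function_Ck[OF \<phi>]]] .
  qed (use \<phi> B in \<open>auto simp: test_functions_def\<close>)
qed

lemma integral_box_eq_0:
  fixes f :: "'a::euclidean_space \<Rightarrow> 'b::euclidean_space"
  assumes f: "locally_integrable \<Omega> f" and \<Omega>: "\<Omega> \<in> sets lebesgue"
    and zero: "\<And>\<phi>. \<phi> \<in> test_functions \<Omega> \<Longrightarrow> (LINT x|lebesgue_on \<Omega>. \<phi> x *\<^sub>R f x) = 0"
    and sub: "cbox a b \<subseteq> \<Omega>"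
  shows "(LINT x|lebesgue. indicator (box a b) x *\<^sub>R f x) = 0"
proof -
  have int: "integrable lebesgue (\<lambda>x. indicator (cbox a b) x *\<^sub>R f x)"
    using f sub by (simp add: locally_integrable_def set_integrable_def)
  have eq: "indicator \<Omega> x *\<^sub>R (box_bump a b k x *\<^sub>R f x) = box_bump a b k x *\<^sub>R (indicator (cbox a b) x *\<^sub>R f x)" for k x
    using box_bump_eq_0_iff[of a b k x] sub box_subset_cbox[of a b] by (auto simp: indicator_def)
  have z: "(LINT x|lebesgue. box_bump a b k x *\<^sub>R (indicator (cbox a b) x *\<^sub>R f x)) = 0" for k
    using zero[OF box_bump_test_function[OF sub, of k]] \<Omega>
    by (simp add: integral_restrict_space eq del: scaleR_scaleR)
  have "(\<lambda>k. LINT x|lebesgue. box_bump a b k x *\<^sub>R (indicator (cbox a b) x *\<^sub>R f x))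
      \<longlonglongrightarrow> (LINT x|lebesgue. indicator (box a b) x *\<^sub>R (indicator (cbox a b) x *\<^sub>R f x))"
  proof (rule integral_dominated_convergence[where w = "\<lambda>x. norm (indicator (cbox a b) x *\<^sub>R f x)"])
    show "(\<lambda>x. indicator (box a b) x *\<^sub>R (indicator (cbox a b) x *\<^sub>R f x)) \<in> borel_measurable lebesgue"
      by (rule borel_measurable_scaleR[OF borel_measurable_indicator borel_measurable_integrable[OF int]]) auto
    show "(\<lambda>x. box_bump a b k x *\<^sub>R (indicator (cbox a b) x *\<^sub>R f x)) \<in> borel_measurable lebesgue" for k
    proof (rule borel_measurable_scaleR[OF _ borel_measurable_integrable[OF int]])
      have "box_bump a b k \<in> borel_measurable borel"
        using box_bump_test_function[OF subset_refl, of a b k]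
        by (intro borel_measurable_continuous_onI Ck_continuous test_function_Ck)
      then show "box_bump a b k \<in> borel_measurable lebesgue" by (simp add: measurable_completion)
    qed
    show "integrable lebesgue (\<lambda>x. norm (indicator (cbox a b) x *\<^sub>R f x))" using int by (rule integrable_norm)
    show "AE x in lebesgue. (\<lambda>k. box_bump a b k x *\<^sub>R (indicator (cbox a b) x *\<^sub>R f x))
         \<longlonglongrightarrow> indicator (box a b) x *\<^sub>R (indicator (cbox a b) x *\<^sub>R f x)"
      by (intro AE_I2 tendsto_scaleR box_bump_tendsto tendsto_const)
    show "AE x in lebesgue. norm (box_bump a b k x *\<^sub>R (indicator (cbox a b) x *\<^sub>R f x))
        \<le> norm (indicator (cbox a b) x *\<^sub>R f x)" for k
    proof (rule AE_I2)
      fix x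
      have "\<bar>box_bump a b k x\<bar> * norm (indicator (cbox a b) x *\<^sub>R f x) \<le> 1 * norm (indicator (cbox a b) x *\<^sub>R f x)"
        using box_bump_bounds[of a b k x] by (intro mult_right_mono) auto
      then show "norm (box_bump a b k x *\<^sub>R (indicator (cbox a b) x *\<^sub>R f x)) \<le> norm (indicator (cbox a b) x *\<^sub>R f x)"
        by (simp only: norm_scaleR[of "box_bump a b k x"] mult_1)
    qed
  qed
  then have "(LINT x|lebesgue. indicator (box a b) x *\<^sub>R (indicator (cbox a b) x *\<^sub>R f x)) = 0"
    by (simp only: z LIMSEQ_const_iff)
  moreover have "indicator (box a b) x *\<^sub>R (indicator (cbox a b) x *\<^sub>R f x) = indicator (box a b) x *\<^sub>R f x" for x
    using box_subset_cbox[of a b] by (auto simp: indicator_def)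
  ultimately show ?thesis by (simp del: scaleR_scaleR)
qed

text \<open>Testing with the functions \<^const>\<open>box_bump\<close> shows that the integral of \<open>f\<close> over every box in the
  domain vanishes, and almost every value of \<open>f\<close> is a limit of averages over shrinking boxes.\<close>

lemma fundamental_lemma_calculus_of_variations:
  fixes f :: "'a::euclidean_space \<Rightarrow> 'b::euclidean_space"
  assumes f: "locally_integrable \<Omega> f" and \<Omega>: "open \<Omega>"
    and zero: "\<And>\<phi>. \<phi> \<in> test_functions \<Omega> \<Longrightarrow> (LINT x|lebesgue_on \<Omega>. \<phi> x *\<^sub>R f x) = 0"
  shows "AE x in lebesgue_on \<Omega>. f x = 0"
proof -
  have \<Omega>l: "\<Omega> \<in> sets lebesgue" using \<Omega> by auto
  have box0: "integral (cbox a b) f = 0" if sub: "cbox a b \<subseteq> \<Omega>" for a b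
  proof -
    have "f absolutely_integrable_on cbox a b" using f sub by (simp add: locally_integrable_def)
    then have "f absolutely_integrable_on box a b"
      by (rule set_integrable_subset) (auto simp: box_subset_cbox)
    from set_lebesgue_integral_eq_integral(2)[OF this] show ?thesis
      using integral_box_eq_0[OF f \<Omega>l zero sub]
      by (simp add: set_lebesgue_integral_def integral_open_interval)
  qed
  have local0: "AE x in lebesgue. x \<in> cbox a b \<longrightarrow> f x = 0" if sub: "cbox a b \<subseteq> \<Omega>" for a b
  proof -
    define F where "F = (\<lambda>x. if x \<in> cbox a b then f x else 0)"
    have "f integrable_on cbox a b"
      by (rule set_lebesgue_integral_eq_integral(1)) (use f sub in \<open>simp add: locally_integrable_def\<close>)
    then have "F integrable_on UNIV" by (simp add: F_def integrable_restrict_UNIV)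
    then have "F integrable_on cbox c d" for c d using integrable_on_subcbox[of F UNIV c d] by blast
    then obtain N where N: "negligible N" "\<And>x e. x \<notin> N \<Longrightarrow> 0 < e \<Longrightarrow> \<exists>d>0. \<forall>h. 0 < h \<and> h < d \<longrightarrow>
        norm (integral (cbox x (x + h *\<^sub>R One)) F /\<^sub>R h ^ DIM('a) - F x) < e"
      by (rule integrable_ccontinuous_explicit) blast
    have F0: "f x = 0" if x: "x \<in> box a b" "x \<notin> N" for x
    proof (rule ccontr)
      assume "f x \<noteq> 0"
      then obtain d where d: "d > 0" "\<And>h. 0 < h \<Longrightarrow> h < d \<Longrightarrow>
          norm (integral (cbox x (x + h *\<^sub>R One)) F /\<^sub>R h ^ DIM('a) - F x) < norm (f x)"
        using N(2)[OF x(2), of "norm (f x)"] by auto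
      obtain r where r: "r > 0" "ball x r \<subseteq> box a b" using open_box x(1) open_contains_ball by blast
      define m where "m = norm (One::'a) + 1"
      \<comment> \<open>Small enough for the box with corner \<open>x\<close> and side \<open>h\<close> to stay inside \<open>ball x r\<close>.\<close>
      define h where "h = min (d / 2) (r / (2 * m))"
      have m: "m > 0" using norm_ge_zero[of "One::'a"] unfolding m_def by linarith
      have h: "0 < h" "h < d" using d(1) r(1) m by (auto simp: h_def)
      have "h * m \<le> r / (2 * m) * m" using m by (intro mult_right_mono) (auto simp: h_def)
      also have "\<dots> < r" using m r(1) by simp
      finally have hr: "h * norm (One::'a) + h < r" by (simp add: m_def algebra_simps)
      have "cbox x (x + h *\<^sub>R One) \<subseteq> ball x r"
      proof
        fix y assume y: "y \<in> cbox x (x + h *\<^sub>R One)"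
        have "norm (y - x) \<le> norm (h *\<^sub>R (One::'a))"
          using y h(1) by (intro norm_le_componentwise) (auto simp: mem_box inner_diff_left inner_add_left)
        then show "y \<in> ball x r" using hr h(1) by (simp add: dist_norm norm_minus_commute algebra_simps)
      qed
      then have in_box: "cbox x (x + h *\<^sub>R One) \<subseteq> cbox a b" using r(2) box_subset_cbox[of a b] by blast
      have "integral (cbox x (x + h *\<^sub>R One)) F = integral (cbox x (x + h *\<^sub>R One)) f"
        by (rule integral_cong) (use in_box in \<open>auto simp: F_def\<close>)
      also have "\<dots> = 0" using in_box sub by (intro box0) blast
      finally show False using d(2)[OF h] x(1) box_subset_cbox[of a b] by (auto simp: F_def)
    qed
    have "negligible (N \<union> (cbox a b - box a b))"
      using N(1) by (intro negligible_Un negligible_frontier_interval)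
    then have "AE x in lebesgue. x \<notin> N \<union> (cbox a b - box a b)"
      using AE_not_in negligible_iff_null_sets by blast
    then show ?thesis by eventually_elim (use F0 in auto)
  qed
  obtain \<D> where D: "countable \<D>" "\<D> \<subseteq> Pow \<Omega>" "\<And>X. X \<in> \<D> \<Longrightarrow> \<exists>a b. X = cbox a b" "\<Union>\<D> = \<Omega>"
    using open_countable_Union_open_cbox[OF \<Omega>] by metis
  have "AE x in lebesgue. \<forall>X\<in>\<D>. x \<in> X \<longrightarrow> f x = 0"
  proof (subst AE_ball_countable[OF D(1)], rule ballI)
    fix X assume X: "X \<in> \<D>"
    then obtain a b where "X = cbox a b" using D(3) by blast
    then show "AE x in lebesgue. x \<in> X \<longrightarrow> f x = 0" using local0 X D(2) by blast
  qed
  then have "AE x in lebesgue. x \<in> \<Omega> \<longrightarrow> f x = 0"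
    using D(4) by (auto elim!: eventually_mono)
  then show ?thesis using \<Omega>l by (simp add: AE_restrict_space_iff)
qed

lemma weak_deriv_unique:
  fixes u :: "'a::euclidean_space \<Rightarrow> 'b::euclidean_space"
  assumes \<Omega>: "open \<Omega>" and v: "is_weak_deriv \<Omega> e u v" and w: "is_weak_deriv \<Omega> e u w"
  shows "AE x in lebesgue_on \<Omega>. v x = w x"
proof -
  let ?M = "lebesgue_on \<Omega>"
  have l: "locally_integrable \<Omega> v" "locally_integrable \<Omega> w" using v w by (auto simp: is_weak_deriv_def)
  have "AE x in lebesgue_on \<Omega>. v x - w x = 0"
  proof (rule fundamental_lemma_calculus_of_variations[OF _ \<Omega>])
    show "locally_integrable \<Omega> (\<lambda>x. v x - w x)"
      using l by (auto simp: locally_integrable_def)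
    fix \<phi> assume \<phi>: "\<phi> \<in> test_functions \<Omega>"
    have "(LINT x|?M. \<phi> x *\<^sub>R v x) = (LINT x|?M. \<phi> x *\<^sub>R w x)"
      using v w \<phi> by (auto simp: is_weak_deriv_def)
    then show "(LINT x|?M. \<phi> x *\<^sub>R (v x - w x)) = 0"
      using integrable_test_function_mult[OF l(1) \<phi>] integrable_test_function_mult[OF l(2) \<phi>] \<Omega>
      by (simp add: scaleR_diff_right)
  qed
  then show ?thesis by (auto elim!: eventually_mono)
qed

section \<open>Convergence in the mean and in the quadratic mean\<close>

lemma L2_onD: "f \<in> L2_on \<Omega> \<Longrightarrow> f \<in> borel_measurable (lebesgue_on \<Omega>)"
  "f \<in> L2_on \<Omega> \<Longrightarrow> integrable (lebesgue_on \<Omega>) (\<lambda>x. (norm (f x))\<^sup>2)"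
  by (auto simp: L2_on_def)

lemma L2_on_dominated:
  assumes "f \<in> borel_measurable (lebesgue_on \<Omega>)" "integrable (lebesgue_on \<Omega>) g"
    and "\<And>x. x \<in> \<Omega> \<Longrightarrow> (norm (f x))\<^sup>2 \<le> g x"
  shows "f \<in> L2_on \<Omega>"
proof -
  have "AE x in lebesgue_on \<Omega>. norm ((norm (f x))\<^sup>2) \<le> norm (g x)"
    using assms(3) by (intro AE_I2) force
  then have "integrable (lebesgue_on \<Omega>) (\<lambda>x. (norm (f x))\<^sup>2)"
    using assms(1,2) by (intro Bochner_Integration.integrable_bound[OF assms(2)]) auto
  then show ?thesis using assms(1) by (simp add: L2_on_def)
qed

lemma norm_sum_sq_le: "(norm (x + y))\<^sup>2 \<le> 2 * (norm x)\<^sup>2 + 2 * (norm y)\<^sup>2"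
proof -
  have "(norm (x + y))\<^sup>2 \<le> (norm x + norm y)\<^sup>2" by (intro power_mono norm_triangle_ineq) auto
  also have "\<dots> \<le> 2 * (norm x)\<^sup>2 + 2 * (norm y)\<^sup>2"
    using zero_le_power2[of "norm x - norm y"] by (simp add: power2_sum power2_diff)
  finally show ?thesis .
qed

lemma L2_on_add:
  assumes "f \<in> L2_on \<Omega>" "g \<in> L2_on \<Omega>"
  shows "(\<lambda>x. f x + g x) \<in> L2_on \<Omega>"
proof (rule L2_on_dominated)
  show "(\<lambda>x. f x + g x) \<in> borel_measurable (lebesgue_on \<Omega>)"
    using L2_onD(1)[OF assms(1)] L2_onD(1)[OF assms(2)] by simp
  show "integrable (lebesgue_on \<Omega>) (\<lambda>x. 2 * (norm (f x))\<^sup>2 + 2 * (norm (g x))\<^sup>2)"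
    using L2_onD(2)[OF assms(1)] L2_onD(2)[OF assms(2)] by simp
qed (rule norm_sum_sq_le)

lemma L2_on_uminus: "f \<in> L2_on \<Omega> \<Longrightarrow> (\<lambda>x. - f x) \<in> L2_on \<Omega>"
  by (simp add: L2_on_def)

lemma L2_on_diff: "f \<in> L2_on \<Omega> \<Longrightarrow> g \<in> L2_on \<Omega> \<Longrightarrow> (\<lambda>x. f x - g x) \<in> L2_on \<Omega>"
  using L2_on_add[OF _ L2_on_uminus] by force

lemma integrable_norm_mult_L2:
  fixes a :: "'a::euclidean_space \<Rightarrow> 'b::euclidean_space" and b :: "'a \<Rightarrow> 'c::euclidean_space"
  assumes "a \<in> L2_on \<Omega>" "b \<in> L2_on \<Omega>"
  shows "integrable (lebesgue_on \<Omega>) (\<lambda>x. norm (a x) * norm (b x))"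
proof (rule Bochner_Integration.integrable_bound)
  let ?M = "lebesgue_on \<Omega>"
  show "integrable ?M (\<lambda>x. (norm (a x))\<^sup>2 + (norm (b x))\<^sup>2)"
    using L2_onD(2)[OF assms(1)] L2_onD(2)[OF assms(2)] by simp
  show "(\<lambda>x. norm (a x) * norm (b x)) \<in> borel_measurable ?M"
    using L2_onD(1)[OF assms(1)] L2_onD(1)[OF assms(2)] by simp
  show "AE x in lebesgue_on \<Omega>. norm (norm (a x) * norm (b x)) \<le> norm ((norm (a x))\<^sup>2 + (norm (b x))\<^sup>2)"
  proof (rule AE_I2)
    fix x
    have "2 * (norm (a x) * norm (b x)) \<le> (norm (a x))\<^sup>2 + (norm (b x))\<^sup>2"
      using zero_le_power2[of "norm (a x) - norm (b x)"] by (simp add: power2_diff)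
    moreover have "0 \<le> norm (a x) * norm (b x)" by simp
    ultimately have "norm (a x) * norm (b x) \<le> (norm (a x))\<^sup>2 + (norm (b x))\<^sup>2" by linarith
    then show "norm (norm (a x) * norm (b x)) \<le> norm ((norm (a x))\<^sup>2 + (norm (b x))\<^sup>2)"
      by simp
  qed
qed

lemma Cauchy_Schwarz_L2:
  fixes a :: "'a::euclidean_space \<Rightarrow> 'b::euclidean_space" and b :: "'a \<Rightarrow> 'c::euclidean_space"
  assumes "a \<in> L2_on \<Omega>" "b \<in> L2_on \<Omega>"
  shows "(LINT x|lebesgue_on \<Omega>. norm (a x) * norm (b x))
    \<le> sqrt (LINT x|lebesgue_on \<Omega>. (norm (a x))\<^sup>2) * sqrt (LINT x|lebesgue_on \<Omega>. (norm (b x))\<^sup>2)"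
proof -
  let ?M = "lebesgue_on \<Omega>"
  define X Y Z where "X = (LINT x|?M. (norm (a x))\<^sup>2)"
    and "Y = (LINT x|?M. (norm (b x))\<^sup>2)"
    and "Z = (LINT x|?M. norm (a x) * norm (b x))"
  have nonneg: "X \<ge> 0" "Y \<ge> 0" "Z \<ge> 0" by (auto simp: X_def Y_def Z_def)
  \<comment> \<open>The integral of \<open>(t * norm a - norm b)\<^sup>2\<close> is a nonnegative quadratic polynomial in \<open>t\<close>.\<close>
  have quad: "0 \<le> t\<^sup>2 * X - 2 * t * Z + Y" for t
  proof -
    have "0 \<le> (LINT x|?M. (t * norm (a x) - norm (b x))\<^sup>2)" by simp
    also have "\<dots> = (LINT x|?M. t\<^sup>2 * (norm (a x))\<^sup>2 - 2 * t * (norm (a x) * norm (b x)) + (norm (b x))\<^sup>2)"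
      by (intro Bochner_Integration.integral_cong) (auto simp: power2_diff power_mult_distrib algebra_simps)
    also have "\<dots> = t\<^sup>2 * X - 2 * t * Z + Y"
      unfolding X_def Y_def Z_def
      using L2_onD(2)[OF assms(1)] L2_onD(2)[OF assms(2)] integrable_norm_mult_L2[OF assms] by simp
    finally show ?thesis .
  qed
  have "Z\<^sup>2 \<le> X * Y"
  proof (cases "X = 0")
    case True
    have "Z \<le> 0"
    proof (rule ccontr)
      assume "\<not> Z \<le> 0"
      then show False using quad[of "(Y + 1) / (2 * Z)"] True by (simp add: field_simps)
    qed
    then show ?thesis using nonneg True by simp
  next
    case False
    then have X: "X > 0" using nonneg by simp
    have "0 \<le> (Z / X)\<^sup>2 * X - 2 * (Z / X) * Z + Y" by (rule quad)
    also have "\<dots> = Y - Z\<^sup>2 / X" using X by (simp add: power2_eq_square field_simps)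
    finally have "Z\<^sup>2 / X \<le> Y" by simp
    then show ?thesis using X by (simp add: pos_divide_le_eq mult.commute)
  qed
  then have "Z \<le> sqrt (X * Y)" by (rule real_le_rsqrt)
  then show ?thesis by (simp add: X_def Y_def Z_def real_sqrt_mult)
qed

definition L2_lim :: "'a::euclidean_space set \<Rightarrow> (nat \<Rightarrow> 'a \<Rightarrow> 'b::euclidean_space) \<Rightarrow> ('a \<Rightarrow> 'b) \<Rightarrow> bool" where
  "L2_lim \<Omega> A a \<longleftrightarrow> (\<forall>k. A k \<in> L2_on \<Omega>) \<and> a \<in> L2_on \<Omega> \<and>
     (\<lambda>k. LINT x|lebesgue_on \<Omega>. (norm (A k x - a x))\<^sup>2) \<longlonglongrightarrow> 0"

definition L1_lim :: "'a::euclidean_space set \<Rightarrow> (nat \<Rightarrow> 'a \<Rightarrow> 'b::euclidean_space) \<Rightarrow> ('a \<Rightarrow> 'b) \<Rightarrow> bool" where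
  "L1_lim \<Omega> A a \<longleftrightarrow> (\<forall>k. integrable (lebesgue_on \<Omega>) (A k)) \<and> integrable (lebesgue_on \<Omega>) a \<and>
     (\<lambda>k. LINT x|lebesgue_on \<Omega>. norm (A k x - a x)) \<longlonglongrightarrow> 0"

lemma tendsto_0_sandwich:
  fixes f g :: "nat \<Rightarrow> real"
  assumes "g \<longlonglongrightarrow> 0" "\<And>n. 0 \<le> f n" "\<And>n. f n \<le> g n"
  shows "f \<longlonglongrightarrow> 0"
  using tendsto_sandwich[OF always_eventually always_eventually tendsto_const assms(1), of f] assms(2,3) by blast

lemma L2_lim_add:
  assumes "L2_lim \<Omega> A a" "L2_lim \<Omega> B b"
  shows "L2_lim \<Omega> (\<lambda>k x. A k x + B k x) (\<lambda>x. a x + b x)"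
  unfolding L2_lim_def
proof (intro conjI allI)
  let ?M = "lebesgue_on \<Omega>"
  let ?I = "\<lambda>f. LINT x|?M. (norm (f x))\<^sup>2"
  have L: "(\<lambda>x. A k x - a x) \<in> L2_on \<Omega>" "(\<lambda>x. B k x - b x) \<in> L2_on \<Omega>" for k
    using assms by (auto simp: L2_lim_def intro: L2_on_diff)
  show "(\<lambda>k. LINT x|?M. (norm (A k x + B k x - (a x + b x)))\<^sup>2) \<longlonglongrightarrow> 0"
  proof (rule tendsto_0_sandwich)
    have "(\<lambda>k. 2 * ?I (\<lambda>x. A k x - a x) + 2 * ?I (\<lambda>x. B k x - b x)) \<longlonglongrightarrow> 2 * 0 + 2 * 0"
      using assms by (intro tendsto_intros) (auto simp: L2_lim_def)
    then show "(\<lambda>k. 2 * ?I (\<lambda>x. A k x - a x) + 2 * ?I (\<lambda>x. B k x - b x)) \<longlonglongrightarrow> 0" by simp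
    fix k
    have "(LINT x|?M. (norm (A k x + B k x - (a x + b x)))\<^sup>2)
      \<le> (LINT x|?M. 2 * (norm (A k x - a x))\<^sup>2 + 2 * (norm (B k x - b x))\<^sup>2)"
    proof (rule integral_mono)
      have "(\<lambda>x. (A k x - a x) + (B k x - b x)) \<in> L2_on \<Omega>" by (intro L2_on_add L)
      then show "integrable ?M (\<lambda>x. (norm (A k x + B k x - (a x + b x)))\<^sup>2)"
        by (auto dest!: L2_onD(2) simp: algebra_simps)
      show "(norm (A k x + B k x - (a x + b x)))\<^sup>2 \<le> 2 * (norm (A k x - a x))\<^sup>2 + 2 * (norm (B k x - b x))\<^sup>2" for x
        using norm_sum_sq_le[of "A k x - a x" "B k x - b x"] by (simp add: algebra_simps)
    qed (use L[THEN L2_onD(2)] in auto)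
    also have "\<dots> = 2 * ?I (\<lambda>x. A k x - a x) + 2 * ?I (\<lambda>x. B k x - b x)"
      using L[THEN L2_onD(2)] by simp
    finally show "(LINT x|?M. (norm (A k x + B k x - (a x + b x)))\<^sup>2)
       \<le> 2 * ?I (\<lambda>x. A k x - a x) + 2 * ?I (\<lambda>x. B k x - b x)" .
  qed simp
qed (use assms in \<open>auto simp: L2_lim_def intro: L2_on_add\<close>)

lemma L2_lim_uminus: "L2_lim \<Omega> A a \<Longrightarrow> L2_lim \<Omega> (\<lambda>k x. - A k x) (\<lambda>x. - a x)"
  by (auto simp: L2_lim_def norm_minus_commute intro: L2_on_uminus)

lemma L2_lim_diff:
  "L2_lim \<Omega> A a \<Longrightarrow> L2_lim \<Omega> B b \<Longrightarrow> L2_lim \<Omega> (\<lambda>k x. A k x - B k x) (\<lambda>x. a x - b x)"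
  using L2_lim_add[OF _ L2_lim_uminus] by force

lemma bilinear_measurable:
  fixes p :: "'b::euclidean_space \<Rightarrow> 'c::euclidean_space \<Rightarrow> 'd::euclidean_space"
  assumes "bounded_bilinear p" "a \<in> borel_measurable M" "b \<in> borel_measurable M"
  shows "(\<lambda>x. p (a x) (b x)) \<in> borel_measurable M"
proof -
  have c: "continuous_on UNIV (\<lambda>z. p (fst z) (snd z))"
    by (intro bounded_bilinear.continuous_on[OF assms(1)] continuous_intros)
  show ?thesis using borel_measurable_continuous_Pair[OF assms(2,3) c] by blast
qed

lemma integrable_bilinear_L2:
  fixes a :: "'a::euclidean_space \<Rightarrow> 'b::euclidean_space" and b :: "'a \<Rightarrow> 'c::euclidean_space"
    and p :: "'b \<Rightarrow> 'c \<Rightarrow> 'd::euclidean_space"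
  assumes p: "bounded_bilinear p" and ab: "a \<in> L2_on \<Omega>" "b \<in> L2_on \<Omega>"
  shows "integrable (lebesgue_on \<Omega>) (\<lambda>x. p (a x) (b x))"
proof -
  obtain K where K: "K > 0" "\<And>a b. norm (p a b) \<le> norm a * norm b * K"
    using bounded_bilinear.pos_bounded[OF p] by blast
  show ?thesis
  proof (rule Bochner_Integration.integrable_bound)
    show "integrable (lebesgue_on \<Omega>) (\<lambda>x. norm (a x) * norm (b x) * K)"
      using integrable_norm_mult_L2[OF ab] by simp
    show "AE x in lebesgue_on \<Omega>. norm (p (a x) (b x)) \<le> norm (norm (a x) * norm (b x) * K)"
      using K by (intro AE_I2) auto
  qed (rule bilinear_measurable[OF p ab[THEN L2_onD(1)]])
qed

text \<open>Expanded about the limit, the difference is a sum of three products, each with a factor that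
  tends to zero in the quadratic mean.\<close>

lemma L2_lim_bilinear:
  fixes a :: "'a::euclidean_space \<Rightarrow> 'b::euclidean_space" and b :: "'a \<Rightarrow> 'c::euclidean_space"
    and p :: "'b \<Rightarrow> 'c \<Rightarrow> 'd::euclidean_space"
  assumes p: "bounded_bilinear p" and A: "L2_lim \<Omega> A a" and B: "L2_lim \<Omega> B b"
  shows "L1_lim \<Omega> (\<lambda>k x. p (A k x) (B k x)) (\<lambda>x. p (a x) (b x))"
  unfolding L1_lim_def
proof (intro conjI allI)
  let ?M = "lebesgue_on \<Omega>"
  interpret bounded_bilinear p by fact
  have L: "A k \<in> L2_on \<Omega>" "B k \<in> L2_on \<Omega>" "a \<in> L2_on \<Omega>" "b \<in> L2_on \<Omega>" for k
    using A B by (auto simp: L2_lim_def)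
  show "integrable ?M (\<lambda>x. p (A k x) (B k x))" for k
    by (intro integrable_bilinear_L2 p L)
  show "integrable ?M (\<lambda>x. p (a x) (b x))"
    by (intro integrable_bilinear_L2 p L)
  obtain K where K: "K > 0" "\<And>a b. norm (p a b) \<le> norm a * norm b * K"
    using pos_bounded by blast
  have D: "(\<lambda>x. A k x - a x) \<in> L2_on \<Omega>" "(\<lambda>x. B k x - b x) \<in> L2_on \<Omega>" for k
    by (intro L2_on_diff L)+
  let ?n = "\<lambda>f. sqrt (LINT x|?M. (norm (f x))\<^sup>2)"
  let ?bd = "\<lambda>k. (?n (\<lambda>x. A k x - a x) * ?n (\<lambda>x. B k x - b x) + ?n (\<lambda>x. A k x - a x) * ?n b + ?n a * ?n (\<lambda>x. B k x - b x)) * K"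
  show "(\<lambda>k. LINT x|?M. norm (p (A k x) (B k x) - p (a x) (b x))) \<longlonglongrightarrow> 0"
  proof (rule tendsto_0_sandwich)
    have "(\<lambda>k. ?n (\<lambda>x. A k x - a x)) \<longlonglongrightarrow> sqrt 0" "(\<lambda>k. ?n (\<lambda>x. B k x - b x)) \<longlonglongrightarrow> sqrt 0"
    proof -
      have l: "(\<lambda>k. LINT x|?M. (norm (A k x - a x))\<^sup>2) \<longlonglongrightarrow> 0"
        "(\<lambda>k. LINT x|?M. (norm (B k x - b x))\<^sup>2) \<longlonglongrightarrow> 0"
        using A B by (auto simp: L2_lim_def)
      show "(\<lambda>k. ?n (\<lambda>x. A k x - a x)) \<longlonglongrightarrow> sqrt 0" "(\<lambda>k. ?n (\<lambda>x. B k x - b x)) \<longlonglongrightarrow> sqrt 0"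
        by (rule tendsto_real_sqrt[OF l(1)], rule tendsto_real_sqrt[OF l(2)])
    qed
    then have "?bd \<longlonglongrightarrow> (0 * 0 + 0 * ?n b + ?n a * 0) * K"
      by (intro tendsto_intros) auto
    then show "?bd \<longlonglongrightarrow> 0" by simp
    fix k
    have "(LINT x|?M. norm (p (A k x) (B k x) - p (a x) (b x)))
      \<le> (LINT x|?M. (norm (A k x - a x) * norm (B k x - b x) + norm (A k x - a x) * norm (b x) + norm (a x) * norm (B k x - b x)) * K)"
    proof (rule integral_mono)
      show "integrable ?M (\<lambda>x. norm (p (A k x) (B k x) - p (a x) (b x)))"
        by (intro integrable_norm Bochner_Integration.integrable_diff integrable_bilinear_L2 p L)
      show "integrable ?M (\<lambda>x. (norm (A k x - a x) * norm (B k x - b x) + norm (A k x - a x) * norm (b x) + norm (a x) * norm (B k x - b x)) * K)"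
        by (intro integrable_mult_left Bochner_Integration.integrable_add integrable_norm_mult_L2 L D)
      fix x
      have "p (A k x) (B k x) - p (a x) (b x) = p (A k x - a x) (B k x - b x) + p (A k x - a x) (b x) + p (a x) (B k x - b x)"
        by (simp add: diff_left diff_right)
      also have "norm \<dots> \<le> norm (p (A k x - a x) (B k x - b x)) + norm (p (A k x - a x) (b x)) + norm (p (a x) (B k x - b x))"
        by (intro norm_triangle_le add_mono norm_triangle_ineq order_refl)
      also have "\<dots> \<le> (norm (A k x - a x) * norm (B k x - b x) + norm (A k x - a x) * norm (b x) + norm (a x) * norm (B k x - b x)) * K"
        unfolding distrib_right by (intro add_mono K)
      finally show "norm (p (A k x) (B k x) - p (a x) (b x)) \<le> (norm (A k x - a x) * norm (B k x - b x) + norm (A k x - a x) * norm (b x) + norm (a x) * norm (B k x - b x)) * K" .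
    qed
    also have "\<dots> = ((LINT x|?M. norm (A k x - a x) * norm (B k x - b x))
       + (LINT x|?M. norm (A k x - a x) * norm (b x))
       + (LINT x|?M. norm (a x) * norm (B k x - b x))) * K"
      using integrable_norm_mult_L2[OF D(1)[of k] D(2)[of k]] integrable_norm_mult_L2[OF D(1)[of k] L(4)]
        integrable_norm_mult_L2[OF L(3) D(2)[of k]] by simp
    also have "\<dots> \<le> ?bd k"
      using K(1) by (intro mult_right_mono add_mono Cauchy_Schwarz_L2 L D) auto
    finally show "(LINT x|?M. norm (p (A k x) (B k x) - p (a x) (b x))) \<le> ?bd k" .
  qed simp
qed

lemma L1_lim_integral_mult:
  fixes a :: "'a::euclidean_space \<Rightarrow> 'b::euclidean_space"
  assumes A: "L1_lim \<Omega> A a" and m: "m \<in> borel_measurable (lebesgue_on \<Omega>)" "\<And>x. \<bar>m x\<bar> \<le> (B::real)"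
  shows "(\<lambda>k. LINT x|lebesgue_on \<Omega>. m x *\<^sub>R A k x) \<longlonglongrightarrow> (LINT x|lebesgue_on \<Omega>. m x *\<^sub>R a x)"
proof -
  let ?M = "lebesgue_on \<Omega>"
  have int: "integrable ?M (\<lambda>x. m x *\<^sub>R f x)" if "integrable ?M f" for f :: "'a \<Rightarrow> 'b"
  proof (rule Bochner_Integration.integrable_bound)
    show "integrable ?M (\<lambda>x. B *\<^sub>R f x)" using that by (rule integrable_scaleR_right)
    show "(\<lambda>x. m x *\<^sub>R f x) \<in> borel_measurable ?M"
      by (rule borel_measurable_scaleR[OF m(1) borel_measurable_integrable[OF that]])
    show "AE x in lebesgue_on \<Omega>. norm (m x *\<^sub>R f x) \<le> norm (B *\<^sub>R f x)"
    proof (rule AE_I2)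
      fix x show "norm (m x *\<^sub>R f x) \<le> norm (B *\<^sub>R f x)"
        unfolding norm_scaleR using m(2)[of x] by (intro mult_right_mono) auto
    qed
  qed
  have L: "integrable ?M (A k)" "integrable ?M a" for k
    using A by (auto simp: L1_lim_def)
  have d: "integrable ?M (\<lambda>x. A k x - a x)" for k using L by simp
  have "(\<lambda>k. (LINT x|?M. m x *\<^sub>R A k x) - (LINT x|?M. m x *\<^sub>R a x)) \<longlonglongrightarrow> 0"
  proof (rule tendsto_norm_zero_cancel, rule tendsto_0_sandwich)
    show "(\<lambda>k. B * (LINT x|?M. norm (A k x - a x))) \<longlonglongrightarrow> 0"
      using A tendsto_mult_right_zero by (auto simp: L1_lim_def)
    fix k
    have "(LINT x|?M. m x *\<^sub>R A k x) - (LINT x|?M. m x *\<^sub>R a x)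
        = (LINT x|?M. m x *\<^sub>R (A k x - a x))"
      using int[OF L(1)[of k]] int[OF L(2)] by (simp add: scaleR_diff_right)
    also have "norm \<dots> \<le> (LINT x|?M. norm (m x *\<^sub>R (A k x - a x)))"
      by (rule integral_norm_bound)
    also have "\<dots> \<le> (LINT x|?M. B * norm (A k x - a x))"
    proof (rule integral_mono)
      show "norm (m x *\<^sub>R (A k x - a x)) \<le> B * norm (A k x - a x)" for x
        unfolding norm_scaleR using m(2)[of x] by (intro mult_right_mono) auto
    qed (use integrable_norm[OF int[OF d]] d in \<open>auto simp del: norm_scaleR\<close>)
    also have "\<dots> = B * (LINT x|?M. norm (A k x - a x))" by simp
    finally show "norm ((LINT x|?M. m x *\<^sub>R A k x) - (LINT x|?M. m x *\<^sub>R a x))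
        \<le> B * (LINT x|?M. norm (A k x - a x))" .
  qed simp
  then show ?thesis by (rule LIM_zero_cancel)
qed

lemma L2_lim_imp_L1_lim:
  fixes a :: "'a::euclidean_space \<Rightarrow> 'b::euclidean_space"
  assumes \<Omega>: "\<Omega> \<in> lmeasurable" and A: "L2_lim \<Omega> A a"
  shows "L1_lim \<Omega> A a"
proof -
  interpret finite_measure "lebesgue_on \<Omega>" using \<Omega> by (rule finite_measure_lebesgue_on)
  have "L2_lim \<Omega> (\<lambda>_ _. 1::real) (\<lambda>_. 1)" by (simp add: L2_lim_def L2_on_def)
  from L2_lim_bilinear[OF bounded_bilinear_scaleR this A] show ?thesis by simp
qed

section \<open>Weak derivatives of limits and of compositions\<close>

lemma locally_integrable_integrable:
  assumes "\<Omega> \<in> sets lebesgue" "integrable (lebesgue_on \<Omega>) f"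
  shows "locally_integrable \<Omega> f"
  unfolding locally_integrable_def
proof (intro allI impI)
  fix K assume K: "compact K \<and> K \<subseteq> \<Omega>"
  have "set_integrable lebesgue \<Omega> f"
    using assms by (simp add: set_integrable_def integrable_restrict_space)
  then show "f absolutely_integrable_on K"
    by (rule set_integrable_subset) (use K lmeasurable_compact[THEN fmeasurableD] in blast)+
qed

lemma continuous_measurable_lebesgue_on:
  "continuous_on UNIV f \<Longrightarrow> f \<in> borel_measurable (lebesgue_on \<Omega>)"
  by (intro measurable_restrict_space1 measurable_completion) (simp add: borel_measurable_continuous_onI)

text \<open>A test function and its derivative are bounded, so both sides of the defining identity pass to the limit.\<close>

lemma is_weak_deriv_L1_lim:
  fixes u :: "'a::euclidean_space \<Rightarrow> 'b::euclidean_space"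
  assumes \<Omega>: "\<Omega> \<in> sets lebesgue" and e: "e \<in> Basis"
    and w: "\<And>k. is_weak_deriv \<Omega> e (U k) (V k)"
    and U: "L1_lim \<Omega> U u" and V: "L1_lim \<Omega> V v"
  shows "is_weak_deriv \<Omega> e u v"
  unfolding is_weak_deriv_def
proof (intro conjI ballI)
  let ?M = "lebesgue_on \<Omega>"
  show "locally_integrable \<Omega> u" "locally_integrable \<Omega> v"
    using U V \<Omega> by (auto simp: L1_lim_def intro: locally_integrable_integrable)
  fix \<phi> assume \<phi>: "\<phi> \<in> test_functions \<Omega>"
  obtain B where B: "B > 0" "\<And>x. \<bar>\<phi> x\<bar> \<le> B" "\<And>x. \<bar>pd \<phi> e x\<bar> \<le> B"
    by (rule test_function_bounded[OF \<phi> e]) blast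
  have "(\<lambda>k. LINT x|?M. pd \<phi> e x *\<^sub>R U k x) \<longlonglongrightarrow> (LINT x|?M. pd \<phi> e x *\<^sub>R u x)"
    by (rule L1_lim_integral_mult[OF U continuous_measurable_lebesgue_on B(3)])
      (rule Ck_pd_continuous[OF test_function_Ck[OF \<phi>] e])
  moreover have "(\<lambda>k. - (LINT x|?M. \<phi> x *\<^sub>R V k x)) \<longlonglongrightarrow> - (LINT x|?M. \<phi> x *\<^sub>R v x)"
    by (rule tendsto_minus, rule L1_lim_integral_mult[OF V continuous_measurable_lebesgue_on B(2)])
      (rule Ck_continuous[OF test_function_Ck[OF \<phi>]])
  moreover have "(LINT x|?M. pd \<phi> e x *\<^sub>R U k x) = - (LINT x|?M. \<phi> x *\<^sub>R V k x)" for k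
    using w[of k] \<phi> by (simp add: is_weak_deriv_def)
  ultimately show "(LINT x|?M. pd \<phi> e x *\<^sub>R u x) = - (LINT x|?M. \<phi> x *\<^sub>R v x)"
    using LIMSEQ_unique by simp
qed

lemma L1_lim_dominated:
  fixes a :: "'a::euclidean_space \<Rightarrow> 'b::euclidean_space"
  assumes A: "\<And>k. A k \<in> borel_measurable (lebesgue_on \<Omega>)" and a: "a \<in> borel_measurable (lebesgue_on \<Omega>)"
    and w: "integrable (lebesgue_on \<Omega>) w" "\<And>k x. x \<in> \<Omega> \<Longrightarrow> norm (A k x) \<le> w x"
    and lim: "AE x in lebesgue_on \<Omega>. (\<lambda>k. A k x) \<longlonglongrightarrow> a x"
  shows "L1_lim \<Omega> A a"
proof -
  let ?M = "lebesgue_on \<Omega>"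
  have bd: "AE x in ?M. norm (A k x) \<le> w x" for k using w(2) by (intro AE_I2) simp
  have bda: "AE x in ?M. norm (a x) \<le> w x"
    using lim AE_space[of ?M]
    by eventually_elim (rule LIMSEQ_le_const2[OF tendsto_norm], auto simp: w(2))
  have i: "integrable ?M f" if "f \<in> borel_measurable ?M" "AE x in ?M. norm (f x) \<le> w x" for f :: "'a \<Rightarrow> 'b"
    using that(2) by (intro Bochner_Integration.integrable_bound[OF w(1) that(1)]) (auto elim!: eventually_mono)
  have "(\<lambda>k. LINT x|?M. norm (A k x - a x)) \<longlonglongrightarrow> (LINT x|?M. 0::real)"
  proof (rule integral_dominated_convergence[where w = "\<lambda>x. 2 * w x"])
    show "AE x in ?M. (\<lambda>k. norm (A k x - a x)) \<longlonglongrightarrow> 0"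
      using lim by eventually_elim (simp add: LIM_zero tendsto_norm_zero)
    show "AE x in ?M. norm (norm (A k x - a x)) \<le> 2 * w x" for k
      using bd[of k] bda
    proof eventually_elim
      case (elim x) then show ?case using norm_triangle_ineq4[of "A k x" "a x"] by simp
    qed
    show "(\<lambda>x. norm (A k x - a x)) \<in> borel_measurable ?M" for k using A[of k] a by measurable
  qed (use w(1) in auto)
  then show ?thesis using i[OF A bd] i[OF a bda] by (simp add: L1_lim_def)
qed

lemma L1_lim_dominated_difference:
  fixes a :: "'a::euclidean_space \<Rightarrow> 'b::euclidean_space" and b :: "'a \<Rightarrow> 'c::euclidean_space"
  assumes B: "L1_lim \<Omega> B b" and A: "\<And>k. integrable (lebesgue_on \<Omega>) (A k)" "integrable (lebesgue_on \<Omega>) a"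
    and le: "\<And>k x. x \<in> \<Omega> \<Longrightarrow> norm (A k x - a x) \<le> K * norm (B k x - b x)"
  shows "L1_lim \<Omega> A a"
  unfolding L1_lim_def
proof (intro conjI allI A)
  let ?M = "lebesgue_on \<Omega>"
  have b: "integrable ?M (\<lambda>x. norm (B k x - b x))" for k
    using B by (auto simp: L1_lim_def)
  show "(\<lambda>k. LINT x|?M. norm (A k x - a x)) \<longlonglongrightarrow> 0"
  proof (rule tendsto_0_sandwich)
    show "(\<lambda>k. K * (LINT x|?M. norm (B k x - b x))) \<longlonglongrightarrow> 0"
      using B tendsto_mult_right_zero by (auto simp: L1_lim_def)
    fix k
    have "(LINT x|?M. norm (A k x - a x)) \<le> (LINT x|?M. K * norm (B k x - b x))"
      by (rule integral_mono) (use A b le in auto)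
    then show "(LINT x|?M. norm (A k x - a x)) \<le> K * (LINT x|?M. norm (B k x - b x))"
      by simp
  qed simp
qed

lemma L1_lim_add:
  assumes A: "L1_lim \<Omega> A a" and B: "L1_lim \<Omega> B b"
  shows "L1_lim \<Omega> (\<lambda>k x. A k x + B k x) (\<lambda>x. a x + b x)"
  unfolding L1_lim_def
proof (intro conjI allI)
  let ?M = "lebesgue_on \<Omega>"
  have i: "integrable ?M (A k)" "integrable ?M (B k)"
    "integrable ?M a" "integrable ?M b" for k
    using A B by (auto simp: L1_lim_def)
  then show "integrable ?M (\<lambda>x. A k x + B k x)" "integrable ?M (\<lambda>x. a x + b x)" for k
    by auto
  show "(\<lambda>k. LINT x|?M. norm (A k x + B k x - (a x + b x))) \<longlonglongrightarrow> 0"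
  proof (rule tendsto_0_sandwich)
    have "(\<lambda>k. (LINT x|?M. norm (A k x - a x)) + (LINT x|?M. norm (B k x - b x))) \<longlonglongrightarrow> 0 + 0"
      using A B by (intro tendsto_add) (auto simp: L1_lim_def)
    then show "(\<lambda>k. (LINT x|?M. norm (A k x - a x)) + (LINT x|?M. norm (B k x - b x))) \<longlonglongrightarrow> 0"
      by simp
    fix k
    have "(LINT x|?M. norm (A k x + B k x - (a x + b x)))
       \<le> (LINT x|?M. norm (A k x - a x) + norm (B k x - b x))"
    proof (rule integral_mono)
      show "norm (A k x + B k x - (a x + b x)) \<le> norm (A k x - a x) + norm (B k x - b x)" for x
        using norm_triangle_ineq[of "A k x - a x" "B k x - b x"] by (simp add: algebra_simps)
    qed (use i in auto)
    also have "\<dots> = (LINT x|?M. norm (A k x - a x)) + (LINT x|?M. norm (B k x - b x))"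
      using i by simp
    finally show "(LINT x|?M. norm (A k x + B k x - (a x + b x)))
       \<le> (LINT x|?M. norm (A k x - a x)) + (LINT x|?M. norm (B k x - b x))" .
  qed simp
qed

lemma L1_lim_subseq: "L1_lim \<Omega> A a \<Longrightarrow> strict_mono r \<Longrightarrow> L1_lim \<Omega> (\<lambda>k. A (r k)) a"
  using LIMSEQ_subseq_LIMSEQ[of "\<lambda>k. LINT x|lebesgue_on \<Omega>. norm (A k x - a x)" 0 r]
  by (auto simp: L1_lim_def o_def)

lemma L1_lim_AE_subseq:
  fixes a :: "'a::euclidean_space \<Rightarrow> 'b::euclidean_space"
  assumes "L1_lim \<Omega> A a"
  obtains r where "strict_mono r" "AE x in lebesgue_on \<Omega>. (\<lambda>k. A (r k) x) \<longlonglongrightarrow> a x"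
proof -
  let ?M = "lebesgue_on \<Omega>"
  obtain r where r: "strict_mono r" "AE x in lebesgue_on \<Omega>. (\<lambda>k. A (r k) x - a x) \<longlonglongrightarrow> 0"
    using tendsto_L1_AE_subseq[of ?M "\<lambda>k x. A k x - a x"] assms
    by (auto simp: L1_lim_def)
  show thesis
  proof (rule that[OF r(1)])
    show "AE x in lebesgue_on \<Omega>. (\<lambda>k. A (r k) x) \<longlonglongrightarrow> a x"
      using r(2) by eventually_elim (rule LIM_zero_cancel)
  qed
qed

text \<open>For the smooth approximations this is the classical chain rule. In the limit, the error of the derivative
  splits into \<open>\<Phi>' (U k) (pd (U k) e - v)\<close>, which is small because \<open>\<Phi>'\<close> is bounded, and
  \<open>\<Phi>' (U k) v - \<Phi>' u v\<close>, which is handled by dominated convergence along a subsequence that converges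
  almost everywhere.\<close>

lemma is_weak_deriv_compose:
  fixes u :: "'a::euclidean_space \<Rightarrow> 'b::euclidean_space" and \<Phi> :: "'b \<Rightarrow> 'c::euclidean_space"
  assumes \<Omega>: "\<Omega> \<in> lmeasurable" and e: "e \<in> Basis"
    and U: "\<And>k. Ck (Suc 0) (U k)" "L1_lim \<Omega> U u" "L1_lim \<Omega> (\<lambda>k. pd (U k) e) v"
    and \<Phi>: "\<And>y. (\<Phi> has_derivative \<Phi>' y) (at y)" "continuous_on UNIV (\<lambda>p. \<Phi>' (fst p) (snd p))"
      "\<And>y h. norm (\<Phi>' y h) \<le> K * norm h"
  shows "is_weak_deriv \<Omega> e (\<lambda>x. \<Phi> (u x)) (\<lambda>x. \<Phi>' (u x) (v x))"
proof -
  let ?M = "lebesgue_on \<Omega>"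
  interpret finite_measure ?M using \<Omega> by (rule finite_measure_lebesgue_on)
  have \<Omega>l: "\<Omega> \<in> sets lebesgue" using \<Omega> by auto
  obtain r where r: "strict_mono r" "AE x in lebesgue_on \<Omega>. (\<lambda>k. U (r k) x) \<longlonglongrightarrow> u x"
    using L1_lim_AE_subseq[OF U(2)] by blast
  define W where "W = (\<lambda>k. U (r k))"
  have W: "\<And>k. Ck (Suc 0) (W k)" "L1_lim \<Omega> W u" "L1_lim \<Omega> (\<lambda>k. pd (W k) e) v"
    "AE x in lebesgue_on \<Omega>. (\<lambda>k. W k x) \<longlonglongrightarrow> u x"
    using U(1) L1_lim_subseq[OF U(2) r(1)] L1_lim_subseq[OF U(3) r(1)] r(2) by (auto simp: W_def)
  have i: "integrable ?M u" "integrable ?M v" "integrable ?M (W k)"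
      "integrable ?M (pd (W k) e)" for k
    using W(2,3) by (auto simp: L1_lim_def)
  note meas = i[THEN borel_measurable_integrable]
  have lip: "norm (\<Phi> x - \<Phi> y) \<le> K * norm (x - y)" for x y
  proof (rule differentiable_bound[of UNIV \<Phi> \<Phi>' K])
    show "onorm (\<Phi>' x) \<le> K" for x by (intro onorm_le \<Phi>)
  qed (auto intro: \<Phi>(1) has_derivative_at_withinI)
  have c\<Phi>: "continuous_on UNIV \<Phi>"
    using \<Phi>(1) by (auto intro!: continuous_at_imp_continuous_on has_derivative_continuous)
  have \<Phi>m: "(\<lambda>x. \<Phi> (f x)) \<in> borel_measurable ?M" if "f \<in> borel_measurable ?M" for f
    using borel_measurable_continuous_onI[OF c\<Phi>] that by measurable
  have \<Phi>'m: "(\<lambda>x. \<Phi>' (f x) (g x)) \<in> borel_measurable ?M"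
    if "f \<in> borel_measurable ?M" "g \<in> borel_measurable ?M" for f g
    using borel_measurable_continuous_Pair[OF that \<Phi>(2)] by blast
  have \<Phi>i: "integrable ?M (\<lambda>x. \<Phi> (f x))" if f: "integrable ?M f" for f
  proof (rule Bochner_Integration.integrable_bound)
    show "integrable ?M (\<lambda>x. norm (\<Phi> 0) + K * norm (f x))"
      using f by (intro Bochner_Integration.integrable_add integrable_const integrable_mult_right integrable_norm)
    show "AE x in lebesgue_on \<Omega>. norm (\<Phi> (f x)) \<le> norm (norm (\<Phi> 0) + K * norm (f x))"
    proof (rule AE_I2)
      fix x
      have "norm (\<Phi> (f x)) \<le> norm (\<Phi> 0) + norm (\<Phi> (f x) - \<Phi> 0)" by (simp add: norm_triangle_sub)
      also have "\<dots> \<le> norm (\<Phi> 0) + K * norm (f x)" using lip[of "f x" 0] by simp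
      finally show "norm (\<Phi> (f x)) \<le> norm (norm (\<Phi> 0) + K * norm (f x))" by simp
    qed
  qed (intro \<Phi>m borel_measurable_integrable f)
  have \<Phi>'i: "integrable ?M (\<lambda>x. \<Phi>' (f x) (g x))"
    if f: "f \<in> borel_measurable ?M" and g: "integrable ?M g" for f g
  proof (rule Bochner_Integration.integrable_bound)
    show "integrable ?M (\<lambda>x. K * norm (g x))" using g by simp
    show "AE x in lebesgue_on \<Omega>. norm (\<Phi>' (f x) (g x)) \<le> norm (K * norm (g x))"
      using \<Phi>(3) by (intro AE_I2) (metis abs_ge_self order_trans real_norm_def)
  qed (intro \<Phi>'m f borel_measurable_integrable g)
  have hd: "((\<lambda>x. \<Phi> (W k x)) has_derivative (\<lambda>h. \<Phi>' (W k x) (pd (W k) h x))) (at x)" for k x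
    using has_derivative_compose[OF Ck_has_derivative[OF W(1)] \<Phi>(1)] .
  have c: "continuous_on UNIV (\<lambda>x. \<Phi>' (W k x) (pd (W k) i x))" if "i \<in> Basis" for k i
    using continuous_on_compose2[OF \<Phi>(2) continuous_on_Pair[OF Ck_continuous[OF W(1)] Ck_pd_continuous[OF W(1) that]]]
    by simp
  have CW: "Ck (Suc 0) (\<lambda>x. \<Phi> (W k x))" for k
    by (rule CkI[OF hd]) (simp add: c)
  have pdW: "pd (\<lambda>x. \<Phi> (W k x)) e = (\<lambda>x. \<Phi>' (W k x) (pd (W k) e x))" for k
    using pd_eq[OF hd] by blast
  have wk: "is_weak_deriv \<Omega> e (\<lambda>x. \<Phi> (W k x)) (\<lambda>x. \<Phi>' (W k x) (pd (W k) e x))" for k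
    using is_weak_deriv_Ck[OF CW e \<Omega>l] by (simp add: pdW)
  have lim1: "L1_lim \<Omega> (\<lambda>k x. \<Phi> (W k x)) (\<lambda>x. \<Phi> (u x))"
    by (rule L1_lim_dominated_difference[OF W(2), where K = K]) (intro \<Phi>i i lip)+
  have sub: "\<Phi>' y (h - h') = \<Phi>' y h - \<Phi>' y h'" for y h h'
    using has_derivative_linear[OF \<Phi>(1)] linear_diff by blast
  have lim2: "L1_lim \<Omega> (\<lambda>k x. \<Phi>' (W k x) (pd (W k) e x - v x)) (\<lambda>x. 0)"
  proof (rule L1_lim_dominated_difference[OF W(3), where K = K])
    show "integrable ?M (\<lambda>x. \<Phi>' (W k x) (pd (W k) e x - v x))" for k
      by (intro \<Phi>'i meas Bochner_Integration.integrable_diff i)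
    show "norm (\<Phi>' (W k x) (pd (W k) e x - v x) - 0) \<le> K * norm (pd (W k) e x - v x)" for k x
      using \<Phi>(3) by simp
  qed simp
  have lim3: "L1_lim \<Omega> (\<lambda>k x. \<Phi>' (W k x) (v x)) (\<lambda>x. \<Phi>' (u x) (v x))"
  proof (rule L1_lim_dominated[where w = "\<lambda>x. K * norm (v x)"])
    show "(\<lambda>x. \<Phi>' (W k x) (v x)) \<in> borel_measurable ?M" for k by (intro \<Phi>'m meas)
    show "(\<lambda>x. \<Phi>' (u x) (v x)) \<in> borel_measurable ?M" by (intro \<Phi>'m meas)
    show "AE x in lebesgue_on \<Omega>. (\<lambda>k. \<Phi>' (W k x) (v x)) \<longlonglongrightarrow> \<Phi>' (u x) (v x)"
      using W(4)
    proof eventually_elim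
      case (elim x)
      have "isCont (\<lambda>p. \<Phi>' (fst p) (snd p)) (u x, v x)"
        using \<Phi>(2) by (simp add: continuous_on_eq_continuous_at)
      from isCont_tendsto_compose[OF this, of "\<lambda>k. (W k x, v x)" sequentially] elim
      show ?case by (simp add: tendsto_Pair)
    qed
  qed (use i \<Phi>(3) in auto)
  have "L1_lim \<Omega> (\<lambda>k x. \<Phi>' (W k x) (pd (W k) e x)) (\<lambda>x. \<Phi>' (u x) (v x))"
    using L1_lim_add[OF lim2 lim3] by (simp add: sub)
  then show ?thesis by (rule is_weak_deriv_L1_lim[OF \<Omega>l e wk lim1])
qed


text \<open>Convergence in \<open>H1\<close> of globally smooth functions, the last argument collecting the weak derivatives of the
  limit. Membership in \<^const>\<open>H1_boundary\<close> provides such a sequence.\<close>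

definition smooth_approx :: "'a::euclidean_space set \<Rightarrow> (nat \<Rightarrow> 'a \<Rightarrow> 'b::euclidean_space) \<Rightarrow> ('a \<Rightarrow> 'b)
    \<Rightarrow> ('a \<Rightarrow> 'a \<Rightarrow> 'b) \<Rightarrow> bool" where
  "smooth_approx \<Omega> U u v \<longleftrightarrow> (\<forall>k. smooth (U k)) \<and> L2_lim \<Omega> U u \<and> (\<forall>e\<in>Basis. L2_lim \<Omega> (\<lambda>k. pd (U k) e) (v e))"

lemma smooth_approx_L1:
  assumes "smooth_approx \<Omega> U u v" "\<Omega> \<in> lmeasurable" "e \<in> Basis"
  shows "Ck j (U k)" "L1_lim \<Omega> U u" "L1_lim \<Omega> (\<lambda>k. pd (U k) e) (v e)"
  using assms by (auto simp: smooth_approx_def smooth_def intro: L2_lim_imp_L1_lim)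

lemma smooth_approx_weak_deriv:
  assumes "smooth_approx \<Omega> U u v" "\<Omega> \<in> lmeasurable" "e \<in> Basis"
  shows "is_weak_deriv \<Omega> e u (v e)"
proof (rule is_weak_deriv_L1_lim[OF _ assms(3) _ smooth_approx_L1(2,3)[OF assms]])
  show "is_weak_deriv \<Omega> e (U k) (pd (U k) e)" for k
    using is_weak_deriv_Ck[OF smooth_approx_L1(1)[OF assms] assms(3)] assms(2) by blast
qed (use assms(2) in auto)

lemma measurable_L1_lim:
  "L1_lim \<Omega> A a \<Longrightarrow> a \<in> borel_measurable (lebesgue_on \<Omega>)"
  by (auto simp: L1_lim_def)

lemma norm_le_sqrt_add: "norm y \<le> sqrt (y \<bullet> y + d\<^sup>2)"
  by (simp add: norm_eq_sqrt_inner)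

lemma le_sqrt_add: "d \<ge> 0 \<Longrightarrow> d \<le> sqrt (y \<bullet> y + d\<^sup>2)"
  using real_sqrt_le_mono[of "d\<^sup>2" "y \<bullet> y + d\<^sup>2"] by simp

lemma sqrt_add_pos: "d > 0 \<Longrightarrow> sqrt (y \<bullet> y + d\<^sup>2) > 0"
  using le_sqrt_add[of d y] by linarith

lemma has_derivative_sqrt_add:
  fixes y :: "'b::euclidean_space"
  assumes "d > 0"
  shows "((\<lambda>y. sqrt (y \<bullet> y + d\<^sup>2)) has_derivative (\<lambda>h. (y \<bullet> h) / sqrt (y \<bullet> y + d\<^sup>2))) (at y)"
proof -
  have "y \<bullet> y + d\<^sup>2 > 0" using sqrt_add_pos[OF assms, of y] by simp
  then show ?thesis
    by (auto intro!: derivative_eq_intros simp: inner_commute field_simps)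
qed

definition delta_seq :: "nat \<Rightarrow> real" where "delta_seq n = 1 / Suc n"

lemma delta_seq: "delta_seq n > 0" "delta_seq n \<le> 1" "delta_seq \<longlonglongrightarrow> 0"
  unfolding delta_seq_def using LIMSEQ_Suc[OF lim_1_over_n[where 'a=real]] by auto

lemma sqrt_add_tendsto: "(\<lambda>n. sqrt (y \<bullet> y + (delta_seq n)\<^sup>2)) \<longlonglongrightarrow> norm y"
proof -
  have "(\<lambda>n. sqrt (y \<bullet> y + (delta_seq n)\<^sup>2)) \<longlonglongrightarrow> sqrt (y \<bullet> y + 0\<^sup>2)"
    by (intro tendsto_intros delta_seq)
  then show ?thesis by (simp add: norm_eq_sqrt_inner)
qed

text \<open>The norm is approximated by the smooth functions \<open>\<lambda>y. sqrt (y \<bullet> y + d\<^sup>2)\<close>, whose derivatives are bounded by 1 and tend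
  to \<open>(y \<bullet> h) / norm y\<close>. At zeros of \<open>u\<close> they are 0, which is also the value of the quotient, as
  division by zero yields zero.\<close>

lemma weak_deriv_norm:
  fixes u :: "'a::euclidean_space \<Rightarrow> 'b::euclidean_space"
  assumes \<Omega>: "\<Omega> \<in> lmeasurable" and e: "e \<in> Basis" and u: "smooth_approx \<Omega> U u v"
  shows "is_weak_deriv \<Omega> e (\<lambda>x. norm (u x)) (\<lambda>x. (u x \<bullet> v e x) / norm (u x))"
proof -
  let ?M = "lebesgue_on \<Omega>"
  interpret finite_measure ?M using \<Omega> by (rule finite_measure_lebesgue_on)
  note L = smooth_approx_L1[OF u \<Omega> e]
  have [measurable]: "u \<in> borel_measurable ?M" "v e \<in> borel_measurable ?M"
    using measurable_L1_lim L by auto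
  have i: "integrable ?M u" "integrable ?M (v e)"
    using L by (auto simp: L1_lim_def)
  have CS: "\<bar>y \<bullet> h\<bar> / s \<le> norm h" if "norm y \<le> s" "0 < s" for y h :: 'b and s
  proof -
    have "\<bar>y \<bullet> h\<bar> \<le> norm y * norm h" by (rule Cauchy_Schwarz_ineq2)
    also have "\<dots> \<le> s * norm h" using that by (intro mult_right_mono) auto
    finally show ?thesis using that by (simp add: pos_divide_le_eq mult.commute)
  qed
  have s: "sqrt (y \<bullet> y + (delta_seq n)\<^sup>2) > 0" for n and y :: 'b
    by (rule sqrt_add_pos[OF delta_seq(1)])
  have CS': "\<bar>y \<bullet> h\<bar> / sqrt (y \<bullet> y + (delta_seq n)\<^sup>2) \<le> norm h" for n and y h :: 'b
    by (rule CS[OF norm_le_sqrt_add s])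
  define f where "f = (\<lambda>n x. sqrt (u x \<bullet> u x + (delta_seq n)\<^sup>2))"
  define g where "g = (\<lambda>n x. (u x \<bullet> v e x) / sqrt (u x \<bullet> u x + (delta_seq n)\<^sup>2))"
  have w: "is_weak_deriv \<Omega> e (f n) (g n)" for n
    unfolding f_def g_def
  proof (rule is_weak_deriv_compose[OF \<Omega> e L, where K = 1])
    show "((\<lambda>y. sqrt (y \<bullet> y + (delta_seq n)\<^sup>2)) has_derivative (\<lambda>h. (y \<bullet> h) / sqrt (y \<bullet> y + (delta_seq n)\<^sup>2))) (at y)" for y :: 'b
      by (rule has_derivative_sqrt_add[OF delta_seq(1)])
    show "continuous_on UNIV (\<lambda>p::'b \<times> 'b. (fst p \<bullet> snd p) / sqrt (fst p \<bullet> fst p + (delta_seq n)\<^sup>2))"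
    proof (rule continuous_on_divide)
      show "\<forall>p\<in>(UNIV::('b \<times> 'b) set). sqrt (fst p \<bullet> fst p + (delta_seq n)\<^sup>2) \<noteq> 0"
      proof (rule ballI)
        fix p :: "'b \<times> 'b" show "sqrt (fst p \<bullet> fst p + (delta_seq n)\<^sup>2) \<noteq> 0"
          using s[of "fst p" n] by linarith
      qed
    qed (intro continuous_intros)+
    show "norm ((y \<bullet> h) / sqrt (y \<bullet> y + (delta_seq n)\<^sup>2)) \<le> 1 * norm h" for y h :: 'b
      using CS'[of y h n] s[of y n] by simp
  qed
  have bd: "norm (f n x) \<le> norm (u x) + 1" for n x
  proof -
    have "u x \<bullet> u x + (delta_seq n)\<^sup>2 \<le> (norm (u x) + delta_seq n)\<^sup>2"
      using delta_seq(1)[of n] by (simp add: power2_sum dot_square_norm)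
    then have "sqrt (u x \<bullet> u x + (delta_seq n)\<^sup>2) \<le> norm (u x) + delta_seq n"
      using delta_seq(1)[of n] by (intro real_le_lsqrt) auto
    then show ?thesis using delta_seq(2)[of n] s[of "u x" n] by (simp add: f_def)
  qed
  show ?thesis
  proof (rule is_weak_deriv_L1_lim[OF _ e w])
    show "L1_lim \<Omega> f (\<lambda>x. norm (u x))"
    proof (rule L1_lim_dominated[OF _ _ _ bd])
      show "AE x in lebesgue_on \<Omega>. (\<lambda>n. f n x) \<longlonglongrightarrow> norm (u x)"
        unfolding f_def by (intro AE_I2 sqrt_add_tendsto)
    qed (use i in \<open>auto simp: f_def\<close>)
    show "L1_lim \<Omega> g (\<lambda>x. (u x \<bullet> v e x) / norm (u x))"
    proof (rule L1_lim_dominated)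
      show "norm (g n x) \<le> norm (v e x)" for n x
        using CS'[of "u x" "v e x" n] s[of "u x" n] by (simp add: g_def)
      show "AE x in lebesgue_on \<Omega>. (\<lambda>n. g n x) \<longlonglongrightarrow> (u x \<bullet> v e x) / norm (u x)"
      proof (rule AE_I2)
        fix x show "(\<lambda>n. g n x) \<longlonglongrightarrow> (u x \<bullet> v e x) / norm (u x)"
        proof (cases "u x = 0")
          case True
          then show ?thesis by (simp add: g_def)
        next
          case False
          then show ?thesis unfolding g_def by (intro tendsto_divide tendsto_const sqrt_add_tendsto) simp
        qed
      qed
    qed (use i in \<open>auto simp: g_def\<close>)
  qed (use \<Omega> in auto)
qed

lemma smooth_approx_diff:
  assumes "smooth_approx \<Omega> U u u'" "smooth_approx \<Omega> V v v'"
  shows "smooth_approx \<Omega> (\<lambda>k x. U k x - V k x) (\<lambda>x. u x - v x) (\<lambda>e x. u' e x - v' e x)"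
proof -
  have C: "Ck j (U k)" "Ck j (V k)" for j k using assms by (auto simp: smooth_approx_def smooth_def)
  have "pd (\<lambda>x. U k x - V k x) e = (\<lambda>x. pd (U k) e x - pd (V k) e x)" for k e
    using pd_diff[OF C(1)[of "Suc 0"] C(2)] by blast
  then show ?thesis
    using assms Ck_diff[OF C] by (auto simp: smooth_approx_def smooth_def intro!: L2_lim_diff)
qed

lemma smooth_approx_add:
  assumes "smooth_approx \<Omega> U u u'" "smooth_approx \<Omega> V v v'"
  shows "smooth_approx \<Omega> (\<lambda>k x. U k x + V k x) (\<lambda>x. u x + v x) (\<lambda>e x. u' e x + v' e x)"
proof -
  have C: "Ck j (U k)" "Ck j (V k)" for j k using assms by (auto simp: smooth_approx_def smooth_def)
  have "pd (\<lambda>x. U k x + V k x) e = (\<lambda>x. pd (U k) e x + pd (V k) e x)" for k e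
    using pd_add[OF C(1)[of "Suc 0"] C(2)] by blast
  then show ?thesis
    using assms Ck_add[OF C] by (auto simp: smooth_approx_def smooth_def intro!: L2_lim_add)
qed

lemma smooth_approx_const:
  fixes c :: "'b::euclidean_space"
  assumes "\<Omega> \<in> lmeasurable" shows "smooth_approx \<Omega> (\<lambda>k x. c) (\<lambda>x. c) (\<lambda>e x. 0)"
proof -
  interpret finite_measure "lebesgue_on \<Omega>" using assms by (rule finite_measure_lebesgue_on)
  have "pd (\<lambda>x::'a. c) e = (\<lambda>x. 0)" for e by (simp add: pd_eq[OF has_derivative_const] fun_eq_iff)
  then show ?thesis by (simp add: smooth_approx_def smooth_def Ck_const L2_lim_def L2_on_def)
qed

text \<open>Let \<open>c\<close> be a basis vector. As \<open>t\<close> decreases to 0, \<open>norm (u - t c)\<close> tends to \<open>norm u\<close>, and by \<open>weak_deriv_norm\<close> its derivatives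
  tend to a weak derivative of \<open>norm u\<close> that equals \<open>- (c \<bullet> v e)\<close> on the zero set of \<open>u\<close>. The formula in
  \<open>weak_deriv_norm\<close> gives 0 there, so uniqueness forces \<open>c \<bullet> v e = 0\<close>.\<close>

lemma weak_deriv_zero_set:
  fixes u :: "'a::euclidean_space \<Rightarrow> 'b::euclidean_space"
  assumes \<Omega>: "open \<Omega>" "\<Omega> \<in> lmeasurable" and e: "e \<in> Basis" and u: "smooth_approx \<Omega> U u v"
  shows "AE x in lebesgue_on \<Omega>. u x = 0 \<longrightarrow> v e x = 0"
proof -
  let ?M = "lebesgue_on \<Omega>"
  interpret finite_measure ?M using \<Omega>(2) by (rule finite_measure_lebesgue_on)
  note L = smooth_approx_L1[OF u \<Omega>(2) e]
  have [measurable]: "u \<in> borel_measurable ?M" "v e \<in> borel_measurable ?M"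
    using measurable_L1_lim L by auto
  have i: "integrable ?M u" "integrable ?M (v e)"
    using L by (auto simp: L1_lim_def)
  have comp: "AE x in lebesgue_on \<Omega>. u x = 0 \<longrightarrow> c \<bullet> v e x = 0" if c: "c \<in> Basis" for c
  proof -
    \<comment> \<open>Subtracting a small positive multiple of \<open>c\<close> prescribes the direction from which 0 is approached.\<close>
    define s where "s = (\<lambda>n x. u x - delta_seq n *\<^sub>R c)"
    define g where "g = (\<lambda>x. if u x = 0 then - (c \<bullet> v e x) else u x \<bullet> v e x / norm (u x))"
    have w: "is_weak_deriv \<Omega> e (\<lambda>x. norm (s n x)) (\<lambda>x. s n x \<bullet> v e x / norm (s n x))" for n
      using weak_deriv_norm[OF \<Omega>(2) e smooth_approx_diff[OF u smooth_approx_const[OF \<Omega>(2)]]]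
      by (simp add: s_def)
    have lim: "(\<lambda>n. s n x) \<longlonglongrightarrow> u x" for x
      using tendsto_diff[OF tendsto_const tendsto_scaleR[OF delta_seq(3) tendsto_const], of "u x" c]
      by (simp add: s_def)
    have sm[measurable]: "s n \<in> borel_measurable ?M" for n unfolding s_def by measurable
    have "is_weak_deriv \<Omega> e (\<lambda>x. norm (u x)) g"
    proof (rule is_weak_deriv_L1_lim[OF _ e w])
      show "L1_lim \<Omega> (\<lambda>n x. norm (s n x)) (\<lambda>x. norm (u x))"
      proof (rule L1_lim_dominated[where w = "\<lambda>x. norm (u x) + 1"])
        show "norm (norm (s n x)) \<le> norm (u x) + 1" for n x
          using norm_triangle_ineq4[of "u x" "delta_seq n *\<^sub>R c"] delta_seq(1,2)[of n] c by (simp add: s_def)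
        show "AE x in lebesgue_on \<Omega>. (\<lambda>n. norm (s n x)) \<longlonglongrightarrow> norm (u x)"
          by (intro AE_I2 tendsto_norm lim)
      qed (use i in auto)
      show "L1_lim \<Omega> (\<lambda>n x. s n x \<bullet> v e x / norm (s n x)) g"
      proof (rule L1_lim_dominated[where w = "\<lambda>x. norm (v e x)"])
        show "norm (s n x \<bullet> v e x / norm (s n x)) \<le> norm (v e x)" for n x
          using Cauchy_Schwarz_ineq2[of "s n x" "v e x"]
          by (cases "s n x = 0") (auto simp: divide_le_eq mult.commute)
        have "(\<lambda>n. s n x \<bullet> v e x / norm (s n x)) \<longlonglongrightarrow> g x" for x
        proof (cases "u x = 0")
          case True
          have "delta_seq n \<noteq> 0" for n using delta_seq(1)[of n] by simp
          then have "s n x \<bullet> v e x / norm (s n x) = g x" for n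
            using True c delta_seq(1)[of n] by (simp add: s_def g_def)
          then show ?thesis by simp
        next
          case False
          then show ?thesis unfolding g_def by (auto intro!: tendsto_intros lim)
        qed
        then show "AE x in lebesgue_on \<Omega>. (\<lambda>n. s n x \<bullet> v e x / norm (s n x)) \<longlonglongrightarrow> g x" by simp
        show "g \<in> borel_measurable ?M" unfolding g_def by measurable
      qed (use i in auto)
    qed (use \<Omega> in auto)
    from weak_deriv_unique[OF \<Omega>(1) weak_deriv_norm[OF \<Omega>(2) e u] this]
    show ?thesis by eventually_elim (auto simp: g_def)
  qed
  have "AE x in lebesgue_on \<Omega>. \<forall>c\<in>Basis. u x = 0 \<longrightarrow> c \<bullet> v e x = 0"
    using comp by (intro AE_finite_allI) auto
  then show ?thesis by eventually_elim (auto simp: inner_commute intro: euclidean_eqI)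
qed

section \<open>Polar coordinates\<close>

text \<open>The change of variables theorem speaks about the type \<^typ>\<open>real^2\<close>; this lemma transports Lebesgue
  measure from there to pairs of reals and to complex numbers. The functions \<open>c1\<close>, \<open>c2\<close> are the coordinates on the target.\<close>

lemma lborel_distr_vec2:
  fixes T :: "real^2 \<Rightarrow> 'a::euclidean_space" and c1 c2 :: "'a \<Rightarrow> real"
  assumes T: "T \<in> borel_measurable borel"
    and vimage: "\<And>l u. T -` box l u = box (vector [c1 l, c2 l]) (vector [c1 u, c2 u])"
    and prod: "\<And>l u. (\<Prod>b\<in>Basis. (u - l) \<bullet> b) = (c1 u - c1 l) * (c2 u - c2 l)"
    and le: "\<And>l u. (\<And>b. b \<in> Basis \<Longrightarrow> l \<bullet> b \<le> u \<bullet> b) \<Longrightarrow> c1 l \<le> c1 u \<and> c2 l \<le> c2 u"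
  shows "distr lborel borel T = lborel"
proof (rule lborel_eqI[symmetric])
  fix l u :: 'a assume "\<And>b. b \<in> Basis \<Longrightarrow> l \<bullet> b \<le> u \<bullet> b"
  then have c: "c1 l \<le> c1 u" "c2 l \<le> c2 u" using le by auto
  have B: "(Basis :: (real^2) set) = {axis 1 1, axis 2 1}"
    by (auto simp: Basis_vec_def UNIV_2)
  have ne: "axis 1 (1::real) \<noteq> (axis 2 1 :: real^2)" by (simp add: axis_eq_axis)
  have "emeasure (distr lborel borel T) (box l u) = emeasure lborel (box (vector [c1 l, c2 l]) (vector [c1 u, c2 u] :: real^2))"
    using T by (simp add: emeasure_distr vimage)
  also have "\<dots> = ennreal ((c1 u - c1 l) * (c2 u - c2 l))"
    using c ne by (subst emeasure_lborel_box) (auto simp: B inner_axis inner_diff_left)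
  finally show "emeasure (distr lborel borel T) (box l u) = (\<Prod>b\<in>Basis. (u - l) \<bullet> b)"
    by (simp add: prod)
qed simp

lemma lborel_distr_Pair:
  "distr (lborel :: (real^2) measure) borel (\<lambda>v. (v$1, v$2)) = lborel"
proof (rule lborel_distr_vec2[where ?c1.0 = fst and ?c2.0 = snd])
  show "(\<lambda>v::real^2. (v$1, v$2)) \<in> borel_measurable borel"
    by (intro borel_measurable_continuous_onI continuous_intros)
  fix l u :: "real \<times> real" assume "\<And>b. b \<in> Basis \<Longrightarrow> l \<bullet> b \<le> u \<bullet> b"
  from this[of "(1, 0)"] this[of "(0, 1)"] show "fst l \<le> fst u \<and> snd l \<le> snd u"
    by (cases l; cases u) (simp add: Basis_prod_def)
qed (auto simp: box_def Basis_vec_def UNIV_2 inner_axis Basis_prod_def)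

lemma lborel_distr_Complex:
  "distr (lborel :: (real^2) measure) borel (\<lambda>v. Complex (v$1) (v$2)) = lborel"
proof (rule lborel_distr_vec2[where ?c1.0 = Re and ?c2.0 = Im])
  show "(\<lambda>v::real^2. Complex (v$1) (v$2)) \<in> borel_measurable borel"
    unfolding Complex_eq by (intro borel_measurable_continuous_onI continuous_intros)
  fix l u :: complex assume "\<And>b. b \<in> Basis \<Longrightarrow> l \<bullet> b \<le> u \<bullet> b"
  from this[of 1] this[of \<i>] show "Re l \<le> Re u \<and> Im l \<le> Im u"
    by (simp add: Basis_complex_def)
qed (auto simp: box_def Basis_vec_def UNIV_2 inner_axis Basis_complex_def)

definition polar_vec :: "real^2 \<Rightarrow> real^2" where
  "polar_vec v = (\<chi> i. if i = 1 then v$1 * cos (v$2) else v$1 * sin (v$2))"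

lemma Complex_polar_vec: "Complex (polar_vec v $ 1) (polar_vec v $ 2) = rcis (v$1) (v$2)"
  by (simp add: polar_vec_def complex_eq_iff)

definition polar_deriv :: "real^2 \<Rightarrow> real^2 \<Rightarrow> real^2" where
  "polar_deriv v h = (\<chi> i. if i = 1 then h$1 * cos (v$2) - v$1 * sin (v$2) * h$2
     else h$1 * sin (v$2) + v$1 * cos (v$2) * h$2)"

lemma polar_vec_has_derivative: "(polar_vec has_derivative polar_deriv v) (at v within S)"
proof -
  have [derivative_intros]: "((\<lambda>x. x $ j) has_derivative (\<lambda>h. h $ j)) (at v within S)" for j
    by (rule bounded_linear_imp_has_derivative[OF bounded_linear_vec_nth])
  have 1: "((\<lambda>v. if i = 1 then v$1 * cos (v$2) else v$1 * sin (v$2)) has_derivative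
    (\<lambda>h. if i = 1 then h$1 * cos (v$2) - v$1 * sin (v$2) * h$2
     else h$1 * sin (v$2) + v$1 * cos (v$2) * h$2)) (at v within S)" for i :: 2
    by (cases "i = 1") (auto intro!: derivative_eq_intros simp: fun_eq_iff algebra_simps)
  show ?thesis
    unfolding has_derivative_componentwise_within[of polar_vec]
  proof (rule ballI)
    fix b :: "real^2" assume "b \<in> Basis"
    then obtain i where "b = axis i 1" by (auto simp: Basis_vec_def)
    then show "((\<lambda>v. polar_vec v \<bullet> b) has_derivative (\<lambda>h. polar_deriv v h \<bullet> b)) (at v within S)"
      using 1[of i] by (simp add: inner_axis polar_vec_def polar_deriv_def)
  qed
qed

lemma det_polar_deriv: "det (matrix (polar_deriv v)) = v$1"
proof -
  have "det (matrix (polar_deriv v)) = v$1 * (cos (v$2) * cos (v$2) + sin (v$2) * sin (v$2))"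
    by (simp add: det_2 matrix_def polar_deriv_def axis_def algebra_simps del: sin_cos_squared_add3)
  then show ?thesis by simp
qed

lemma Arg2pi_rcis: "0 < r \<Longrightarrow> 0 \<le> \<theta> \<Longrightarrow> \<theta> < 2 * pi \<Longrightarrow> Arg2pi (rcis r \<theta>) = \<theta>"
  by (rule Arg2pi_unique[of r]) (auto simp: rcis_def cis_conv_exp)

text \<open>Both measures are compared on boxes. The part of a box outside the ray \<open>Arg2pi = 0\<close>, which is a null set, is the
  injective image of an open set of parameters under a map with Jacobian determinant \<open>r\<close>.\<close>

lemma lborel_polar:
  "lborel = distr (density (lborel :: (real \<times> real) measure)
      (\<lambda>p. indicator ({0<..} \<times> {0<..<2 * pi}) p * ennreal (fst p))) borel (\<lambda>p. rcis (fst p) (snd p))"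
  (is "_ = distr (density lborel ?d) borel ?P")
proof (rule lborel_eqI)
  have P[measurable]: "?P \<in> borel_measurable borel"
    unfolding rcis_def cis_conv_exp by (intro borel_measurable_continuous_onI continuous_intros)
  have S[measurable]: "{0<..} \<times> {0<..<2 * pi} \<in> sets (borel :: (real \<times> real) measure)"
    by (intro borel_open open_Times) auto
  have d[measurable]: "?d \<in> borel_measurable borel"
  proof -
    have [measurable]: "(fst :: real \<times> real \<Rightarrow> real) \<in> borel_measurable borel"
      by (intro borel_measurable_continuous_onI continuous_intros)
    show ?thesis by measurable
  qed
  fix l u :: complex assume lu: "\<And>b. b \<in> Basis \<Longrightarrow> l \<bullet> b \<le> u \<bullet> b"
  define C where "C = (\<lambda>v::real^2. Complex (v$1) (v$2))"
  have C[measurable]: "C \<in> borel_measurable borel"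
    unfolding C_def Complex_eq by (intro borel_measurable_continuous_onI continuous_intros)
  define Sb where "Sb = {v::real^2. 0 < v$1 \<and> 0 < v$2 \<and> v$2 < 2 * pi \<and> rcis (v$1) (v$2) \<in> box l u}"
  have pv[measurable]: "(\<lambda>v::real^2. (v$1, v$2)) \<in> borel_measurable borel"
    by (intro borel_measurable_continuous_onI continuous_intros)
  have "open Sb"
  proof -
    have "open ((\<lambda>v. rcis (v$1) (v$2)) -` box l u :: (real^2) set)"
      unfolding rcis_def cis_conv_exp by (intro open_vimage open_box continuous_intros)
    moreover have "open {v::real^2. 0 < v$1}" "open {v::real^2. 0 < v$2}" "open {v::real^2. v$2 < 2 * pi}"
      by (intro open_Collect_less continuous_intros)+
    ultimately have "open ({v::real^2. 0 < v$1} \<inter> {v. 0 < v$2} \<inter> {v. v$2 < 2 * pi} \<inter> (\<lambda>v. rcis (v$1) (v$2)) -` box l u)"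
      by (intro open_Int)
    moreover have "Sb = {v. 0 < v$1} \<inter> {v. 0 < v$2} \<inter> {v. v$2 < 2 * pi} \<inter> (\<lambda>v. rcis (v$1) (v$2)) -` box l u"
      by (auto simp: Sb_def)
    ultimately show ?thesis by simp
  qed
  then have Sb: "Sb \<in> sets borel" "Sb \<in> sets lebesgue" by auto
  have inj: "inj_on polar_vec Sb"
  proof (rule inj_onI)
    fix v w assume v: "v \<in> Sb" and w: "w \<in> Sb" and eq: "polar_vec v = polar_vec w"
    then have r: "rcis (v$1) (v$2) = rcis (w$1) (w$2)" by (metis Complex_polar_vec)
    have "norm (rcis (v$1) (v$2)) = norm (rcis (w$1) (w$2))" by (simp only: r)
    then have "v$1 = w$1" using v w by (simp add: Sb_def)
    moreover have "v$2 = w$2"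
      using v w r Arg2pi_rcis[of "v$1" "v$2"] Arg2pi_rcis[of "w$1" "w$2"] by (simp add: Sb_def)
    ultimately show "v = w" by (simp add: vec_eq_iff forall_2)
  qed
  define N where "N = {w::real^2. w$2 = 0 \<and> w$1 \<ge> 0}"
  have img: "polar_vec ` Sb = C -` box l u - N"
  proof (rule set_eqI, rule iffI)
    fix w assume "w \<in> polar_vec ` Sb"
    then obtain v where v: "v \<in> Sb" "w = polar_vec v" by blast
    have Cw: "C w = rcis (v$1) (v$2)" by (simp add: C_def v(2) Complex_polar_vec)
    have "w \<notin> N"
    proof
      assume "w \<in> N"
      then have "Arg2pi (C w) = 0" by (simp add: N_def C_def Arg2pi_eq_0 complex_is_Real_iff)
      then show False using v(1) Cw Arg2pi_rcis[of "v$1" "v$2"] by (simp add: Sb_def)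
    qed
    then show "w \<in> C -` box l u - N" using Cw v(1) by (simp add: Sb_def)
  next
    fix w assume w: "w \<in> C -` box l u - N"
    define v :: "real^2" where "v = vector [norm (C w), Arg2pi (C w)]"
    have v12: "v$1 = norm (C w)" "v$2 = Arg2pi (C w)" by (auto simp: v_def)
    have rc: "rcis (v$1) (v$2) = C w"
      using Arg2pi_eq[of "C w"] by (simp add: v12 rcis_def cis_conv_exp)
    have "Arg2pi (C w) \<noteq> 0"
      using w by (auto simp: Arg2pi_eq_0 N_def C_def complex_is_Real_iff)
    moreover have "0 \<le> Arg2pi (C w)" "Arg2pi (C w) < 2 * pi" by (auto simp: Arg2pi_ge_0 Arg2pi_lt_2pi)
    moreover have "C w \<noteq> 0" using w by (auto simp: C_def N_def complex_eq_iff)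
    ultimately have "v \<in> Sb" using w by (simp add: Sb_def rc) (simp add: v12)
    moreover have "w = polar_vec v"
    proof -
      have "C w = C (polar_vec v)" by (simp add: C_def[of] Complex_polar_vec rc[unfolded C_def])
      then show ?thesis by (simp add: C_def vec_eq_iff forall_2)
    qed
    ultimately show "w \<in> polar_vec ` Sb" by blast
  qed
  have "negligible N"
  proof (rule negligible_subset)
    show "negligible {w::real^2. axis 2 1 \<bullet> w = 0}" by (rule negligible_hyperplane) (simp add: axis_eq_0_iff)
    show "N \<subseteq> {w. axis 2 1 \<bullet> w = 0}" by (auto simp: N_def inner_axis inner_commute)
  qed
  have eb: "emeasure lborel (C -` box l u) = ennreal (\<Prod>b\<in>Basis. (u - l) \<bullet> b)"
  proof -
    have "emeasure lborel (C -` box l u) = emeasure (distr lborel borel C) (box l u)"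
      using C by (simp add: emeasure_distr)
    also have "\<dots> = ennreal (\<Prod>b\<in>Basis. (u - l) \<bullet> b)"
      using lborel_distr_Complex lu by (simp add: C_def)
    finally show ?thesis .
  qed
  have Cb: "C -` box l u \<in> sets borel" using measurable_sets[OF C, of "box l u"] by simp
  have Nl: "N \<in> null_sets lebesgue" using \<open>negligible N\<close> by (simp add: negligible_iff_null_sets)
  have eI: "emeasure lebesgue (polar_vec ` Sb) = ennreal (\<Prod>b\<in>Basis. (u - l) \<bullet> b)"
    unfolding img using emeasure_Diff_null_set[OF Nl, of "C -` box l u"] Cb eb by simp
  have "polar_vec ` Sb \<in> lmeasurable"
  proof (rule fmeasurableI)
    show "polar_vec ` Sb \<in> sets lebesgue" unfolding img using Cb Nl by auto
  qed (simp add: eI)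
  then have "((\<lambda>v. \<bar>det (matrix (polar_deriv v))\<bar>) has_integral measure lebesgue (polar_vec ` Sb)) Sb"
    using measurable_differentiable_image_eq[OF Sb(2) polar_vec_has_derivative inj]
      measure_differentiable_image_eq[OF Sb(2) polar_vec_has_derivative inj] integrable_integral by metis
  then have hi: "((\<lambda>v. \<bar>v$1\<bar>) has_integral (\<Prod>b\<in>Basis. (u - l) \<bullet> b)) Sb"
    using eI lu by (simp add: det_polar_deriv measure_def prod_nonneg inner_diff_left)
  have "emeasure (distr (density lborel ?d) borel ?P) (box l u)
      = (\<integral>\<^sup>+p. ?d p * indicator (?P -` box l u) p \<partial>lborel)"
    using measurable_sets[OF P, of "box l u"] by (simp add: emeasure_distr emeasure_density)
  also have "\<dots> = (\<integral>\<^sup>+p. ?d p * indicator (?P -` box l u) p \<partial>distr (lborel :: (real^2) measure) borel (\<lambda>v. (v$1, v$2)))"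
    by (simp only: lborel_distr_Pair)
  also have "\<dots> = (\<integral>\<^sup>+v. ?d (v$1, v$2) * indicator (?P -` box l u) (v$1, v$2) \<partial>(lborel :: (real^2) measure))"
    using measurable_sets[OF P, of "box l u"]
    by (intro nn_integral_distr) (auto intro!: borel_measurable_times_ennreal borel_measurable_indicator d pv)
  also have "\<dots> = (\<integral>\<^sup>+v. ennreal (indicator Sb v * \<bar>v$1\<bar>) \<partial>lborel)"
    by (intro nn_integral_cong) (auto simp: Sb_def indicator_def)
  also have "\<dots> = ennreal (\<Prod>b\<in>Basis. (u - l) \<bullet> b)"
    using nn_integral_has_integral_lebesgue[OF _ hi] by simp
  finally show "emeasure (distr (density lborel ?d) borel ?P) (box l u) = (\<Prod>b\<in>Basis. (u - l) \<bullet> b)" .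
qed simp

definition radial_integral :: "(complex \<Rightarrow> ennreal) \<Rightarrow> real \<Rightarrow> ennreal" where
  "radial_integral f \<theta> = (\<integral>\<^sup>+r. indicator {0<..} r * ennreal r * f (rcis r \<theta>) \<partial>lborel)"

lemma nn_integral_polar:
  fixes f :: "complex \<Rightarrow> ennreal"
  assumes f[measurable]: "f \<in> borel_measurable borel"
  shows "(\<integral>\<^sup>+z. f z \<partial>lborel) = (\<integral>\<^sup>+\<theta>. indicator {0<..<2 * pi} \<theta> * radial_integral f \<theta> \<partial>lborel)"
proof -
  let ?d = "\<lambda>p. indicator ({0<..} \<times> {0<..<2 * pi}) p * ennreal (fst p) :: ennreal"
  let ?P = "\<lambda>p. rcis (fst p) (snd p)"
  have P[measurable]: "?P \<in> borel_measurable borel"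
    unfolding rcis_def cis_conv_exp by (intro borel_measurable_continuous_onI continuous_intros)
  have S[measurable]: "{0<..} \<times> {0<..<2 * pi} \<in> sets (borel :: (real \<times> real) measure)"
    by (intro borel_open open_Times) auto
  have d[measurable]: "?d \<in> borel_measurable borel"
  proof -
    have [measurable]: "(fst :: real \<times> real \<Rightarrow> real) \<in> borel_measurable borel"
      by (intro borel_measurable_continuous_onI continuous_intros)
    show ?thesis by measurable
  qed
  have fP[measurable]: "(\<lambda>p. f (?P p)) \<in> borel_measurable borel" using measurable_compose[OF P f] .
  have df: "(\<lambda>p. ?d p * f (?P p)) \<in> borel_measurable borel"
    using d fP by (rule borel_measurable_times_ennreal)
  have "(\<integral>\<^sup>+z. f z \<partial>lborel) = (\<integral>\<^sup>+p. f (?P p) \<partial>density lborel ?d)"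
    by (subst lborel_polar, rule nn_integral_distr) (auto simp: P)
  also have "\<dots> = (\<integral>\<^sup>+p. ?d p * f (?P p) \<partial>lborel)"
    by (rule nn_integral_density) auto
  also have "\<dots> = (\<integral>\<^sup>+p. ?d p * f (?P p) \<partial>(lborel \<Otimes>\<^sub>M lborel))" by (simp add: lborel_prod)
  also have "\<dots> = (\<integral>\<^sup>+\<theta>. \<integral>\<^sup>+r. ?d (r, \<theta>) * f (?P (r, \<theta>)) \<partial>lborel \<partial>lborel)"
    using df by (intro lborel_pair.nn_integral_snd[symmetric]) (simp add: lborel_prod)
  also have "\<dots> = (\<integral>\<^sup>+\<theta>. indicator {0<..<2 * pi} \<theta> * radial_integral f \<theta> \<partial>lborel)"
    by (intro nn_integral_cong) (auto simp: indicator_def radial_integral_def)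
  finally show ?thesis .
qed


section \<open>Boundary layer estimate\<close>

lemma rcis_scaleR: "rcis r \<theta> = r *\<^sub>R cis \<theta>"
  by (simp add: rcis_def scaleR_conv_of_real)

lemma continuous_on_rcis: "continuous_on UNIV (\<lambda>r. rcis r \<theta>)" "continuous_on UNIV (\<lambda>\<theta>. rcis r \<theta>)"
  unfolding rcis_def cis_conv_exp by (intro continuous_intros)+

definition grad_sq :: "('a::euclidean_space \<Rightarrow> 'b::euclidean_space) \<Rightarrow> 'a \<Rightarrow> real" where
  "grad_sq F x = (\<Sum>e\<in>Basis. (norm (pd F e x))\<^sup>2)"

lemma grad_sq_nonneg: "0 \<le> grad_sq F x"
  by (simp add: grad_sq_def sum_nonneg)

lemma continuous_grad_sq: "Ck (Suc k) F \<Longrightarrow> continuous_on UNIV (grad_sq F)"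
  unfolding grad_sq_def[abs_def] by (intro continuous_intros Ck_pd_continuous)

lemma directional_derivative_sq_le:
  fixes F :: "complex \<Rightarrow> 'b::euclidean_space"
  assumes "Ck (Suc k) F"
  shows "pd F (cis \<theta>) z = cos \<theta> *\<^sub>R pd F 1 z + sin \<theta> *\<^sub>R pd F \<i> z"
    and "(norm (pd F (cis \<theta>) z))\<^sup>2 \<le> grad_sq F z"
proof -
  have lin: "linear (\<lambda>h. pd F h z)" using has_derivative_linear[OF Ck_has_derivative[OF assms]] .
  have "cis \<theta> = cos \<theta> *\<^sub>R 1 + sin \<theta> *\<^sub>R \<i>" by (simp add: complex_eq_iff)
  then show eq: "pd F (cis \<theta>) z = cos \<theta> *\<^sub>R pd F 1 z + sin \<theta> *\<^sub>R pd F \<i> z"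
    using linear_add[OF lin] linear_cmul[OF lin] by metis
  define a b where "a = norm (pd F 1 z)" and "b = norm (pd F \<i> z)"
  have "norm (pd F (cis \<theta>) z) \<le> \<bar>cos \<theta>\<bar> * a + \<bar>sin \<theta>\<bar> * b"
    unfolding eq a_def b_def by (rule norm_triangle_le) simp
  then have "(norm (pd F (cis \<theta>) z))\<^sup>2 \<le> (\<bar>cos \<theta>\<bar> * a + \<bar>sin \<theta>\<bar> * b)\<^sup>2"
    by (rule power_mono) simp
  also have "\<dots> = ((cos \<theta>)\<^sup>2 + (sin \<theta>)\<^sup>2) * (a\<^sup>2 + b\<^sup>2) - (\<bar>cos \<theta>\<bar> * b - \<bar>sin \<theta>\<bar> * a)\<^sup>2"
    by (simp add: power2_sum power2_diff power_mult_distrib algebra_simps del: sin_cos_squared_add sin_cos_squared_add2)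
  also have "\<dots> \<le> a\<^sup>2 + b\<^sup>2" by simp
  also have "\<dots> = grad_sq F z" by (simp add: grad_sq_def a_def b_def Basis_complex_def)
  finally show "(norm (pd F (cis \<theta>) z))\<^sup>2 \<le> grad_sq F z" .
qed

text \<open>The fundamental theorem of calculus along a ray, and the Cauchy-Schwarz inequality.\<close>

lemma radial_increment_bound:
  fixes F :: "complex \<Rightarrow> 'b::euclidean_space"
  assumes F: "Ck (Suc k) F" and r: "r \<le> R"
  shows "(norm (F (rcis R \<theta>) - F (rcis r \<theta>)))\<^sup>2 \<le> (R - r) * integral {r..R} (\<lambda>s. grad_sq F (rcis s \<theta>))"
proof -
  define \<psi> where "\<psi> = (\<lambda>s. pd F (cis \<theta>) (rcis s \<theta>))"
  have cpd: "continuous_on UNIV (\<lambda>s. pd F e (rcis s \<theta>))" if "e \<in> Basis" for e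
    using continuous_on_compose2[OF Ck_pd_continuous[OF F that] continuous_on_rcis(1)] by simp
  have c\<psi>: "continuous_on UNIV \<psi>"
    unfolding \<psi>_def directional_derivative_sq_le(1)[OF F]
    by (intro continuous_intros cpd) (auto simp: Basis_complex_def)
  have cg: "continuous_on UNIV (\<lambda>s. grad_sq F (rcis s \<theta>))"
    using continuous_on_compose2[OF continuous_grad_sq[OF F] continuous_on_rcis(1)] by simp
  have ig: "integrable (lebesgue_on {r..R}) (\<lambda>s. grad_sq F (rcis s \<theta>))"
    by (rule continuous_imp_integrable_real[OF continuous_on_subset[OF cg]]) simp
  have i\<psi>: "integrable (lebesgue_on {r..R}) \<psi>"
    by (rule continuous_imp_integrable_real[OF continuous_on_subset[OF c\<psi>]]) simp
  have L\<psi>: "\<psi> \<in> L2_on {r..R}"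
  proof -
    have "continuous_on {r..R} (\<lambda>s. (norm (\<psi> s))\<^sup>2)"
      by (intro continuous_intros continuous_on_subset[OF c\<psi>]) simp
    then show ?thesis
      using i\<psi> continuous_imp_integrable_real by (auto simp: L2_on_def)
  qed
  have L1: "(\<lambda>_. 1::real) \<in> L2_on {r..R}"
    using continuous_imp_integrable_real[OF continuous_on_const[of "{r..R}" "1::real"]] by (simp add: L2_on_def)
  have "(\<psi> has_integral (F (rcis R \<theta>) - F (rcis r \<theta>))) {r..R}"
  proof (rule fundamental_theorem_of_calculus[OF r])
    fix s
    show "((\<lambda>s. F (rcis s \<theta>)) has_vector_derivative \<psi> s) (at s within {r..R})"
      using has_vector_derivative_line[OF F, of 0 "cis \<theta>" s "{r..R}"] by (simp add: rcis_scaleR \<psi>_def)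
  qed
  then have "F (rcis R \<theta>) - F (rcis r \<theta>) = integral {r..R} \<psi>" by (simp add: integral_unique)
  also have "\<dots> = (LINT s|lebesgue_on {r..R}. \<psi> s)"
    using lebesgue_integral_eq_integral[OF i\<psi>] by simp
  also have "norm \<dots> \<le> (LINT s|lebesgue_on {r..R}. norm (\<psi> s) * norm (1::real))" by simp
  also have "\<dots> \<le> sqrt (LINT s|lebesgue_on {r..R}. (norm (\<psi> s))\<^sup>2) * sqrt (LINT s|lebesgue_on {r..R}. (norm (1::real))\<^sup>2)"
    by (rule Cauchy_Schwarz_L2[OF L\<psi> L1])
  finally have "(norm (F (rcis R \<theta>) - F (rcis r \<theta>)))\<^sup>2
      \<le> (sqrt (LINT s|lebesgue_on {r..R}. (norm (\<psi> s))\<^sup>2) * sqrt (LINT s|lebesgue_on {r..R}. (norm (1::real))\<^sup>2))\<^sup>2"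
    by (rule power_mono) simp
  also have "\<dots> = (LINT s|lebesgue_on {r..R}. (norm (\<psi> s))\<^sup>2) * (R - r)"
    using r by (simp add: power_mult_distrib measure_restrict_space)
  also have "\<dots> \<le> (LINT s|lebesgue_on {r..R}. grad_sq F (rcis s \<theta>)) * (R - r)"
    using r L2_onD(2)[OF L\<psi>] ig directional_derivative_sq_le(2)[OF F]
    by (intro mult_right_mono integral_mono) (auto simp: \<psi>_def)
  also have "(LINT s|lebesgue_on {r..R}. grad_sq F (rcis s \<theta>)) = integral {r..R} (\<lambda>s. grad_sq F (rcis s \<theta>))"
    using lebesgue_integral_eq_integral[OF ig] by simp
  finally show ?thesis by (simp add: mult.commute)
qed

definition annulus :: "real \<Rightarrow> real \<Rightarrow> complex set" where
  "annulus a b = {z. a < norm z \<and> norm z < b}"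

lemma annulus_borel [measurable]: "annulus a b \<in> sets borel"
proof -
  have "annulus a b = {z. a < norm z} \<inter> {z. norm z < b}" by (auto simp: annulus_def)
  then show ?thesis by (auto intro!: borel_open open_Int open_Collect_less continuous_intros)
qed

text \<open>On the ray at angle \<open>\<theta>\<close>, \<open>radial_increment_bound\<close> compares \<open>F\<close> with its value on the circle. The weight \<open>r\<close> of polar
  coordinates is at most \<open>R\<close> on the left, and at least \<open>R/2\<close> on the right because \<open>2 \<delta> \<le> R\<close>.\<close>

lemma fiber_estimate:
  fixes F :: "complex \<Rightarrow> 'b::euclidean_space"
  assumes F: "Ck (Suc k) F" and \<delta>: "0 < \<delta>" "2 * \<delta> \<le> R"
  defines "A \<equiv> annulus (R - \<delta>) R"
  shows "radial_integral (\<lambda>z. ennreal (indicator A z * (norm (F z))\<^sup>2)) \<theta>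
    \<le> ennreal (2 * R * \<delta>) * ennreal ((norm (F (rcis R \<theta>)))\<^sup>2) +
      ennreal (4 * \<delta>\<^sup>2) * radial_integral (\<lambda>z. ennreal (indicator A z * grad_sq F z)) \<theta>"
    (is "?L \<le> _ + _ * ?J")
proof -
  define a where "a = (norm (F (rcis R \<theta>)))\<^sup>2"
  define B where "B = integral {R - \<delta>..R} (\<lambda>s. grad_sq F (rcis s \<theta>))"
  have cg: "continuous_on UNIV (\<lambda>s. grad_sq F (rcis s \<theta>))"
    using continuous_on_compose2[OF continuous_grad_sq[OF F] continuous_on_rcis(1)] by simp
  have ion: "(\<lambda>s. grad_sq F (rcis s \<theta>)) integrable_on {x..y}" for x y
    by (rule integrable_continuous_interval[OF continuous_on_subset[OF cg]]) simp
  have B0: "B \<ge> 0" unfolding B_def by (rule integral_nonneg[OF ion]) (simp add: grad_sq_nonneg)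
  have R: "R > 0" using \<delta> by linarith
  have pt: "(norm (F (rcis r \<theta>)))\<^sup>2 \<le> 2 * a + 2 * \<delta> * B" if r: "R - \<delta> < r" "r < R" for r
  proof -
    have "(norm (F (rcis r \<theta>)))\<^sup>2 \<le> 2 * (norm (F (rcis R \<theta>)))\<^sup>2 + 2 * (norm (F (rcis r \<theta>) - F (rcis R \<theta>)))\<^sup>2"
      using norm_sum_sq_le[of "F (rcis R \<theta>)" "F (rcis r \<theta>) - F (rcis R \<theta>)"] by simp
    moreover have "(norm (F (rcis R \<theta>) - F (rcis r \<theta>)))\<^sup>2 \<le> (R - r) * integral {r..R} (\<lambda>s. grad_sq F (rcis s \<theta>))"
      by (rule radial_increment_bound[OF F]) (use r in simp)
    moreover have "(R - r) * integral {r..R} (\<lambda>s. grad_sq F (rcis s \<theta>)) \<le> \<delta> * B"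
      unfolding B_def
      by (intro mult_mono integral_subset_le ion integral_nonneg) (use r \<delta> in \<open>auto simp: grad_sq_nonneg\<close>)
    ultimately show ?thesis by (simp add: a_def norm_minus_commute)
  qed
  have "?L \<le> (\<integral>\<^sup>+r. ennreal (R * (2 * a + 2 * \<delta> * B)) * indicator {R - \<delta>..R} r \<partial>lborel)"
    unfolding radial_integral_def
  proof (rule nn_integral_mono)
    fix r
    show "indicator {0<..} r * ennreal r * ennreal (indicator A (rcis r \<theta>) * (norm (F (rcis r \<theta>)))\<^sup>2)
       \<le> ennreal (R * (2 * a + 2 * \<delta> * B)) * indicator {R - \<delta>..R} r"
    proof (cases "r > 0 \<and> R - \<delta> < r \<and> r < R")
      case True
      then have "r * (norm (F (rcis r \<theta>)))\<^sup>2 \<le> R * (2 * a + 2 * \<delta> * B)"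
        using pt[of r] by (intro mult_mono) auto
      then show ?thesis using True by (auto simp: indicator_def ennreal_mult''[symmetric] intro: ennreal_leI)
    next
      case False
      then show ?thesis by (auto simp: indicator_def A_def annulus_def)
    qed
  qed
  also have "\<dots> = ennreal (R * (2 * a + 2 * \<delta> * B)) * ennreal \<delta>"
    using \<delta> by (simp add: nn_integral_cmult_indicator)
  also have "\<dots> = ennreal (2 * R * \<delta>) * ennreal a + ennreal (2 * R * \<delta>\<^sup>2) * ennreal B"
    using R \<delta> B0 by (simp add: a_def ennreal_mult''[symmetric] ennreal_plus[symmetric] power2_eq_square algebra_simps del: ennreal_plus)
  also have "ennreal B \<le> ennreal (2 / R) * ?J"
  proof -
    have "ennreal B = (\<integral>\<^sup>+s. ennreal (indicator {R - \<delta>..R} s * grad_sq F (rcis s \<theta>)) \<partial>lborel)"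
      using nn_integral_has_integral_lebesgue[OF _ integrable_integral[OF ion, of "R - \<delta>" R]]
      by (simp add: B_def grad_sq_nonneg)
    also have "\<dots> \<le> (\<integral>\<^sup>+s. ennreal (2 / R) * (indicator {0<..} s * ennreal s * ennreal (indicator A (rcis s \<theta>) * grad_sq F (rcis s \<theta>))) \<partial>lborel)"
    proof (rule nn_integral_mono_AE)
      have "AE s in lborel. s \<noteq> R - \<delta>" "AE s in lborel. s \<noteq> R"
        by (auto intro!: AE_lborel_singleton)
      then show "AE s in lborel. ennreal (indicator {R - \<delta>..R} s * grad_sq F (rcis s \<theta>))
        \<le> ennreal (2 / R) * (indicator {0<..} s * ennreal s * ennreal (indicator A (rcis s \<theta>) * grad_sq F (rcis s \<theta>)))"
      proof eventually_elim
        case (elim s)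
        show ?case
        proof (cases "R - \<delta> < s \<and> s < R")
          case True
          then have "1 \<le> (2 / R) * s" using \<delta> R by (simp add: field_simps)
          then have "1 * grad_sq F (rcis s \<theta>) \<le> (2 / R) * s * grad_sq F (rcis s \<theta>)"
            by (intro mult_right_mono grad_sq_nonneg)
          moreover have "s > 0" "rcis s \<theta> \<in> A" using True \<delta> by (auto simp: A_def annulus_def)
          ultimately show ?thesis
            using True R grad_sq_nonneg[of F "rcis s \<theta>"]
            by (simp add: ennreal_mult''[symmetric] ennreal_mult[symmetric] ennreal_leI mult.assoc)
        next
          case False
          then have "s \<notin> {R - \<delta>..R}" using elim by auto
          then show ?thesis by simp
        qed
      qed
    qed
    also have "\<dots> = ennreal (2 / R) * ?J"
      unfolding radial_integral_def
    proof (rule nn_integral_cmult)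
      have [measurable]: "(\<lambda>s. grad_sq F (rcis s \<theta>)) \<in> borel_measurable borel" "(\<lambda>s. rcis s \<theta>) \<in> borel_measurable borel"
        using cg continuous_on_rcis(1) by (auto intro: borel_measurable_continuous_onI)
      show "(\<lambda>r. indicator {0<..} r * ennreal r * ennreal (indicator A (rcis r \<theta>) * grad_sq F (rcis r \<theta>))) \<in> borel_measurable lborel"
        unfolding A_def by measurable
    qed
    finally show ?thesis .
  qed
  also have "ennreal (2 * R * \<delta>\<^sup>2) * (ennreal (2 / R) * ?J) = ennreal (4 * \<delta>\<^sup>2) * ?J"
    using R by (simp add: mult.assoc[symmetric] ennreal_mult''[symmetric])
  finally show ?thesis by (simp add: a_def add_left_mono mult_left_mono)
qed

text \<open>The factor \<open>\<delta>\<^sup>2\<close> in front of the gradient compensates the gradient of order \<open>1/\<delta>\<close> of a function that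
  drops from 1 to 0 across the annulus; this is what makes a trace that vanishes only in the square mean sufficient below.\<close>

lemma boundary_layer_estimate:
  fixes F :: "complex \<Rightarrow> 'b::euclidean_space"
  assumes F: "Ck (Suc k) F" and \<delta>: "0 < \<delta>" "2 * \<delta> \<le> R"
  defines "A \<equiv> annulus (R - \<delta>) R"
  shows "(LINT z|lebesgue_on (ball 0 R). indicator A z * (norm (F z))\<^sup>2)
    \<le> 2 * R * \<delta> * (LINT \<theta>|lebesgue_on {0..2 * pi}. (norm (F (rcis R \<theta>)))\<^sup>2) +
      4 * \<delta>\<^sup>2 * (LINT z|lebesgue_on (ball 0 R). indicator A z * grad_sq F z)"
proof -
  have R: "R > 0" using \<delta> by linarith
  have cF: "continuous_on UNIV (\<lambda>z. (norm (F z))\<^sup>2)" by (intro continuous_intros Ck_continuous[OF F])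
  have cG: "continuous_on UNIV (grad_sq F)" by (rule continuous_grad_sq[OF F])
  have conv: "integrable lborel (\<lambda>z. indicator A z * f z)"
      "(LINT z|lebesgue_on (ball 0 R). indicator A z * f z) = (LINT z|lborel. indicator A z * f z)"
      "(\<lambda>z. indicator A z * f z) \<in> borel_measurable borel"
    if f: "continuous_on UNIV f" for f :: "complex \<Rightarrow> real"
  proof -
    have "integrable lborel (\<lambda>z. indicator (cball 0 R) z *\<^sub>R f z)"
      by (rule borel_integrable_compact) (auto intro: continuous_on_subset[OF f])
    then have "integrable lborel (\<lambda>z. indicator A z *\<^sub>R (indicator (cball 0 R) z *\<^sub>R f z))"
      by (rule integrable_mult_indicator[rotated]) (simp add: A_def)
    moreover have "indicator A z *\<^sub>R (indicator (cball 0 R) z *\<^sub>R f z) = indicator A z * f z" for z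
      by (auto simp: A_def annulus_def indicator_def)
    ultimately show "integrable lborel (\<lambda>z. indicator A z * f z)" by (simp only:)
    then show m: "(\<lambda>z. indicator A z * f z) \<in> borel_measurable borel" using borel_measurable_integrable by force
    show "(LINT z|lebesgue_on (ball 0 R). indicator A z * f z) = (LINT z|lborel. indicator A z * f z)"
      by (rule integral_lebesgue_on_support[OF m]) (auto simp: A_def annulus_def indicator_def)
  qed
  define a where "a = (\<lambda>\<theta>. (norm (F (rcis R \<theta>)))\<^sup>2)"
  have ca: "continuous_on UNIV a"
    unfolding a_def using continuous_on_compose2[OF cF continuous_on_rcis(2)] by simp
  have am[measurable]: "a \<in> borel_measurable borel" using ca by (rule borel_measurable_continuous_onI)
  have ia: "integrable lborel (\<lambda>\<theta>. indicator {0..2 * pi} \<theta> *\<^sub>R a \<theta>)"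
    by (rule borel_integrable_compact) (auto intro: continuous_on_subset[OF ca])
  have la: "(LINT \<theta>|lebesgue_on {0..2 * pi}. a \<theta>) = (LINT \<theta>|lborel. indicator {0..2 * pi} \<theta> *\<^sub>R a \<theta>)"
    using borel_measurable_integrable[OF ia] by (simp add: integral_restrict_space integral_completion)
  let ?J = "radial_integral (\<lambda>z. ennreal (indicator A z * grad_sq F z))"
  let ?L = "radial_integral (\<lambda>z. ennreal (indicator A z * (norm (F z))\<^sup>2))"
  have Jm: "?J \<in> borel_measurable lborel"
  proof -
    have P: "(\<lambda>p. rcis (snd p) (fst p)) \<in> borel_measurable (borel :: (real \<times> real) measure)"
      unfolding rcis_def cis_conv_exp by (intro borel_measurable_continuous_onI continuous_intros)
    have s: "(snd :: real \<times> real \<Rightarrow> real) \<in> borel_measurable borel"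
      by (intro borel_measurable_continuous_onI continuous_intros)
    have "(\<lambda>p. indicator A (rcis (snd p) (fst p)) * grad_sq F (rcis (snd p) (fst p))) \<in> borel_measurable (borel :: (real \<times> real) measure)"
      using measurable_compose[OF P conv(3)[OF cG]] .
    then have "(\<lambda>p. indicator {0<..} (snd p) * ennreal (snd p) * ennreal (indicator A (rcis (snd p) (fst p)) * grad_sq F (rcis (snd p) (fst p))))
       \<in> borel_measurable (borel :: (real \<times> real) measure)"
      using s by measurable
    then have "(\<lambda>(\<theta>, r). indicator {0<..} r * ennreal r * ennreal (indicator A (rcis r \<theta>) * grad_sq F (rcis r \<theta>)))
       \<in> borel_measurable (lborel \<Otimes>\<^sub>M lborel)"
      by (simp add: lborel_prod split_beta')
    then show ?thesis unfolding radial_integral_def[abs_def] by (rule lborel.borel_measurable_nn_integral)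
  qed
  have "ennreal (LINT z|lborel. indicator A z * (norm (F z))\<^sup>2) = (\<integral>\<^sup>+z. ennreal (indicator A z * (norm (F z))\<^sup>2) \<partial>lborel)"
    using conv(1)[OF cF] by (intro nn_integral_eq_integral[symmetric]) auto
  also have "\<dots> = (\<integral>\<^sup>+\<theta>. indicator {0<..<2 * pi} \<theta> * ?L \<theta> \<partial>lborel)"
    using conv(3)[OF cF] by (intro nn_integral_polar) simp
  also have "\<dots> \<le> (\<integral>\<^sup>+\<theta>. ennreal (2 * R * \<delta>) * (indicator {0<..<2 * pi} \<theta> * ennreal (a \<theta>))
      + ennreal (4 * \<delta>\<^sup>2) * (indicator {0<..<2 * pi} \<theta> * ?J \<theta>) \<partial>lborel)"
  proof (rule nn_integral_mono)
    fix \<theta>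
    have "indicator {0<..<2 * pi} \<theta> * ?L \<theta>
      \<le> indicator {0<..<2 * pi} \<theta> * (ennreal (2 * R * \<delta>) * ennreal (a \<theta>) + ennreal (4 * \<delta>\<^sup>2) * ?J \<theta>)"
      unfolding a_def A_def by (intro mult_left_mono fiber_estimate[OF F \<delta>]) simp
    then show "indicator {0<..<2 * pi} \<theta> * ?L \<theta>
      \<le> ennreal (2 * R * \<delta>) * (indicator {0<..<2 * pi} \<theta> * ennreal (a \<theta>)) + ennreal (4 * \<delta>\<^sup>2) * (indicator {0<..<2 * pi} \<theta> * ?J \<theta>)"
      by (simp add: distrib_left mult.left_commute)
  qed
  also have "\<dots> = ennreal (2 * R * \<delta>) * (\<integral>\<^sup>+\<theta>. indicator {0<..<2 * pi} \<theta> * ennreal (a \<theta>) \<partial>lborel)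
      + ennreal (4 * \<delta>\<^sup>2) * (\<integral>\<^sup>+\<theta>. indicator {0<..<2 * pi} \<theta> * ?J \<theta> \<partial>lborel)"
    using Jm by (subst nn_integral_add) (auto simp: nn_integral_cmult)
  also have "(\<integral>\<^sup>+\<theta>. indicator {0<..<2 * pi} \<theta> * ?J \<theta> \<partial>lborel) = (\<integral>\<^sup>+z. ennreal (indicator A z * grad_sq F z) \<partial>lborel)"
    using conv(3)[OF cG] by (intro nn_integral_polar[symmetric]) simp
  also have "\<dots> = ennreal (LINT z|lborel. indicator A z * grad_sq F z)"
    using conv(1)[OF cG] grad_sq_nonneg[of F] by (intro nn_integral_eq_integral AE_I2 mult_nonneg_nonneg) auto
  also have "(\<integral>\<^sup>+\<theta>. indicator {0<..<2 * pi} \<theta> * ennreal (a \<theta>) \<partial>lborel) \<le> (\<integral>\<^sup>+\<theta>. ennreal (indicator {0..2 * pi} \<theta> *\<^sub>R a \<theta>) \<partial>lborel)"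
    by (rule nn_integral_mono) (auto simp: indicator_def)
  also have "\<dots> = ennreal (LINT \<theta>|lborel. indicator {0..2 * pi} \<theta> *\<^sub>R a \<theta>)"
    using ia by (intro nn_integral_eq_integral) (auto simp: a_def)
  finally have "ennreal (LINT z|lborel. indicator A z * (norm (F z))\<^sup>2)
     \<le> ennreal (2 * R * \<delta>) * ennreal (LINT \<theta>|lborel. indicator {0..2 * pi} \<theta> *\<^sub>R a \<theta>)
      + ennreal (4 * \<delta>\<^sup>2) * ennreal (LINT z|lborel. indicator A z * grad_sq F z)"
    by (simp add: add_right_mono mult_left_mono)
  also have "\<dots> = ennreal (2 * R * \<delta> * (LINT \<theta>|lborel. indicator {0..2 * pi} \<theta> *\<^sub>R a \<theta>)
      + 4 * \<delta>\<^sup>2 * (LINT z|lborel. indicator A z * grad_sq F z))"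
    using R \<delta> by (subst ennreal_plus)
      (auto simp: ennreal_mult' a_def grad_sq_nonneg intro!: mult_nonneg_nonneg Bochner_Integration.integral_nonneg)
  finally have "(LINT z|lborel. indicator A z * (norm (F z))\<^sup>2)
     \<le> 2 * R * \<delta> * (LINT \<theta>|lborel. indicator {0..2 * pi} \<theta> *\<^sub>R a \<theta>)
      + 4 * \<delta>\<^sup>2 * (LINT z|lborel. indicator A z * grad_sq F z)"
    using R \<delta> by (subst (asm) ennreal_le_iff)
      (auto simp: a_def grad_sq_nonneg intro!: add_nonneg_nonneg mult_nonneg_nonneg Bochner_Integration.integral_nonneg)
  then show ?thesis unfolding conv(2)[OF cF] conv(2)[OF cG] la[unfolded a_def] a_def .
qed

text \<open>In polar coordinates the integrand becomes \<open>r powr (2 * \<alpha> - 1)\<close>.\<close>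

lemma integrable_norm_powr:
  assumes \<alpha>: "\<alpha> > 0"
  shows "integrable (lebesgue_on (ball 0 R)) (\<lambda>z::complex. norm z powr (2 * \<alpha> - 2))"
proof -
  have pm[measurable]: "(\<lambda>z::complex. norm z powr (2 * \<alpha> - 2)) \<in> borel_measurable borel" by measurable
  have bm[measurable]: "ball 0 R \<in> sets (borel :: complex measure)" by simp
  let ?f = "\<lambda>z::complex. indicator (ball 0 R) z * norm z powr (2 * \<alpha> - 2)"
  have "integrable lborel ?f"
  proof (rule integrableI_nonneg)
    have "(\<integral>\<^sup>+z. ennreal (?f z) \<partial>lborel)
       = (\<integral>\<^sup>+\<theta>. indicator {0<..<2 * pi} \<theta> * radial_integral (\<lambda>z. ennreal (?f z)) \<theta> \<partial>lborel)"
      by (rule nn_integral_polar) measurable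
    also have "\<dots> \<le> (\<integral>\<^sup>+\<theta>. ennreal (\<bar>R\<bar> powr (2 * \<alpha>) / (2 * \<alpha>)) * indicator {0<..<2 * pi} \<theta> \<partial>lborel)"
    proof (rule nn_integral_mono)
      fix \<theta>
      have "radial_integral (\<lambda>z. ennreal (?f z)) \<theta>
        \<le> (\<integral>\<^sup>+r. ennreal (indicator {0..\<bar>R\<bar>} r * r powr (2 * \<alpha> - 1)) \<partial>lborel)"
        unfolding radial_integral_def
      proof (rule nn_integral_mono)
        fix r
        show "indicator {0<..} r * ennreal r * ennreal (?f (rcis r \<theta>)) \<le> ennreal (indicator {0..\<bar>R\<bar>} r * r powr (2 * \<alpha> - 1))"
        proof (cases "0 < r \<and> r < R")
          case True
          have "r * r powr (2 * \<alpha> - 2) = r powr (2 * \<alpha> - 1)"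
            using True powr_mult_base[of r "2 * \<alpha> - 2"] by simp
          then show ?thesis using True by (simp add: ennreal_mult''[symmetric])
        next
          case False
          then show ?thesis by (auto simp: indicator_def)
        qed
      qed
      also have "\<dots> = ennreal (\<bar>R\<bar> powr (2 * \<alpha>) / (2 * \<alpha>))"
        using nn_integral_has_integral_lebesgue[OF _ has_integral_powr_from_0[of "2 * \<alpha> - 1" "\<bar>R\<bar>"]] \<alpha> by simp
      finally show "indicator {0<..<2 * pi} \<theta> * radial_integral (\<lambda>z. ennreal (?f z)) \<theta>
          \<le> ennreal (\<bar>R\<bar> powr (2 * \<alpha>) / (2 * \<alpha>)) * indicator {0<..<2 * pi} \<theta>"
        by (subst mult.commute) (intro mult_right_mono; simp)
    qed
    also have "\<dots> < \<infinity>"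
      by (simp add: nn_integral_cmult_indicator ennreal_mult_less_top)
    finally show "(\<integral>\<^sup>+z. ennreal (?f z) \<partial>lborel) < \<infinity>" .
  qed auto
  then have "integrable lebesgue ?f" using borel_measurable_integrable integrable_completion by blast
  then show ?thesis by (simp add: integrable_restrict_space)
qed

section \<open>The Jacobian is a null Lagrangian\<close>

text \<open>For the two partial derivatives of a map this is its Jacobian determinant.\<close>

definition wedge :: "complex \<Rightarrow> complex \<Rightarrow> real" where
  "wedge a b = Re a * Im b - Im a * Re b"

lemma wedge_inner: "wedge a b = (\<i> * a) \<bullet> b"
  by (simp add: wedge_def inner_complex_def)

lemma bounded_bilinear_wedge: "bounded_bilinear wedge"
proof -
  have "bounded_linear (\<lambda>a::complex. \<i> * a)" by (rule bounded_linear_mult_right)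
  from bounded_bilinear.comp1[OF bounded_bilinear_inner this]
  show ?thesis by (simp add: wedge_inner[abs_def])
qed

lemma abs_wedge_le: "\<bar>wedge a b\<bar> \<le> norm a * norm b"
  unfolding wedge_inner using Cauchy_Schwarz_ineq2[of "\<i> * a" b] by (simp add: norm_mult)

text \<open>The square of the positive part is continuously differentiable; nested twice it yields
  a transition from 0 on the negative half-line to 1 on \<open>{1..}\<close>.\<close>

definition pos_sq :: "real \<Rightarrow> real" where "pos_sq x = (max 0 x)\<^sup>2"

lemma DERIV_pos_sq: "(pos_sq has_real_derivative 2 * max 0 x) (at x)"
proof -
  consider "x < 0" | "x = 0" | "x > 0" by linarith
  then show ?thesis
  proof cases
    case 1
    have "((\<lambda>_. 0) has_real_derivative 0) (at x)" by simp
    then have "(pos_sq has_real_derivative 0) (at x)"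
      by (rule has_field_derivative_transform_within_open[of _ _ _ "{..<0}"]) (use 1 in \<open>auto simp: pos_sq_def\<close>)
    then show ?thesis using 1 by simp
  next
    case 2
    have "((\<lambda>h::real. max 0 h) \<longlongrightarrow> max 0 0) (at 0)" by (intro tendsto_intros)
    then have "((\<lambda>h::real. max 0 h) \<longlongrightarrow> 0) (at 0)" by simp
    then have "((\<lambda>h. (pos_sq (0 + h) - pos_sq 0) / h) \<longlongrightarrow> 0) (at 0)"
      by (rule Lim_transform_eventually)
        (auto simp: pos_sq_def eventually_at_filter max_def power2_eq_square intro!: always_eventually)
    then show ?thesis using 2 by (simp add: DERIV_def)
  next
    case 3
    have "((\<lambda>x. x\<^sup>2) has_real_derivative 2 * x) (at x)" by (auto intro!: derivative_eq_intros)
    then have "(pos_sq has_real_derivative 2 * x) (at x)"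
      by (rule has_field_derivative_transform_within_open[of _ _ _ "{0<..}"]) (use 3 in \<open>auto simp: pos_sq_def\<close>)
    then show ?thesis using 3 by simp
  qed
qed

definition step :: "real \<Rightarrow> real" where "step t = 1 - pos_sq (1 - pos_sq t)"
definition step' :: "real \<Rightarrow> real" where "step' t = 4 * max 0 (1 - pos_sq t) * max 0 t"

lemma DERIV_step: "(step has_real_derivative step' t) (at t)"
proof -
  have "((\<lambda>t. 1 - pos_sq t) has_real_derivative - (2 * max 0 t)) (at t)"
    using DERIV_diff[OF DERIV_const DERIV_pos_sq, of 1 t] by simp
  from DERIV_chain2[OF DERIV_pos_sq this]
  have "((\<lambda>t. pos_sq (1 - pos_sq t)) has_real_derivative 2 * max 0 (1 - pos_sq t) * - (2 * max 0 t)) (at t)" .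
  from DERIV_diff[OF DERIV_const this, of 1] show ?thesis
    by (simp add: step_def[abs_def] step'_def mult.assoc)
qed

lemma pos_sq_ge_1: "t \<ge> 1 \<Longrightarrow> pos_sq t \<ge> 1"
  by (simp add: pos_sq_def)

lemma pos_sq_le_1: "t \<le> 1 \<Longrightarrow> pos_sq t \<le> 1"
  by (simp add: pos_sq_def power_le_one)

lemma pos_sq_nonneg: "pos_sq t \<ge> 0"
  by (simp add: pos_sq_def)

lemma step_bounds: "0 \<le> step t" "step t \<le> 1" "t \<le> 0 \<Longrightarrow> step t = 0" "t \<ge> 1 \<Longrightarrow> step t = 1"
proof -
  show "0 \<le> step t" "step t \<le> 1"
    using pos_sq_le_1[of "1 - pos_sq t"] pos_sq_nonneg by (auto simp: step_def)
  show "t \<le> 0 \<Longrightarrow> step t = 0" by (simp add: step_def pos_sq_def)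
  show "t \<ge> 1 \<Longrightarrow> step t = 1" using pos_sq_ge_1[of t] by (simp add: step_def pos_sq_def[of "1 - pos_sq t"])
qed

lemma step'_bounds: "\<bar>step' t\<bar> \<le> 4" "t \<le> 0 \<or> t \<ge> 1 \<Longrightarrow> step' t = 0"
proof -
  show z: "step' t = 0" if "t \<le> 0 \<or> t \<ge> 1"
    using that pos_sq_ge_1[of t] by (auto simp: step'_def)
  show "\<bar>step' t\<bar> \<le> 4"
  proof (cases "t \<le> 0 \<or> t \<ge> 1")
    case False
    then have "max 0 (1 - pos_sq t) * max 0 t \<le> 1 * 1"
      using pos_sq_nonneg[of t] by (intro mult_mono) auto
    then show ?thesis by (simp add: step'_def abs_mult)
  qed (simp add: z)
qed

text \<open>Vanishes outside the disc and equals 1 up to a distance of order \<open>R / n\<close> from the circle. It is continuously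
  differentiable across the circle because \<^const>\<open>step\<close> is so at 0.\<close>

definition cutoff :: "real \<Rightarrow> nat \<Rightarrow> complex \<Rightarrow> real" where
  "cutoff R n z = step (real n * (1 - (z \<bullet> z) / R\<^sup>2))"

lemma cutoff_has_derivative:
  assumes "R > 0"
  shows "(cutoff R n has_derivative (\<lambda>h. step' (real n * (1 - (z \<bullet> z) / R\<^sup>2)) * (- (2 * real n / R\<^sup>2) * (z \<bullet> h)))) (at z)"
proof -
  have "((\<lambda>z. real n * (1 - (z \<bullet> z) / R\<^sup>2)) has_derivative (\<lambda>h. - (2 * real n / R\<^sup>2) * (z \<bullet> h))) (at z)"
    using assms by (auto intro!: derivative_eq_intros simp: inner_commute fun_eq_iff power2_eq_square field_simps)
  from has_derivative_compose[OF this DERIV_step[unfolded has_field_derivative_def]]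
  show ?thesis unfolding cutoff_def[abs_def] .
qed

lemma continuous_step': "continuous_on UNIV step'"
  unfolding step'_def[abs_def] pos_sq_def[abs_def] by (intro continuous_intros)

lemma Ck_cutoff: "R > 0 \<Longrightarrow> Ck (Suc 0) (cutoff R n)"
  by (rule CkI[OF cutoff_has_derivative])
    (auto intro!: continuous_intros continuous_on_compose2[OF continuous_step'])

lemma cutoff_bounds: "0 \<le> cutoff R n z" "cutoff R n z \<le> 1" "\<bar>cutoff R n z\<bar> \<le> 1"
  using step_bounds(1,2) by (auto simp: cutoff_def)

lemma cutoff_outside:
  assumes "R > 0" "norm z \<ge> R" shows "cutoff R n z = 0"
proof -
  have "R\<^sup>2 \<le> (norm z)\<^sup>2" using assms by (intro power_mono) auto
  then have "1 - (z \<bullet> z) / R\<^sup>2 \<le> 0" using assms by (simp add: dot_square_norm)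
  then show ?thesis unfolding cutoff_def by (intro step_bounds(3) mult_nonneg_nonpos) auto
qed

text \<open>The derivative of \<^const>\<open>step\<close> is nonzero only for \<open>1 - 1/n < (norm z / R)\<^sup>2 < 1\<close>, and
  \<open>1 - 1/n \<ge> (1 - 1/n)\<^sup>2\<close>.\<close>

lemma pd_cutoff_bound:
  assumes R: "R > 0" and n: "n \<ge> 1" and e: "norm e = 1"
  shows "\<bar>pd (cutoff R n) e z\<bar> \<le> indicator (annulus (R - R / real n) R) z * (8 * real n / R)"
proof -
  define t where "t = real n * (1 - (z \<bullet> z) / R\<^sup>2)"
  have pd: "pd (cutoff R n) e z = step' t * (- (2 * real n / R\<^sup>2) * (z \<bullet> e))"
    using pd_eq[OF cutoff_has_derivative[OF R]] by (simp add: t_def)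
  show ?thesis
  proof (cases "t \<le> 0 \<or> t \<ge> 1")
    case True
    then show ?thesis using R by (simp add: pd step'_bounds(2))
  next
    case False
    then have t: "0 < t" "t < 1" by auto
    have "(norm z)\<^sup>2 < R\<^sup>2"
      using t(1) n R by (simp add: t_def zero_less_mult_iff dot_square_norm divide_less_eq_1)
    then have zR: "norm z < R" using R by (simp add: power2_less_imp_less)
    have "1 - 1 / real n < (norm z / R)\<^sup>2"
      using t(2) n by (simp add: t_def dot_square_norm power_divide field_simps)
    moreover have "(1 - 1 / real n)\<^sup>2 \<le> 1 - 1 / real n"
    proof -
      have "1 / real n \<le> 1" using n by simp
      then have "(1 - 1 / real n) * (1 - 1 / real n) \<le> (1 - 1 / real n) * 1" by (intro mult_left_mono) auto
      then show ?thesis by (simp add: power2_eq_square)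
    qed
    ultimately have "(1 - 1 / real n)\<^sup>2 < (norm z / R)\<^sup>2" by linarith
    then have "1 - 1 / real n < norm z / R" by (rule power2_less_imp_less) (use R in simp)
    then have zA: "R - R / real n < norm z" using R by (simp add: field_simps)
    have "\<bar>z \<bullet> e\<bar> \<le> R"
      using Cauchy_Schwarz_ineq2[of z e] e zR by simp
    then have "\<bar>step' t\<bar> * (2 * real n / R\<^sup>2 * \<bar>z \<bullet> e\<bar>) \<le> 4 * (2 * real n / R\<^sup>2 * R)"
      using R by (intro mult_mono step'_bounds mult_left_mono) auto
    also have "\<dots> = 8 * real n / R" using R by (simp add: power2_eq_square)
    finally show ?thesis using zR zA R by (simp add: pd abs_mult annulus_def)
  qed
qed

lemma cutoff_tendsto:
  assumes "R > 0" "norm z < R" shows "(\<lambda>n. cutoff R n z) \<longlonglongrightarrow> 1"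
proof -
  define c where "c = 1 - (z \<bullet> z) / R\<^sup>2"
  have "(norm z)\<^sup>2 < R\<^sup>2" using assms by (intro power_strict_mono) auto
  then have c: "c > 0" using assms by (simp add: c_def dot_square_norm)
  obtain N where N: "1 / c < real N" using reals_Archimedean2 by blast
  have "cutoff R n z = 1" if "n \<ge> N" for n
  proof -
    have "1 / c \<le> real n" using N that by linarith
    then have "1 \<le> real n * c" using c by (simp add: divide_le_eq)
    then show ?thesis by (simp add: cutoff_def c_def step_bounds(4))
  qed
  then show ?thesis by (intro tendsto_eventually) (auto simp: eventually_sequentially)
qed

definition jac :: "(complex \<Rightarrow> complex) \<Rightarrow> (complex \<Rightarrow> complex) \<Rightarrow> complex \<Rightarrow> real" where
  "jac F W z = wedge (pd F 1 z) (pd W \<i> z) - wedge (pd F \<i> z) (pd W 1 z)"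

lemma integrable_indicator_continuous_ball:
  fixes f :: "complex \<Rightarrow> real"
  assumes f: "continuous_on UNIV f" and A: "A \<in> sets borel"
  shows "integrable (lebesgue_on (ball 0 R)) (\<lambda>z. indicator A z * f z)"
proof -
  have "integrable lborel (\<lambda>z. indicator (cball 0 R) z *\<^sub>R f z)"
    by (rule borel_integrable_compact) (auto intro: continuous_on_subset[OF f])
  then have "integrable lborel (\<lambda>z. indicator (A \<inter> ball 0 R) z *\<^sub>R (indicator (cball 0 R) z *\<^sub>R f z))"
    by (rule integrable_mult_indicator[rotated]) (use A in auto)
  moreover have "indicator (A \<inter> ball 0 R) z *\<^sub>R (indicator (cball 0 R) z *\<^sub>R f z) = indicator (ball 0 R) z *\<^sub>R (indicator A z * f z)" for z
    by (auto simp: indicator_def)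
  ultimately have "integrable lborel (\<lambda>z. indicator (ball 0 R) z *\<^sub>R (indicator A z * f z))" by (simp only:)
  then have "integrable lebesgue (\<lambda>z. indicator (ball 0 R) z *\<^sub>R (indicator A z * f z))"
    using borel_measurable_integrable integrable_completion by blast
  then show ?thesis by (simp add: integrable_restrict_space)
qed

text \<open>The Jacobian expression is a divergence in \<open>F\<close>, so the derivatives can be moved from \<open>F\<close> to the cutoff. There
  remain products of \<open>F / \<delta>\<close> and derivatives of \<open>W\<close> over the annulus of width \<open>\<delta> = R / n\<close>; the first factor is
  controlled by the boundary layer estimate.\<close>

lemma jac_cutoff_estimate:
  assumes F: "Ck (Suc 0) F" and W: "Ck (Suc (Suc 0)) W" and R: "R > 0" and n: "n \<ge> 2"
  defines "A \<equiv> annulus (R - R / real n) R"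
  shows "\<bar>LINT z|lebesgue_on (ball 0 R). cutoff R n z * jac F W z\<bar>
    \<le> 16 * real n * (LINT \<theta>|lebesgue_on {0..2 * pi}. (norm (F (rcis R \<theta>)))\<^sup>2)
      + 32 * (LINT z|lebesgue_on (ball 0 R). indicator A z * grad_sq F z)
      + 4 * (LINT z|lebesgue_on (ball 0 R). indicator A z * grad_sq W z)"
proof -
  interpret wedge: bounded_bilinear wedge by (rule bounded_bilinear_wedge)
  let ?M = "lebesgue_on (ball 0 R :: complex set)"
  have W1: "Ck (Suc 0) W" using W Ck_Suc_imp by blast
  have B: "(1::complex) \<in> Basis" "\<i> \<in> Basis" by (auto simp: Basis_complex_def)
  define \<psi> where "\<psi> = cutoff R n"
  have C\<psi>: "Ck (Suc 0) \<psi>" unfolding \<psi>_def by (rule Ck_cutoff[OF R])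
  \<comment> \<open>This product vanishes outside the disc, so \<open>integral_cross_derivatives\<close> applies to it on the whole plane.\<close>
  define G where "G = (\<lambda>z. \<psi> z *\<^sub>R F z)"
  have G: "Ck (Suc 0) G" unfolding G_def by (rule Ck_scaleR[OF C\<psi> F])
  have pdG: "pd G e z = \<psi> z *\<^sub>R pd F e z + pd \<psi> e z *\<^sub>R F z" for e z
    unfolding G_def by (rule pd_bilinear[OF bounded_bilinear_scaleR C\<psi> F])
  have G0: "G z = 0" if "norm z \<ge> R" for z using cutoff_outside[OF R that] by (simp add: G_def \<psi>_def)
  note cont = Ck_continuous[OF F] Ck_continuous[OF C\<psi>] Ck_pd_continuous[OF F] Ck_pd_continuous[OF W1] Ck_pd_continuous[OF C\<psi>]
  have in_ball: "\<psi> z = 0" "pd \<psi> 1 z = 0" "pd \<psi> \<i> z = 0" if "z \<notin> ball 0 R" for z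
    using that cutoff_outside[OF R, of z n] pd_cutoff_bound[OF R, of n 1 z] pd_cutoff_bound[OF R, of n \<i> z] n
    by (auto simp: \<psi>_def annulus_def)
  let ?X = "\<lambda>z. \<psi> z * jac F W z"
  let ?Y = "\<lambda>z. wedge (pd \<psi> 1 z *\<^sub>R F z) (pd W \<i> z) - wedge (pd \<psi> \<i> z *\<^sub>R F z) (pd W 1 z)"
  have cX: "continuous_on UNIV ?X" unfolding jac_def by (intro continuous_intros wedge.continuous_on cont B)
  have cY: "continuous_on UNIV ?Y" by (intro continuous_intros wedge.continuous_on cont B)
  have iX: "integrable lborel ?X"
    by (rule integrable_continuous_bounded_support[OF cX, of R]) (auto simp: in_ball)
  have iY: "integrable lborel ?Y"
    by (rule integrable_continuous_bounded_support[OF cY, of R]) (auto simp: in_ball wedge.zero_left)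
  have "(LINT z|lborel. wedge (pd G 1 z) (pd W \<i> z)) = (LINT z|lborel. wedge (pd G \<i> z) (pd W 1 z))"
    by (rule integral_cross_derivatives[OF bounded_bilinear_wedge G W B, of R]) (use G0 in auto)
  moreover have "integrable lborel (\<lambda>z. wedge (pd G e z) (pd W e' z))" if "e \<in> Basis" "e' \<in> Basis" for e e'
    using pd_bounded_support[of R G] G0
    by (intro integrable_continuous_bounded_support[of _ R] wedge.continuous_on Ck_pd_continuous[OF G that(1)]
        Ck_pd_continuous[OF W1 that(2)]) (auto simp: wedge.zero_left)
  ultimately have "(LINT z|lborel. wedge (pd G 1 z) (pd W \<i> z) - wedge (pd G \<i> z) (pd W 1 z)) = 0"
    using B by simp
  moreover have "wedge (pd G 1 z) (pd W \<i> z) - wedge (pd G \<i> z) (pd W 1 z) = ?X z + ?Y z" for z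
    by (simp add: pdG jac_def wedge.add_left wedge.scaleR_left algebra_simps)
  ultimately have eq: "(LINT z|lborel. ?X z) = - (LINT z|lborel. ?Y z)" using iX iY by simp
  have X: "(LINT z|?M. ?X z) = (LINT z|lborel. ?X z)"
    by (rule integral_lebesgue_on_support) (auto simp: in_ball borel_measurable_continuous_onI[OF cX])
  have Y: "(LINT z|?M. ?Y z) = (LINT z|lborel. ?Y z)"
    by (rule integral_lebesgue_on_support) (auto simp: in_ball wedge.zero_left borel_measurable_continuous_onI[OF cY])
  define \<delta> where "\<delta> = R / real n"
  have \<delta>: "0 < \<delta>" "2 * \<delta> \<le> R" using R n by (auto simp: \<delta>_def field_simps)
  have A: "A = annulus (R - \<delta>) R" by (simp add: A_def \<delta>_def)
  have Ab: "A \<in> sets borel" unfolding A by (rule annulus_borel)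
  have pt: "\<bar>?Y z\<bar> \<le> 8 / \<delta>\<^sup>2 * (indicator A z * (norm (F z))\<^sup>2) + 4 * (indicator A z * grad_sq W z)" for z
  proof -
    have one: "\<bar>wedge (pd \<psi> e z *\<^sub>R F z) w\<bar> \<le> indicator A z * (4 / \<delta>\<^sup>2 * (norm (F z))\<^sup>2 + 4 * (norm w)\<^sup>2)" if "norm e = 1" for e w
    proof -
      have "\<bar>wedge (pd \<psi> e z *\<^sub>R F z) w\<bar> \<le> \<bar>pd \<psi> e z\<bar> * (norm (F z) * norm w)"
        using abs_wedge_le[of "pd \<psi> e z *\<^sub>R F z" w] by (simp add: mult.assoc)
      also have "\<dots> \<le> indicator A z * (8 / \<delta>) * (norm (F z) * norm w)"
        using pd_cutoff_bound[OF R _ that, of n z] n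
        by (intro mult_right_mono) (auto simp: \<psi>_def A_def \<delta>_def)
      also have "\<dots> = indicator A z * (4 * (2 * (norm (F z) / \<delta>) * norm w))" by simp
      also have "\<dots> \<le> indicator A z * (4 * ((norm (F z) / \<delta>)\<^sup>2 + (norm w)\<^sup>2))"
        by (intro mult_left_mono sum_squares_bound) auto
      finally show ?thesis by (simp add: power_divide algebra_simps)
    qed
    have "\<bar>?Y z\<bar> \<le> indicator A z * (4 / \<delta>\<^sup>2 * (norm (F z))\<^sup>2 + 4 * (norm (pd W \<i> z))\<^sup>2)
        + indicator A z * (4 / \<delta>\<^sup>2 * (norm (F z))\<^sup>2 + 4 * (norm (pd W 1 z))\<^sup>2)"
      using one[of 1 "pd W \<i> z"] one[of \<i> "pd W 1 z"] by simp
    also have "\<dots> = 8 / \<delta>\<^sup>2 * (indicator A z * (norm (F z))\<^sup>2) + 4 * (indicator A z * grad_sq W z)"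
      by (simp add: grad_sq_def Basis_complex_def algebra_simps)
    finally show ?thesis .
  qed
  have iF: "integrable ?M (\<lambda>z. indicator A z * (norm (F z))\<^sup>2)"
    by (intro integrable_indicator_continuous_ball Ab continuous_intros cont)
  have iW: "integrable ?M (\<lambda>z. indicator A z * grad_sq W z)"
    by (intro integrable_indicator_continuous_ball Ab continuous_grad_sq[OF W1])
  have iYM: "integrable ?M ?Y"
    using integrable_indicator_continuous_ball[OF cY, of UNIV R] by simp
  have "\<bar>LINT z|?M. ?X z\<bar> = \<bar>LINT z|?M. ?Y z\<bar>" by (simp add: X Y eq)
  also have "\<dots> \<le> (LINT z|?M. \<bar>?Y z\<bar>)" using integral_norm_bound[of ?M ?Y] by simp
  also have "\<dots> \<le> (LINT z|?M. 8 / \<delta>\<^sup>2 * (indicator A z * (norm (F z))\<^sup>2) + 4 * (indicator A z * grad_sq W z))"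
    by (intro integral_mono pt integrable_abs iYM Bochner_Integration.integrable_add integrable_mult_right iF iW)
  also have "\<dots> = 8 / \<delta>\<^sup>2 * (LINT z|?M. indicator A z * (norm (F z))\<^sup>2) + 4 * (LINT z|?M. indicator A z * grad_sq W z)"
    using iF iW by simp
  also have "\<dots> \<le> 8 / \<delta>\<^sup>2 * (2 * R * \<delta> * (LINT \<theta>|lebesgue_on {0..2 * pi}. (norm (F (rcis R \<theta>)))\<^sup>2) +
      4 * \<delta>\<^sup>2 * (LINT z|?M. indicator A z * grad_sq F z)) + 4 * (LINT z|?M. indicator A z * grad_sq W z)"
    unfolding A by (intro add_right_mono mult_left_mono boundary_layer_estimate[OF F \<delta>]) simp
  also have "\<dots> = 16 * real n * (LINT \<theta>|lebesgue_on {0..2 * pi}. (norm (F (rcis R \<theta>)))\<^sup>2)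
      + 32 * (LINT z|?M. indicator A z * grad_sq F z) + 4 * (LINT z|?M. indicator A z * grad_sq W z)"
    using R n by (simp add: \<delta>_def field_simps power2_eq_square)
  finally show ?thesis by (simp add: \<psi>_def)
qed

lemma L2_lim_norm_sq:
  fixes a :: "'a::euclidean_space \<Rightarrow> 'b::euclidean_space"
  assumes "L2_lim \<Omega> A a"
  shows "L1_lim \<Omega> (\<lambda>k x. (norm (A k x))\<^sup>2) (\<lambda>x. (norm (a x))\<^sup>2)"
  using L2_lim_bilinear[OF bounded_bilinear_inner assms assms] by (simp add: dot_square_norm)

text \<open>For a fixed cutoff the estimate passes to the limit along the approximations, and the boundary term
  disappears. The remaining bound is the integral of fixed integrable functions over annuli that shrink to the empty set
  as the cutoff tends to 1.\<close>

lemma jacobian_null_Lagrangian: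
  fixes f w :: "complex \<Rightarrow> complex"
  assumes R: "R > 0" and f: "smooth_approx (ball 0 R) F f f'" and w: "smooth_approx (ball 0 R) W w w'"
    and trace0: "(\<lambda>k. LINT \<theta>|lebesgue_on {0..2 * pi}. (norm (F k (rcis R \<theta>)))\<^sup>2) \<longlonglongrightarrow> 0"
  shows "(LINT z|lebesgue_on (ball 0 R). wedge (f' 1 z) (w' \<i> z) - wedge (f' \<i> z) (w' 1 z)) = 0"
proof -
  let ?M = "lebesgue_on (ball 0 R :: complex set)"
  interpret wedge: bounded_bilinear wedge by (rule bounded_bilinear_wedge)
  have B: "(1::complex) \<in> Basis" "\<i> \<in> Basis" by (auto simp: Basis_complex_def)
  have C: "Ck j (F k)" "Ck j (W k)" for j k using f w by (auto simp: smooth_approx_def smooth_def)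
  have LF: "L2_lim (ball 0 R) (\<lambda>k. pd (F k) e) (f' e)" and LW: "L2_lim (ball 0 R) (\<lambda>k. pd (W k) e) (w' e)"
    if "e \<in> Basis" for e using f w that by (auto simp: smooth_approx_def)
  define J where "J = (\<lambda>z. wedge (f' 1 z) (w' \<i> z) - wedge (f' \<i> z) (w' 1 z))"
  have LJ: "L1_lim (ball 0 R) (\<lambda>k. jac (F k) (W k)) J"
    using L1_lim_add[OF L2_lim_bilinear[OF bounded_bilinear_wedge LF[OF B(1)] LW[OF B(2)]]
        L2_lim_bilinear[OF bounded_bilinear_wedge L2_lim_uminus[OF LF[OF B(2)]] LW[OF B(1)]]]
    by (simp add: J_def jac_def[abs_def] wedge.minus_left)
  define g where "g = (\<lambda>z. (norm (f' 1 z))\<^sup>2 + (norm (f' \<i> z))\<^sup>2)"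
  define h where "h = (\<lambda>z. (norm (w' 1 z))\<^sup>2 + (norm (w' \<i> z))\<^sup>2)"
  have gs: "grad_sq U z = (norm (pd U 1 z))\<^sup>2 + (norm (pd U \<i> z))\<^sup>2" for U :: "complex \<Rightarrow> complex" and z
    by (simp add: grad_sq_def Basis_complex_def)
  have Lg: "L1_lim (ball 0 R) (\<lambda>k. grad_sq (F k)) g"
    using L1_lim_add[OF L2_lim_norm_sq[OF LF[OF B(1)]] L2_lim_norm_sq[OF LF[OF B(2)]]]
    by (simp add: g_def gs[abs_def])
  have Lh: "L1_lim (ball 0 R) (\<lambda>k. grad_sq (W k)) h"
    using L1_lim_add[OF L2_lim_norm_sq[OF LW[OF B(1)]] L2_lim_norm_sq[OF LW[OF B(2)]]]
    by (simp add: h_def gs[abs_def])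
  have i: "integrable ?M J" "integrable ?M g" "integrable ?M h"
    using LJ Lg Lh by (auto simp: L1_lim_def)
  define A where "A = (\<lambda>n::nat. annulus (R - R / real n) R)"
  have Am[measurable]: "indicat_real (A n) \<in> borel_measurable ?M" for n
    by (intro measurable_restrict_space1 measurable_completion) (simp add: A_def)
  have cm[measurable]: "cutoff R n \<in> borel_measurable ?M" for n
    by (rule continuous_measurable_lebesgue_on[OF Ck_continuous[OF Ck_cutoff[OF R]]])
  have est: "\<bar>LINT z|?M. cutoff R n z * J z\<bar> \<le> 32 * (LINT z|?M. indicator (A n) z * g z) + 4 * (LINT z|?M. indicator (A n) z * h z)"
    if n: "n \<ge> 2" for n
  proof (rule LIMSEQ_le)
    show "(\<lambda>k. \<bar>LINT z|?M. cutoff R n z * jac (F k) (W k) z\<bar>) \<longlonglongrightarrow> \<bar>LINT z|?M. cutoff R n z * J z\<bar>"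
      using L1_lim_integral_mult[OF LJ cm cutoff_bounds(3)] by (intro tendsto_rabs) simp
    have "(\<lambda>k. 16 * real n * (LINT \<theta>|lebesgue_on {0..2 * pi}. (norm (F k (rcis R \<theta>)))\<^sup>2)
        + 32 * (LINT z|?M. indicator (A n) z * grad_sq (F k) z) + 4 * (LINT z|?M. indicator (A n) z * grad_sq (W k) z))
        \<longlonglongrightarrow> 16 * real n * 0 + 32 * (LINT z|?M. indicator (A n) z * g z) + 4 * (LINT z|?M. indicator (A n) z * h z)"
      using L1_lim_integral_mult[OF Lg Am[of n], of 1] L1_lim_integral_mult[OF Lh Am[of n], of 1]
      by (intro tendsto_intros trace0) (auto simp: indicator_def)
    then show "(\<lambda>k. 16 * real n * (LINT \<theta>|lebesgue_on {0..2 * pi}. (norm (F k (rcis R \<theta>)))\<^sup>2)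
        + 32 * (LINT z|?M. indicator (A n) z * grad_sq (F k) z) + 4 * (LINT z|?M. indicator (A n) z * grad_sq (W k) z))
        \<longlonglongrightarrow> 32 * (LINT z|?M. indicator (A n) z * g z) + 4 * (LINT z|?M. indicator (A n) z * h z)"
      by simp
    show "\<exists>N. \<forall>k\<ge>N. \<bar>LINT z|?M. cutoff R n z * jac (F k) (W k) z\<bar>
        \<le> 16 * real n * (LINT \<theta>|lebesgue_on {0..2 * pi}. (norm (F k (rcis R \<theta>)))\<^sup>2)
        + 32 * (LINT z|?M. indicator (A n) z * grad_sq (F k) z) + 4 * (LINT z|?M. indicator (A n) z * grad_sq (W k) z)"
      using jac_cutoff_estimate[OF C R n] by (auto simp: A_def)
  qed
  have limJ: "(\<lambda>n. LINT z|?M. cutoff R n z * J z) \<longlonglongrightarrow> (LINT z|?M. J z)"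
  proof (rule integral_dominated_convergence[where w = "\<lambda>z. norm (J z)"])
    show "AE z in ?M. (\<lambda>n. cutoff R n z * J z) \<longlonglongrightarrow> J z"
    proof (rule AE_I2)
      fix z assume "z \<in> space ?M"
      then have "norm z < R" by simp
      from tendsto_mult[OF cutoff_tendsto[OF R this] tendsto_const[of "J z"]]
      show "(\<lambda>n. cutoff R n z * J z) \<longlonglongrightarrow> J z" by simp
    qed
    show "AE z in ?M. norm (cutoff R n z * J z) \<le> norm (J z)" for n
      using cutoff_bounds[of R n] by (intro AE_I2) (simp add: abs_mult mult_left_le_one_le)
  qed (use i(1) in auto)
  have lim0: "(\<lambda>n. LINT z|?M. indicator (A n) z * k z) \<longlonglongrightarrow> 0" if k: "integrable ?M k" for k :: "complex \<Rightarrow> real"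
  proof -
    have "(\<lambda>n. LINT z|?M. indicator (A n) z * k z) \<longlonglongrightarrow> (LINT z|?M. 0)"
    proof (rule integral_dominated_convergence[where w = "\<lambda>z. norm (k z)"])
      show "AE z in ?M. (\<lambda>n. indicator (A n) z * k z) \<longlonglongrightarrow> 0"
      proof (rule AE_I2)
        fix z assume "z \<in> space ?M"
        then have z: "R - norm z > 0" by simp
        obtain N where N: "R / (R - norm z) < real N" using reals_Archimedean2 by blast
        have "indicator (A n) z * k z = 0" if "n \<ge> N" for n
        proof -
          have nz: "R / (R - norm z) < real n" using N that by linarith
          moreover have "0 < R / (R - norm z)" using R z by simp
          ultimately have n: "real n > 0" by linarith
          have "R / real n < R - norm z" using nz z n by (simp add: field_simps)
          then show ?thesis by (simp add: A_def annulus_def)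
        qed
        then show "(\<lambda>n. indicator (A n) z * k z) \<longlonglongrightarrow> 0"
          by (intro tendsto_eventually) (auto simp: eventually_sequentially)
      qed
      show "AE z in ?M. norm (indicator (A n) z * k z) \<le> norm (k z)" for n
        by (intro AE_I2) (simp add: indicator_def)
    qed (use k in auto)
    then show ?thesis by simp
  qed
  have "\<bar>LINT z|?M. J z\<bar> \<le> 32 * 0 + 4 * 0"
  proof (rule LIMSEQ_le)
    show "(\<lambda>n. \<bar>LINT z|?M. cutoff R n z * J z\<bar>) \<longlonglongrightarrow> \<bar>LINT z|?M. J z\<bar>" by (rule tendsto_rabs[OF limJ])
    show "(\<lambda>n. 32 * (LINT z|?M. indicator (A n) z * g z) + 4 * (LINT z|?M. indicator (A n) z * h z)) \<longlonglongrightarrow> 32 * 0 + 4 * 0"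
      by (intro tendsto_intros lim0 i)
  qed (use est in blast)
  then show ?thesis by (simp add: J_def)
qed

section \<open>Sobolev functions with a trace\<close>

text \<open>Lebesgue measure is complete. This makes integrals of the chosen derivatives \<^const>\<open>weak_deriv\<close>
  computable from any known weak derivative.\<close>

lemma borel_measurable_lebesgue_on_AE:
  fixes f g :: "'a::euclidean_space \<Rightarrow> 'b::topological_space"
  assumes \<Omega>: "\<Omega> \<in> sets lebesgue" and g: "g \<in> borel_measurable (lebesgue_on \<Omega>)"
    and ae: "AE x in lebesgue_on \<Omega>. f x = g x"
  shows "f \<in> borel_measurable (lebesgue_on \<Omega>)"
proof (rule measurableI)
  let ?M = "lebesgue_on \<Omega>"
  fix S :: "'b set" assume S: "S \<in> sets borel"
  have "AE x in lebesgue. x \<in> \<Omega> \<longrightarrow> f x = g x" using ae \<Omega> by (simp add: AE_restrict_space_iff)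
  then obtain N where N: "N \<in> null_sets lebesgue" "{x. \<not> (x \<in> \<Omega> \<longrightarrow> f x = g x)} \<subseteq> N"
    using eventually_ae_filter[of "\<lambda>x. x \<in> \<Omega> \<longrightarrow> f x = g x" lebesgue] by auto
  have null: "X \<in> sets lebesgue" if "X \<subseteq> N" for X
    using null_sets_completion_subset[OF that N(1)] by blast
  have "g -` S \<inter> \<Omega> \<in> sets ?M" using measurable_sets[OF g S] by simp
  then have gS: "g -` S \<inter> \<Omega> \<in> sets lebesgue" using \<Omega> by (simp add: sets_restrict_space_iff)
  have "f -` S \<inter> \<Omega> = (g -` S \<inter> \<Omega> - N) \<union> (f -` S \<inter> \<Omega> \<inter> N)" using N(2) by auto
  also have "\<dots> \<in> sets lebesgue" using gS N(1) null[of "f -` S \<inter> \<Omega> \<inter> N"] by auto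
  finally show "f -` S \<inter> space ?M \<in> sets ?M"
    using \<Omega> by (simp add: sets_restrict_space_iff)
qed simp

lemma integral_cong_AE_lebesgue_on:
  fixes f g :: "'a::euclidean_space \<Rightarrow> real"
  assumes "\<Omega> \<in> sets lebesgue" "g \<in> borel_measurable (lebesgue_on \<Omega>)"
    and "AE x in lebesgue_on \<Omega>. f x = g x"
  shows "integral\<^sup>L (lebesgue_on \<Omega>) f = integral\<^sup>L (lebesgue_on \<Omega>) g"
  by (rule integral_cong_AE[OF borel_measurable_lebesgue_on_AE[OF assms] assms(2,3)])

lemma weak_deriv_AE:
  assumes "open \<Omega>" "is_weak_deriv \<Omega> e u v"
  shows "AE x in lebesgue_on \<Omega>. weak_deriv \<Omega> e u x = v x"
proof (rule weak_deriv_unique[OF assms(1) _ assms(2)])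
  show "is_weak_deriv \<Omega> e u (weak_deriv \<Omega> e u)"
    unfolding weak_deriv_def using assms(2) by (rule someI[of "is_weak_deriv \<Omega> e u"])
qed

lemma weak_grad_sq_AE:
  assumes "open \<Omega>" "\<And>e. e \<in> Basis \<Longrightarrow> is_weak_deriv \<Omega> e u (v e)"
  shows "AE x in lebesgue_on \<Omega>. weak_grad_sq \<Omega> u x = (\<Sum>e\<in>Basis. (norm (v e x))\<^sup>2)"
proof -
  have "AE x in lebesgue_on \<Omega>. \<forall>e\<in>Basis. weak_deriv \<Omega> e u x = v e x"
    using assms by (intro AE_finite_allI weak_deriv_AE) auto
  then show ?thesis by eventually_elim (simp add: weak_grad_sq_def)
qed

lemma is_weak_deriv_diff:
  assumes u: "is_weak_deriv \<Omega> e u v" and u': "is_weak_deriv \<Omega> e u' v'" and \<Omega>: "\<Omega> \<in> sets lebesgue"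
    and e: "e \<in> Basis"
  shows "is_weak_deriv \<Omega> e (\<lambda>x. u x - u' x) (\<lambda>x. v x - v' x)"
  unfolding is_weak_deriv_def
proof (intro conjI ballI)
  let ?M = "lebesgue_on \<Omega>"
  have l: "locally_integrable \<Omega> u" "locally_integrable \<Omega> u'" "locally_integrable \<Omega> v" "locally_integrable \<Omega> v'"
    using u u' by (auto simp: is_weak_deriv_def)
  then show "locally_integrable \<Omega> (\<lambda>x. u x - u' x)" "locally_integrable \<Omega> (\<lambda>x. v x - v' x)"
    by (auto simp: locally_integrable_def)
  fix \<phi> assume \<phi>: "\<phi> \<in> test_functions \<Omega>"
  obtain B where B: "\<And>x. \<bar>pd \<phi> e x\<bar> \<le> B" by (rule test_function_bounded[OF \<phi> e]) blast
  have ip: "integrable ?M (\<lambda>x. pd \<phi> e x *\<^sub>R f x)" if "locally_integrable \<Omega> f" for f :: "'a \<Rightarrow> 'b"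
  proof (rule integrable_locally_integrable_mult[OF that, where K = "closure {x. \<phi> x \<noteq> 0}"])
    show "pd \<phi> e \<in> borel_measurable borel"
      by (intro borel_measurable_continuous_onI Ck_pd_continuous[OF test_function_Ck[OF \<phi>] e])
    show "pd \<phi> e x = 0" if "x \<notin> closure {x. \<phi> x \<noteq> 0}" for x
    proof (rule test_function_pd_zero[OF _ that])
      show "\<phi> \<in> test_functions (closure {x. \<phi> x \<noteq> 0})" using \<phi> by (simp add: test_functions_def)
    qed
  qed (use \<phi> \<Omega> B in \<open>auto simp: test_functions_def\<close>)
  show "(LINT x|?M. pd \<phi> e x *\<^sub>R (u x - u' x)) = - (LINT x|?M. \<phi> x *\<^sub>R (v x - v' x))"
    using u u' \<phi> ip[OF l(1)] ip[OF l(2)] integrable_test_function_mult[OF l(3) \<phi> \<Omega>]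
      integrable_test_function_mult[OF l(4) \<phi> \<Omega>]
    by (simp add: scaleR_diff_right is_weak_deriv_def)
qed

lemma H1_norm_diff_eq:
  fixes u :: "'a::euclidean_space \<Rightarrow> 'b::euclidean_space"
  assumes \<Omega>: "open \<Omega>" and U: "Ck (Suc 0) U" "U \<in> L2_on \<Omega>" "\<And>e. e \<in> Basis \<Longrightarrow> pd U e \<in> L2_on \<Omega>"
    and u: "u \<in> L2_on \<Omega>" "\<And>e. e \<in> Basis \<Longrightarrow> v e \<in> L2_on \<Omega>" "\<And>e. e \<in> Basis \<Longrightarrow> is_weak_deriv \<Omega> e u (v e)"
  shows "H1_norm \<Omega> (\<lambda>x. U x - u x) = sqrt ((LINT x|lebesgue_on \<Omega>. (norm (U x - u x))\<^sup>2)
     + (\<Sum>e\<in>Basis. LINT x|lebesgue_on \<Omega>. (norm (pd U e x - v e x))\<^sup>2))"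
proof -
  let ?M = "lebesgue_on \<Omega>"
  have \<Omega>l: "\<Omega> \<in> sets lebesgue" using \<Omega> by auto
  have "AE x in lebesgue_on \<Omega>. weak_grad_sq \<Omega> (\<lambda>x. U x - u x) x = (\<Sum>e\<in>Basis. (norm (pd U e x - v e x))\<^sup>2)"
    by (intro weak_grad_sq_AE \<Omega> is_weak_deriv_diff is_weak_deriv_Ck[OF U(1)] u \<Omega>l)
  then have ae: "AE x in lebesgue_on \<Omega>. (norm (U x - u x))\<^sup>2 + weak_grad_sq \<Omega> (\<lambda>x. U x - u x) x
     = (norm (U x - u x))\<^sup>2 + (\<Sum>e\<in>Basis. (norm (pd U e x - v e x))\<^sup>2)" by eventually_elim simp
  have i: "integrable ?M (\<lambda>x. (norm (U x - u x))\<^sup>2)"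
    "\<And>e. e \<in> Basis \<Longrightarrow> integrable ?M (\<lambda>x. (norm (pd U e x - v e x))\<^sup>2)"
    by (intro L2_onD L2_on_diff U u)+
  then have i2: "integrable ?M (\<lambda>x. \<Sum>e\<in>Basis. (norm (pd U e x - v e x))\<^sup>2)" by simp
  then have "integrable ?M (\<lambda>x. (norm (U x - u x))\<^sup>2 + (\<Sum>e\<in>Basis. (norm (pd U e x - v e x))\<^sup>2))"
    using i(1) by simp
  from integral_cong_AE_lebesgue_on[OF \<Omega>l borel_measurable_integrable[OF this] ae]
  show ?thesis unfolding H1_norm_def using i i2 by simp
qed

lemma continuous_L2_on_ball:
  fixes f :: "complex \<Rightarrow> 'b::euclidean_space"
  assumes "continuous_on UNIV f" shows "f \<in> L2_on (ball 0 R)"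
proof -
  have "continuous_on UNIV (\<lambda>z. (norm (f z))\<^sup>2)" by (intro continuous_intros assms)
  from integrable_indicator_continuous_ball[OF this, of UNIV R] show ?thesis
    using continuous_measurable_lebesgue_on[OF assms] by (simp add: L2_on_def)
qed

lemma smooth_approx_ball_iff:
  fixes u :: "complex \<Rightarrow> 'b::euclidean_space"
  assumes U: "\<And>k. smooth (U k)"
    and u: "u \<in> L2_on (ball 0 R)" "\<And>e. e \<in> Basis \<Longrightarrow> v e \<in> L2_on (ball 0 R)"
      "\<And>e. e \<in> Basis \<Longrightarrow> is_weak_deriv (ball 0 R) e u (v e)"
  shows "smooth_approx (ball 0 R) U u v \<longleftrightarrow> (\<lambda>k. H1_norm (ball 0 R) (\<lambda>x. U k x - u x)) \<longlonglongrightarrow> 0"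
proof -
  let ?M = "lebesgue_on (ball 0 R :: complex set)"
  have C: "Ck j (U k)" for j k using U by (simp add: smooth_def)
  have L: "U k \<in> L2_on (ball 0 R)" for k
    by (rule continuous_L2_on_ball[OF Ck_continuous[OF C]])
  have L': "pd (U k) e \<in> L2_on (ball 0 R)" if "e \<in> Basis" for k e
    by (rule continuous_L2_on_ball[OF Ck_pd_continuous[OF C that]])
  define a where "a = (\<lambda>k. LINT x|?M. (norm (U k x - u x))\<^sup>2)"
  define b where "b = (\<lambda>e k. LINT x|?M. (norm (pd (U k) e x - v e x))\<^sup>2)"
  have nonneg: "a k \<ge> 0" "b e k \<ge> 0" for k e by (auto simp: a_def b_def)
  have H: "H1_norm (ball 0 R) (\<lambda>x. U k x - u x) = sqrt (a k + (\<Sum>e\<in>Basis. b e k))" for k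
    unfolding a_def b_def by (rule H1_norm_diff_eq[OF _ C L L' u]) auto
  have iff1: "smooth_approx (ball 0 R) U u v \<longleftrightarrow> a \<longlonglongrightarrow> 0 \<and> (\<forall>e\<in>Basis. b e \<longlonglongrightarrow> 0)"
    using U L L' u by (auto simp: smooth_approx_def L2_lim_def a_def b_def)
  show ?thesis unfolding iff1 H
  proof
    assume "a \<longlonglongrightarrow> 0 \<and> (\<forall>e\<in>Basis. b e \<longlonglongrightarrow> 0)"
    then have "(\<lambda>k. sqrt (a k + (\<Sum>e\<in>Basis. b e k))) \<longlonglongrightarrow> sqrt (0 + (\<Sum>e\<in>(Basis::complex set). 0))"
      by (intro tendsto_real_sqrt tendsto_add tendsto_sum) auto
    then show "(\<lambda>k. sqrt (a k + (\<Sum>e\<in>Basis. b e k))) \<longlonglongrightarrow> 0" by simp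
  next
    assume "(\<lambda>k. sqrt (a k + (\<Sum>e\<in>Basis. b e k))) \<longlonglongrightarrow> 0"
    from tendsto_power[OF this, of 2]
    have t: "(\<lambda>k. a k + (\<Sum>e\<in>Basis. b e k)) \<longlonglongrightarrow> 0"
      using nonneg by (simp add: sum_nonneg add_nonneg_nonneg)
    have "a \<longlonglongrightarrow> 0" by (rule tendsto_0_sandwich[OF t]) (auto simp: nonneg sum_nonneg)
    moreover have "b e \<longlonglongrightarrow> 0" if "e \<in> Basis" for e
    proof (rule tendsto_0_sandwich[OF t])
      show "b e k \<le> a k + (\<Sum>e\<in>Basis. b e k)" for k
        using member_le_sum[OF that, of "\<lambda>e. b e k"] nonneg by (simp add: add_increasing)
    qed (rule nonneg)
    ultimately show "a \<longlonglongrightarrow> 0 \<and> (\<forall>e\<in>Basis. b e \<longlonglongrightarrow> 0)" by blast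
  qed
qed

lemma circle_L2_lim_iff:
  assumes R: "R > 0" and U: "\<And>k. continuous_on UNIV (U k)" and g: "g \<in> circle_L2 R"
  shows "(\<lambda>k. circle_L2_norm R (\<lambda>x. U k x - g x)) \<longlonglongrightarrow> 0
    \<longleftrightarrow> L2_lim {0..2 * pi} (\<lambda>k \<theta>. U k (rcis R \<theta>)) (\<lambda>\<theta>. g (rcis R \<theta>))"
proof -
  define a where "a = (\<lambda>k. LINT \<theta>|lebesgue_on {0..2 * pi}. (norm (U k (rcis R \<theta>) - g (rcis R \<theta>)))\<^sup>2)"
  have "(\<lambda>\<theta>. U k (rcis R \<theta>)) \<in> L2_on {0..2 * pi}" for k
  proof -
    have c: "continuous_on UNIV (\<lambda>\<theta>. U k (rcis R \<theta>))"
      using continuous_on_compose2[OF U continuous_on_rcis(2)] by simp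
    then have "continuous_on {0..2 * pi} (\<lambda>\<theta>. (norm (U k (rcis R \<theta>)))\<^sup>2)"
      by (intro continuous_intros continuous_on_subset[OF c]) simp
    then show ?thesis
      using continuous_imp_integrable_real continuous_measurable_lebesgue_on[OF c] by (simp add: L2_on_def)
  qed
  then have iff: "L2_lim {0..2 * pi} (\<lambda>k \<theta>. U k (rcis R \<theta>)) (\<lambda>\<theta>. g (rcis R \<theta>)) \<longleftrightarrow> a \<longlonglongrightarrow> 0"
    using g by (simp add: L2_lim_def circle_L2_def a_def)
  have n: "circle_L2_norm R (\<lambda>x. U k x - g x) = sqrt (a k * R)" for k
    by (simp add: circle_L2_norm_def a_def)
  show ?thesis unfolding iff n
  proof
    assume "a \<longlonglongrightarrow> 0"
    then have "(\<lambda>k. sqrt (a k * R)) \<longlonglongrightarrow> sqrt (0 * R)" by (intro tendsto_intros)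
    then show "(\<lambda>k. sqrt (a k * R)) \<longlonglongrightarrow> 0" by simp
  next
    assume "(\<lambda>k. sqrt (a k * R)) \<longlonglongrightarrow> 0"
    from tendsto_mult[OF tendsto_power[OF this, of 2] tendsto_const[of "1 / R"]]
    show "a \<longlonglongrightarrow> 0" using R by (simp add: a_def)
  qed
qed

text \<open>The admissible class without the choices hidden in \<^const>\<open>weak_deriv\<close>: both norms in the definition of the trace
  become convergence in the quadratic mean.\<close>

lemma H1_boundary_iff:
  assumes R: "R > 0"
  shows "u \<in> H1_boundary R g \<longleftrightarrow> g \<in> circle_L2 R \<and> (\<exists>U v. smooth_approx (ball 0 R) U u v \<and>
      L2_lim {0..2 * pi} (\<lambda>k \<theta>. U k (rcis R \<theta>)) (\<lambda>\<theta>. g (rcis R \<theta>)))"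
proof
  assume "u \<in> H1_boundary R g"
  then have uH: "u \<in> H1 (ball 0 R)" and g: "g \<in> circle_L2 R" and "has_trace R u g"
    by (auto simp: H1_boundary_def has_trace_def)
  then obtain U where U: "\<And>k. smooth (U k)" "(\<lambda>k. H1_norm (ball 0 R) (\<lambda>x. U k x - u x)) \<longlonglongrightarrow> 0"
    "(\<lambda>k. circle_L2_norm R (\<lambda>x. U k x - g x)) \<longlonglongrightarrow> 0"
    by (auto simp: has_trace_def)
  have "\<forall>e\<in>Basis. \<exists>v. v \<in> L2_on (ball 0 R) \<and> is_weak_deriv (ball 0 R) e u v"
    using uH by (auto simp: H1_def)
  then obtain v where v: "\<And>e. e \<in> Basis \<Longrightarrow> v e \<in> L2_on (ball 0 R)"
    "\<And>e. e \<in> Basis \<Longrightarrow> is_weak_deriv (ball 0 R) e u (v e)" by metis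
  have "smooth_approx (ball 0 R) U u v"
  proof -
    have "u \<in> L2_on (ball 0 R)" using uH by (simp add: H1_def)
    then show ?thesis using U(2) by (subst smooth_approx_ball_iff[OF U(1)]) (auto intro: v)
  qed
  moreover have "L2_lim {0..2 * pi} (\<lambda>k \<theta>. U k (rcis R \<theta>)) (\<lambda>\<theta>. g (rcis R \<theta>))"
    using circle_L2_lim_iff[OF R _ g, of U] U(1,3) Ck_continuous by (auto simp: smooth_def)
  ultimately show "g \<in> circle_L2 R \<and> (\<exists>U v. smooth_approx (ball 0 R) U u v \<and>
      L2_lim {0..2 * pi} (\<lambda>k \<theta>. U k (rcis R \<theta>)) (\<lambda>\<theta>. g (rcis R \<theta>)))"
    using g by blast
next
  assume "g \<in> circle_L2 R \<and> (\<exists>U v. smooth_approx (ball 0 R) U u v \<and>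
      L2_lim {0..2 * pi} (\<lambda>k \<theta>. U k (rcis R \<theta>)) (\<lambda>\<theta>. g (rcis R \<theta>)))"
  then obtain U v where g: "g \<in> circle_L2 R" and U: "smooth_approx (ball 0 R) U u v"
    and tr: "L2_lim {0..2 * pi} (\<lambda>k \<theta>. U k (rcis R \<theta>)) (\<lambda>\<theta>. g (rcis R \<theta>))" by blast
  have s: "smooth (U k)" for k using U by (simp add: smooth_approx_def)
  have u: "u \<in> L2_on (ball 0 R)" and v: "\<And>e. e \<in> Basis \<Longrightarrow> v e \<in> L2_on (ball 0 R)"
    using U by (auto simp: smooth_approx_def L2_lim_def)
  have w: "is_weak_deriv (ball 0 R) e u (v e)" if "e \<in> Basis" for e
    by (rule smooth_approx_weak_deriv[OF U _ that]) simp
  have "u \<in> H1 (ball 0 R)" using u v w by (auto simp: H1_def)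
  moreover have "has_trace R u g"
    unfolding has_trace_def
  proof (intro conjI g exI[of _ U] allI s)
    show "(\<lambda>k. H1_norm (ball 0 R) (\<lambda>x. U k x - u x)) \<longlonglongrightarrow> 0"
      using smooth_approx_ball_iff[OF s u v w] U by simp
    show "(\<lambda>k. circle_L2_norm R (\<lambda>x. U k x - g x)) \<longlonglongrightarrow> 0"
      using circle_L2_lim_iff[OF R _ g, of U] tr s Ck_continuous by (auto simp: smooth_def)
  qed
  ultimately show "u \<in> H1_boundary R g" by (simp add: H1_boundary_def)
qed

lemma integrable_wedge_smooth_approx:
  assumes "smooth_approx \<Omega> U u u'"
  shows "integrable (lebesgue_on \<Omega>) (\<lambda>z. wedge (u' 1 z) (u' \<i> z))"
proof (rule integrable_bilinear_L2[OF bounded_bilinear_wedge])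
  have "(1::complex) \<in> Basis" "\<i> \<in> Basis" by (auto simp: Basis_complex_def)
  then show "u' 1 \<in> L2_on \<Omega>" "u' \<i> \<in> L2_on \<Omega>" using assms by (auto simp: smooth_approx_def L2_lim_def)
qed

text \<open>The Jacobian is a quadratic form, so twice the difference of its values at \<open>u\<close> and \<open>v\<close> is the bilinear expression
  of \<open>jacobian_null_Lagrangian\<close> at \<open>u - v\<close>, which has zero trace, and \<open>u + v\<close>.\<close>

lemma integral_wedge_boundary_values:
  assumes R: "R > 0" and u: "smooth_approx (ball 0 R) U u u'" and v: "smooth_approx (ball 0 R) V v v'"
    and trU: "L2_lim {0..2 * pi} (\<lambda>k \<theta>. U k (rcis R \<theta>)) (\<lambda>\<theta>. g (rcis R \<theta>))"
    and trV: "L2_lim {0..2 * pi} (\<lambda>k \<theta>. V k (rcis R \<theta>)) (\<lambda>\<theta>. g (rcis R \<theta>))"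
  shows "(LINT z|lebesgue_on (ball 0 R). wedge (u' 1 z) (u' \<i> z)) = (LINT z|lebesgue_on (ball 0 R). wedge (v' 1 z) (v' \<i> z))"
proof -
  have tr: "(\<lambda>k. LINT \<theta>|lebesgue_on {0..2 * pi}. (norm (U k (rcis R \<theta>) - V k (rcis R \<theta>)))\<^sup>2) \<longlonglongrightarrow> 0"
    using L2_lim_diff[OF trU trV] by (simp add: L2_lim_def)
  have "wedge (u' 1 z - v' 1 z) (u' \<i> z + v' \<i> z) - wedge (u' \<i> z - v' \<i> z) (u' 1 z + v' 1 z)
      = 2 * wedge (u' 1 z) (u' \<i> z) - 2 * wedge (v' 1 z) (v' \<i> z)" for z
    by (simp add: wedge_def algebra_simps)
  then have "(LINT z|lebesgue_on (ball 0 R). 2 * wedge (u' 1 z) (u' \<i> z) - 2 * wedge (v' 1 z) (v' \<i> z)) = 0"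
    using jacobian_null_Lagrangian[OF R smooth_approx_diff[OF u v] smooth_approx_add[OF u v] tr] by simp
  then show ?thesis
    using integrable_wedge_smooth_approx[OF u] integrable_wedge_smooth_approx[OF v] by simp
qed

section \<open>The energy density\<close>

text \<open>Here \<open>p\<close> and \<open>q\<close> stand for the partial derivatives of \<open>v\<close>; the quotients are then the partial derivatives of its norm,
  by \<open>weak_deriv_norm\<close>.\<close>

definition energy_density :: "real \<Rightarrow> complex \<Rightarrow> complex \<Rightarrow> complex \<Rightarrow> real" where
  "energy_density \<epsilon> v p q = (norm p)\<^sup>2 + (norm q)\<^sup>2 + (1 / \<epsilon>\<^sup>2 - 1) * ((v \<bullet> p / norm v)\<^sup>2 + (v \<bullet> q / norm v)\<^sup>2)"

text \<open>In the orthonormal frame given by \<open>v / norm v\<close> and its rotation by a right angle, this is the completion of two squares.\<close>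

lemma energy_density_eq:
  assumes v: "v \<noteq> 0" and \<epsilon>: "\<epsilon> > 0"
  shows "energy_density \<epsilon> v p q = 2 / \<epsilon> * wedge p q
    + (v \<bullet> p / (\<epsilon> * norm v) - wedge v q / norm v)\<^sup>2 + (v \<bullet> q / (\<epsilon> * norm v) + wedge v p / norm v)\<^sup>2"
proof -
  define a b where "a = Re v / norm v" and "b = Im v / norm v"
  have ab: "a\<^sup>2 + b\<^sup>2 = 1"
    using v by (simp add: a_def b_def power_divide add_divide_distrib[symmetric] cmod_power2[symmetric])
  define pn pt qn qt where "pn = a * Re p + b * Im p" and "pt = a * Im p - b * Re p"
    and "qn = a * Re q + b * Im q" and "qt = a * Im q - b * Re q"
  have n: "v \<bullet> p / norm v = pn" "v \<bullet> q / norm v = qn" "wedge v p / norm v = pt" "wedge v q / norm v = qt"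
    by (auto simp: pn_def pt_def qn_def qt_def a_def b_def inner_complex_def wedge_def add_divide_distrib diff_divide_distrib)
  have "(norm p)\<^sup>2 = (a\<^sup>2 + b\<^sup>2) * (norm p)\<^sup>2" "(norm q)\<^sup>2 = (a\<^sup>2 + b\<^sup>2) * (norm q)\<^sup>2"
    "wedge p q = (a\<^sup>2 + b\<^sup>2) * wedge p q" by (simp_all add: ab)
  then have s: "(norm p)\<^sup>2 = pn\<^sup>2 + pt\<^sup>2" "(norm q)\<^sup>2 = qn\<^sup>2 + qt\<^sup>2" "wedge p q = pn * qt - pt * qn"
    unfolding cmod_power2 wedge_def pn_def pt_def qn_def qt_def by (simp_all add: power2_eq_square algebra_simps)
  have e: "v \<bullet> p / (\<epsilon> * norm v) = pn / \<epsilon>" "v \<bullet> q / (\<epsilon> * norm v) = qn / \<epsilon>"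
    unfolding n(1,2)[symmetric] by simp_all
  show ?thesis
    unfolding energy_density_def e n s using \<epsilon> by (simp add: power2_eq_square field_simps)
qed

lemma energy_density_ge_wedge:
  assumes "\<epsilon> > 0" "v = 0 \<longrightarrow> p = 0 \<and> q = 0"
  shows "2 / \<epsilon> * wedge p q \<le> energy_density \<epsilon> v p q"
proof (cases "v = 0")
  case True
  then show ?thesis using assms by (simp add: energy_density_def wedge_def)
next
  case False
  then show ?thesis by (simp add: energy_density_eq[OF False assms(1)])
qed

lemma energy_density_eq_wedge:
  assumes "v \<noteq> 0" "\<epsilon> > 0" "v \<bullet> p = \<epsilon> * wedge v q" "v \<bullet> q = - \<epsilon> * wedge v p"
  shows "energy_density \<epsilon> v p q = 2 / \<epsilon> * wedge p q"
  using assms by (simp add: energy_density_eq)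

lemma energy_smooth_approx:
  fixes u :: "complex \<Rightarrow> complex"
  assumes \<Omega>: "open \<Omega>" "\<Omega> \<in> lmeasurable" and u: "smooth_approx \<Omega> U u u'"
  shows "integrable (lebesgue_on \<Omega>) (\<lambda>z. energy_density \<epsilon> (u z) (u' 1 z) (u' \<i> z))"
    and "energy \<epsilon> \<Omega> u = (LINT z|lebesgue_on \<Omega>. energy_density \<epsilon> (u z) (u' 1 z) (u' \<i> z))"
proof -
  let ?M = "lebesgue_on \<Omega>"
  have L: "u \<in> L2_on \<Omega>" "u' e \<in> L2_on \<Omega>" if "e \<in> Basis" for e
    using u that by (auto simp: smooth_approx_def L2_lim_def)
  have B: "(1::complex) \<in> Basis" "\<i> \<in> Basis" by (auto simp: Basis_complex_def)
  have [measurable]: "u \<in> borel_measurable ?M" "u' 1 \<in> borel_measurable ?M"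
    "u' \<i> \<in> borel_measurable ?M" using L B by (auto dest: L2_onD)
  have N: "(\<lambda>z. u z \<bullet> u' e z / norm (u z)) \<in> L2_on \<Omega>" if e: "e \<in> Basis" for e
  proof (rule L2_on_dominated)
    have [measurable]: "u' e \<in> borel_measurable ?M" using L e by (auto dest: L2_onD)
    show "(\<lambda>z. u z \<bullet> u' e z / norm (u z)) \<in> borel_measurable ?M" by measurable
    show "integrable ?M (\<lambda>z. (norm (u' e z))\<^sup>2)" using L(2)[OF e] by (rule L2_onD)
    show "(norm (u z \<bullet> u' e z / norm (u z)))\<^sup>2 \<le> (norm (u' e z))\<^sup>2" for z
    proof (rule power_mono)
      show "norm (u z \<bullet> u' e z / norm (u z)) \<le> norm (u' e z)"
        using Cauchy_Schwarz_ineq2[of "u z" "u' e z"] by (cases "u z = 0") (auto simp: divide_le_eq mult.commute)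
    qed simp
  qed
  show i: "integrable ?M (\<lambda>z. energy_density \<epsilon> (u z) (u' 1 z) (u' \<i> z))"
    unfolding energy_density_def using L(2)[THEN L2_onD(2)] N[THEN L2_onD(2)] B
    by (intro Bochner_Integration.integrable_add integrable_mult_right) (auto simp: power_divide)
  have "AE z in lebesgue_on \<Omega>. weak_grad_sq \<Omega> u z = (\<Sum>e\<in>Basis. (norm (u' e z))\<^sup>2)"
    by (rule weak_grad_sq_AE[OF \<Omega>(1) smooth_approx_weak_deriv[OF u \<Omega>(2)]])
  moreover have "AE z in lebesgue_on \<Omega>. weak_grad_sq \<Omega> (\<lambda>z. norm (u z)) z = (\<Sum>e\<in>Basis. (norm (u z \<bullet> u' e z / norm (u z)))\<^sup>2)"
    by (rule weak_grad_sq_AE[OF \<Omega>(1) weak_deriv_norm[OF \<Omega>(2) _ u]])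
  ultimately have ae: "AE z in lebesgue_on \<Omega>. weak_grad_sq \<Omega> u z + (1 / \<epsilon>\<^sup>2 - 1) * weak_grad_sq \<Omega> (\<lambda>z. norm (u z)) z
      = energy_density \<epsilon> (u z) (u' 1 z) (u' \<i> z)"
    by eventually_elim (simp add: energy_density_def Basis_complex_def power_divide)
  show "energy \<epsilon> \<Omega> u = (LINT z|?M. energy_density \<epsilon> (u z) (u' 1 z) (u' \<i> z))"
    unfolding energy_def using \<Omega>(1) by (intro integral_cong_AE_lebesgue_on[OF _ borel_measurable_integrable[OF i] ae]) auto
qed

text \<open>On the zero set of \<open>u\<close> the pointwise inequality holds because the derivatives vanish there, by \<open>weak_deriv_zero_set\<close>.\<close>

lemma energy_ge_wedge:
  fixes u :: "complex \<Rightarrow> complex"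
  assumes \<Omega>: "open \<Omega>" "\<Omega> \<in> lmeasurable" and u: "smooth_approx \<Omega> U u u'" and \<epsilon>: "\<epsilon> > 0"
  shows "2 / \<epsilon> * (LINT z|lebesgue_on \<Omega>. wedge (u' 1 z) (u' \<i> z)) \<le> energy \<epsilon> \<Omega> u"
proof -
  let ?M = "lebesgue_on \<Omega>"
  have B: "(1::complex) \<in> Basis" "\<i> \<in> Basis" by (auto simp: Basis_complex_def)
  have "AE z in lebesgue_on \<Omega>. u z = 0 \<longrightarrow> u' 1 z = 0" "AE z in lebesgue_on \<Omega>. u z = 0 \<longrightarrow> u' \<i> z = 0"
    using weak_deriv_zero_set[OF \<Omega> B(1) u] weak_deriv_zero_set[OF \<Omega> B(2) u] .
  then have "AE z in lebesgue_on \<Omega>. 2 / \<epsilon> * wedge (u' 1 z) (u' \<i> z) \<le> energy_density \<epsilon> (u z) (u' 1 z) (u' \<i> z)"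
    by eventually_elim (rule energy_density_ge_wedge[OF \<epsilon>], blast)
  then have "(LINT z|?M. 2 / \<epsilon> * wedge (u' 1 z) (u' \<i> z)) \<le> (LINT z|?M. energy_density \<epsilon> (u z) (u' 1 z) (u' \<i> z))"
    using integrable_wedge_smooth_approx[OF u] energy_smooth_approx(1)[OF \<Omega> u]
    by (intro integral_mono_AE integrable_mult_right)
  then show ?thesis by (simp add: energy_smooth_approx(2)[OF \<Omega> u])
qed

lemma energy_eq_wedge:
  fixes u :: "complex \<Rightarrow> complex"
  assumes \<Omega>: "open \<Omega>" "\<Omega> \<in> lmeasurable" and u: "smooth_approx \<Omega> U u u'" and \<epsilon>: "\<epsilon> > 0"
    and eq: "AE z in lebesgue_on \<Omega>. u z \<noteq> 0 \<and> u z \<bullet> u' 1 z = \<epsilon> * wedge (u z) (u' \<i> z) \<and>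
      u z \<bullet> u' \<i> z = - \<epsilon> * wedge (u z) (u' 1 z)"
  shows "energy \<epsilon> \<Omega> u = 2 / \<epsilon> * (LINT z|lebesgue_on \<Omega>. wedge (u' 1 z) (u' \<i> z))"
proof -
  let ?M = "lebesgue_on \<Omega>"
  have "AE z in lebesgue_on \<Omega>. energy_density \<epsilon> (u z) (u' 1 z) (u' \<i> z) = 2 / \<epsilon> * wedge (u' 1 z) (u' \<i> z)"
    using eq
  proof eventually_elim
    case (elim z)
    show ?case by (rule energy_density_eq_wedge) (use elim \<epsilon> in auto)
  qed
  then have "(LINT z|?M. energy_density \<epsilon> (u z) (u' 1 z) (u' \<i> z)) = (LINT z|?M. 2 / \<epsilon> * wedge (u' 1 z) (u' \<i> z))"
    using integrable_wedge_smooth_approx[OF u] energy_smooth_approx(1)[OF \<Omega> u]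
    by (intro integral_cong_AE) auto
  then show ?thesis by (simp add: energy_smooth_approx(2)[OF \<Omega> u])
qed

section \<open>The radial map\<close>

lemma L2_lim_dominated:
  fixes a :: "'a::euclidean_space \<Rightarrow> 'b::euclidean_space"
  assumes A: "\<And>k. A k \<in> L2_on \<Omega>" and a: "a \<in> borel_measurable (lebesgue_on \<Omega>)"
    and w: "integrable (lebesgue_on \<Omega>) w"
    and bd: "\<And>k. AE x in lebesgue_on \<Omega>. (norm (A k x))\<^sup>2 \<le> w x"
    and lim: "AE x in lebesgue_on \<Omega>. (\<lambda>k. A k x) \<longlonglongrightarrow> a x"
  shows "L2_lim \<Omega> A a"
proof -
  let ?M = "lebesgue_on \<Omega>"
  have Am: "A k \<in> borel_measurable ?M" for k using A by (rule L2_onD)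
  have "AE x in lebesgue_on \<Omega>. \<forall>k. (norm (A k x))\<^sup>2 \<le> w x" using bd by (simp add: AE_all_countable)
  with lim have bda: "AE x in lebesgue_on \<Omega>. (norm (a x))\<^sup>2 \<le> w x"
  proof eventually_elim
    case (elim x)
    show ?case
      by (rule LIMSEQ_le_const2[OF tendsto_power[OF tendsto_norm[OF elim(1)]]]) (use elim(2) in auto)
  qed
  have "integrable ?M (\<lambda>x. (norm (a x))\<^sup>2)"
  proof (rule Bochner_Integration.integrable_bound[OF w])
    show "AE x in lebesgue_on \<Omega>. norm ((norm (a x))\<^sup>2) \<le> norm (w x)"
      using bda by eventually_elim auto
  qed (use a in measurable)
  then have La: "a \<in> L2_on \<Omega>" using a by (simp add: L2_on_def)
  have "(\<lambda>k. LINT x|?M. (norm (A k x - a x))\<^sup>2) \<longlonglongrightarrow> (LINT x|?M. 0::real)"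
  proof (rule integral_dominated_convergence[where w = "\<lambda>x. 4 * w x"])
    show "(\<lambda>x. (norm (A k x - a x))\<^sup>2) \<in> borel_measurable ?M" for k
      using Am[of k] a by measurable
    show "AE x in lebesgue_on \<Omega>. (\<lambda>k. (norm (A k x - a x))\<^sup>2) \<longlonglongrightarrow> 0"
      using lim
    proof eventually_elim
      case (elim x)
      from tendsto_power[OF tendsto_norm[OF tendsto_diff[OF elim tendsto_const[of "a x"]]], of 2]
      show ?case by simp
    qed
    show "AE x in lebesgue_on \<Omega>. norm ((norm (A k x - a x))\<^sup>2) \<le> 4 * w x" for k
      using bd[of k] bda
    proof eventually_elim
      case (elim x)
      then show ?case using norm_sum_sq_le[of "A k x" "- a x"] by simp
    qed
  qed (use w in auto)
  then show ?thesis using A La by (simp add: L2_lim_def)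
qed

lemma Ck_powr_shift:
  fixes d :: real
  assumes d: "d > 0"
  shows "Ck k (\<lambda>z::complex. (z \<bullet> z + d) powr b)"
proof (induction k arbitrary: b)
  case 0
  have "z \<bullet> z + d \<noteq> 0" for z :: complex using d inner_ge_zero[of z] by linarith
  then show ?case by (auto intro!: continuous_intros)
next
  case (Suc k)
  have "((\<lambda>z::complex. (z \<bullet> z + d) powr b) has_derivative (\<lambda>h. (2 * b) * (z \<bullet> h) * (z \<bullet> z + d) powr (b - 1))) (at z)" for z
  proof -
    have pos: "z \<bullet> z + d > 0" using d inner_ge_zero[of z] by linarith
    have 1: "((\<lambda>z::complex. z \<bullet> z + d) has_derivative (\<lambda>h. 2 * (z \<bullet> h))) (at z)"
      by (auto intro!: derivative_eq_intros simp: inner_commute)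
    have 2: "((\<lambda>t. t powr b) has_derivative (\<lambda>h. b * (z \<bullet> z + d) powr (b - 1) * h)) (at (z \<bullet> z + d))"
      using has_real_derivative_powr[OF pos, of b] by (simp add: has_field_derivative_def)
    from has_derivative_compose[OF 1 2] show ?thesis by (simp add: algebra_simps)
  qed
  then show ?case
    by (rule CkI) (intro Ck_mult Ck_const Ck_bounded_linear bounded_linear_inner_left Suc)
qed

lemma Ck_power: "Ck k (\<lambda>z::complex. z ^ n)"
  by (induction n) (auto intro: Ck_const Ck_mult Ck_bounded_linear[OF bounded_linear_ident])

text \<open>For \<open>d = 0\<close>, \<open>2 * b + D = D * \<epsilon>\<close> and \<open>c = R powr - (D * \<epsilon>)\<close> this is the map of the theorem on the disc; for \<open>d > 0\<close> it is smooth on the whole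
  plane. The exponent \<open>b\<close> is negative if \<open>\<epsilon> < 1\<close>.\<close>

definition radial :: "real \<Rightarrow> real \<Rightarrow> nat \<Rightarrow> real \<Rightarrow> complex \<Rightarrow> complex" where
  "radial c b D d z = (c * (z \<bullet> z + d) powr b) *\<^sub>R z ^ D"

definition radial' :: "real \<Rightarrow> real \<Rightarrow> nat \<Rightarrow> real \<Rightarrow> complex \<Rightarrow> complex \<Rightarrow> complex" where
  "radial' c b D d e z = (c * (z \<bullet> z + d) powr b) *\<^sub>R (of_nat D * z ^ (D - 1) * e)
     + (c * (2 * b * (z \<bullet> e) * (z \<bullet> z + d) powr (b - 1))) *\<^sub>R z ^ D"

lemma smooth_radial: "d > 0 \<Longrightarrow> smooth (radial c b D d)"
  unfolding smooth_def radial_def[abs_def]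
  by (intro allI Ck_scaleR Ck_mult Ck_const Ck_powr_shift Ck_power)

lemma pd_radial:
  assumes d: "d > 0"
  shows "pd (radial c b D d) e = radial' c b D d e"
proof (rule ext, rule pd_eq)
  fix z :: complex
  have pos: "z \<bullet> z + d > 0" using d inner_ge_zero[of z] by linarith
  have 1: "((\<lambda>z::complex. z \<bullet> z + d) has_derivative (\<lambda>h. 2 * (z \<bullet> h))) (at z)"
    by (auto intro!: derivative_eq_intros simp: inner_commute)
  have 2: "((\<lambda>t. t powr b) has_derivative (\<lambda>h. b * (z \<bullet> z + d) powr (b - 1) * h)) (at (z \<bullet> z + d))"
    using has_real_derivative_powr[OF pos, of b] by (simp add: has_field_derivative_def)
  have 3: "((\<lambda>z. c * (z \<bullet> z + d) powr b) has_derivative (\<lambda>h. c * (2 * b * (z \<bullet> h) * (z \<bullet> z + d) powr (b - 1)))) (at z)"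
    using has_derivative_mult_right[OF has_derivative_compose[OF 1 2], of c] by (simp add: algebra_simps)
  have 4: "((\<lambda>z. z ^ D) has_derivative (\<lambda>h. of_nat D * z ^ (D - 1) * h)) (at z)"
  proof -
    have "((\<lambda>z. z ^ D) has_field_derivative (of_nat D * z ^ (D - 1))) (at z)"
      by (auto intro!: derivative_eq_intros)
    then show ?thesis by (simp add: has_field_derivative_def)
  qed
  have "(radial c b D d has_derivative (\<lambda>e. radial' c b D d e z)) (at z)"
    unfolding radial_def[abs_def] radial'_def by (rule has_derivative_scaleR[OF 3 4])
  then show "(radial c b D d has_derivative (\<lambda>e. radial' c b D d e z)) (at z)" .
qed

lemma radial_measurable:
  "radial c b D d \<in> borel_measurable borel" "radial' c b D d e \<in> borel_measurable borel"
  unfolding radial_def[abs_def] radial'_def[abs_def] by measurable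

lemma measurable_lebesgue_on_borel:
  "f \<in> borel_measurable borel \<Longrightarrow> f \<in> borel_measurable (lebesgue_on \<Omega>)"
  by (intro measurable_restrict_space1 measurable_completion) simp

lemma powr_inner_self: "(z \<bullet> z) powr b = norm z powr (2 * b)"
  for z :: complex
  by (cases "z = 0") (simp_all add: dot_square_norm powr_powr[symmetric])

text \<open>The first term on the right bounds the left-hand side for \<open>b \<le> 0\<close>, the second one for \<open>b \<ge> 0\<close>.\<close>

lemma powr_shift_le:
  assumes z: "z \<noteq> (0::complex)" "norm z \<le> R" and d: "0 \<le> d" "d \<le> 1"
  shows "(z \<bullet> z + d) powr b \<le> norm z powr (2 * b) + (R\<^sup>2 + 1) powr \<bar>b\<bar>"
proof (cases "b \<le> 0")
  case True
  have "z \<bullet> z > 0" using z by simp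
  then have "(z \<bullet> z + d) powr b \<le> (z \<bullet> z) powr b"
    using d True by (intro powr_mono2') auto
  then show ?thesis by (simp add: powr_inner_self add_increasing2)
next
  case False
  have "(norm z)\<^sup>2 \<le> R\<^sup>2" using z by (intro power_mono) auto
  then have "(z \<bullet> z + d) powr b \<le> (R\<^sup>2 + 1) powr b"
    using d False by (intro powr_mono2) (auto simp: dot_square_norm)
  then show ?thesis using False by (simp add: add_increasing)
qed

lemma norm_powr_times_power:
  assumes "z \<noteq> (0::complex)"
  shows "norm z powr a * norm z ^ n = norm z powr (a + real n)"
  using assms by (simp add: powr_add powr_realpow)

lemma radial_bound:
  assumes c: "c > 0" and z: "z \<noteq> 0" "norm z \<le> R" and d: "0 \<le> d" "d \<le> 1" and a: "2 * b + real D > 0"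
  shows "norm (radial c b D d z) \<le> c * (R powr (2 * b + real D) + (R\<^sup>2 + 1) powr \<bar>b\<bar> * R ^ D)"
proof -
  have "norm (radial c b D d z) = c * ((z \<bullet> z + d) powr b * norm z ^ D)"
    using c by (simp add: radial_def norm_power abs_mult)
  also have "\<dots> \<le> c * ((norm z powr (2 * b) + (R\<^sup>2 + 1) powr \<bar>b\<bar>) * norm z ^ D)"
    using c by (intro mult_left_mono mult_right_mono powr_shift_le z d) auto
  also have "\<dots> = c * (norm z powr (2 * b + real D) + (R\<^sup>2 + 1) powr \<bar>b\<bar> * norm z ^ D)"
    using z(1) by (simp add: distrib_right norm_powr_times_power)
  also have "\<dots> \<le> c * (R powr (2 * b + real D) + (R\<^sup>2 + 1) powr \<bar>b\<bar> * R ^ D)"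
    using c z a by (intro mult_left_mono add_mono powr_mono2 power_mono) auto
  finally show ?thesis .
qed

text \<open>Uniformly in \<open>d\<close>, both terms of the derivative are at most a constant times \<open>(z \<bullet> z + d) powr b * norm z ^ (D - 1)\<close>, because
  \<open>norm z\<^sup>2 \<le> z \<bullet> z + d\<close>. The resulting bound is square integrable as soon as \<open>2 * b + D > 0\<close>.\<close>

lemma radial'_bound:
  fixes b :: real
  assumes c: "c > 0" and z: "z \<noteq> 0" "norm z \<le> R" and d: "0 \<le> d" "d \<le> 1" and D: "D \<ge> 1" and e: "norm e = 1"
  defines "K \<equiv> c * (real D + 2 * \<bar>b\<bar>)"
  shows "norm (radial' c b D d e z) \<le> K * norm z powr (2 * b + real D - 1) + K * ((R\<^sup>2 + 1) powr \<bar>b\<bar> * R ^ (D - 1))"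
proof -
  define s where "s = z \<bullet> z + d"
  have zz: "z \<bullet> z > 0" using z by simp
  then have s: "s > 0" "z \<bullet> z \<le> s" using d unfolding s_def by linarith+
  have K: "K \<ge> 0" using c by (simp add: K_def)
  have zD: "norm z ^ D = norm z * norm z ^ (D - 1)" using D by (cases D) auto
  have "\<bar>z \<bullet> e\<bar> * norm z \<le> norm z * norm z"
    using Cauchy_Schwarz_ineq2[of z e] e by (intro mult_right_mono) auto
  also have "\<dots> = z \<bullet> z" by (simp add: dot_square_norm power2_eq_square)
  finally have ze: "\<bar>z \<bullet> e\<bar> * norm z \<le> s" using s by linarith
  have sb: "s * s powr (b - 1) = s powr b" using s powr_mult_base[of s "b - 1"] by simp
  have n1: "norm ((c * s powr b) *\<^sub>R (of_nat D * z ^ (D - 1) * e)) = c * real D * (s powr b * norm z ^ (D - 1))"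
    using c e by (simp add: norm_mult norm_power abs_mult)
  have "norm ((c * (2 * b * (z \<bullet> e) * s powr (b - 1))) *\<^sub>R z ^ D)
      = c * (2 * \<bar>b\<bar>) * ((\<bar>z \<bullet> e\<bar> * norm z) * s powr (b - 1) * norm z ^ (D - 1))"
    using c by (simp add: norm_power abs_mult zD)
  also have "\<dots> \<le> c * (2 * \<bar>b\<bar>) * (s * s powr (b - 1) * norm z ^ (D - 1))"
    using c by (intro mult_left_mono mult_right_mono ze) auto
  finally have n2: "norm ((c * (2 * b * (z \<bullet> e) * s powr (b - 1))) *\<^sub>R z ^ D)
      \<le> c * (2 * \<bar>b\<bar>) * (s powr b * norm z ^ (D - 1))" by (simp only: sb)
  have "norm (radial' c b D d e z) \<le> c * real D * (s powr b * norm z ^ (D - 1)) + c * (2 * \<bar>b\<bar>) * (s powr b * norm z ^ (D - 1))"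
    unfolding radial'_def s_def[symmetric] using n1 n2 by (intro norm_triangle_le) simp
  also have "\<dots> = K * (s powr b * norm z ^ (D - 1))" by (simp add: K_def algebra_simps)
  also have "\<dots> \<le> K * ((norm z powr (2 * b) + (R\<^sup>2 + 1) powr \<bar>b\<bar>) * norm z ^ (D - 1))"
    unfolding s_def using K by (intro mult_left_mono mult_right_mono powr_shift_le z d) auto
  also have "\<dots> = K * norm z powr (2 * b + real D - 1) + K * ((R\<^sup>2 + 1) powr \<bar>b\<bar> * norm z ^ (D - 1))"
  proof -
    have "norm z powr (2 * b) * norm z ^ (D - 1) = norm z powr (2 * b + real D - 1)"
      using norm_powr_times_power[OF z(1), of "2 * b" "D - 1"] D by (simp add: of_nat_diff add_diff_eq)
    then show ?thesis by (simp only: distrib_right distrib_left)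
  qed
  also have "\<dots> \<le> K * norm z powr (2 * b + real D - 1) + K * ((R\<^sup>2 + 1) powr \<bar>b\<bar> * R ^ (D - 1))"
    using K z by (intro add_left_mono mult_left_mono power_mono) auto
  finally show ?thesis .
qed

lemma AE_nonzero_ball: "AE z in lebesgue_on (ball 0 R). z \<noteq> (0::complex)"
proof -
  have "AE z in lborel. z \<noteq> (0::complex)" by (rule AE_lborel_singleton)
  then have "AE z in lebesgue. z \<noteq> (0::complex)" by (rule AE_completion)
  then show ?thesis by (subst AE_restrict_space_iff) (auto elim!: eventually_mono)
qed

lemma radial_tendsto:
  assumes z: "z \<noteq> 0"
  shows "(\<lambda>k. radial c b D (delta_seq k) z) \<longlonglongrightarrow> radial c b D 0 z"
    and "(\<lambda>k. radial' c b D (delta_seq k) e z) \<longlonglongrightarrow> radial' c b D 0 e z"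
proof -
  have "(\<lambda>k. (z \<bullet> z + delta_seq k) powr p) \<longlonglongrightarrow> (z \<bullet> z + 0) powr p" for p
    by (intro tendsto_powr tendsto_add tendsto_const delta_seq) (use z in simp)
  note t = this
  show "(\<lambda>k. radial c b D (delta_seq k) z) \<longlonglongrightarrow> radial c b D 0 z"
    unfolding radial_def by (intro tendsto_intros t)
  show "(\<lambda>k. radial' c b D (delta_seq k) e z) \<longlonglongrightarrow> radial' c b D 0 e z"
    unfolding radial'_def by (intro tendsto_intros t)
qed

text \<open>Dominated convergence with the bounds above, which are uniform in \<open>d\<close>.\<close>

lemma smooth_approx_radial:
  assumes c: "c > 0" and R: "R > 0" and D: "D \<ge> 1" and a: "2 * b + real D > 0"
    and u: "\<And>z. norm z < R \<Longrightarrow> u z = radial c b D 0 z"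
  shows "smooth_approx (ball 0 R) (\<lambda>k. radial c b D (delta_seq k)) u (radial' c b D 0)"
  unfolding smooth_approx_def
proof (intro conjI allI ballI)
  let ?M = "lebesgue_on (ball 0 R :: complex set)"
  interpret finite_measure ?M by (rule finite_measure_lebesgue_on) simp
  show sm: "smooth (radial c b D (delta_seq k))" for k by (rule smooth_radial[OF delta_seq(1)])
  then have C: "Ck j (radial c b D (delta_seq k))" for j k by (simp add: smooth_def)
  have L: "AE z in ?M. (\<lambda>k. radial c b D (delta_seq k) z) \<longlonglongrightarrow> u z"
    using AE_nonzero_ball[of R] AE_space[of ?M]
    by eventually_elim (use radial_tendsto(1) u in auto)
  have L': "AE z in ?M. (\<lambda>k. radial' c b D (delta_seq k) e z) \<longlonglongrightarrow> radial' c b D 0 e z" for e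
    using AE_nonzero_ball[of R] by eventually_elim (rule radial_tendsto(2))
  have LU: "radial c b D (delta_seq k) \<in> L2_on (ball 0 R)" for k
    by (rule continuous_L2_on_ball[OF Ck_continuous[OF C]])
  show "L2_lim (ball 0 R) (\<lambda>k. radial c b D (delta_seq k)) u"
  proof (rule L2_lim_dominated[OF LU _ _ _ L])
    have "AE z in ?M. u z = radial c b D 0 z"
      using AE_space[of ?M] by eventually_elim (simp add: u)
    then show "u \<in> borel_measurable ?M"
      by (intro borel_measurable_lebesgue_on_AE[OF _ measurable_lebesgue_on_borel[OF radial_measurable(1)]]) auto
    show "AE z in ?M. (norm (radial c b D (delta_seq k) z))\<^sup>2
        \<le> (c * (R powr (2 * b + real D) + (R\<^sup>2 + 1) powr \<bar>b\<bar> * R ^ D))\<^sup>2" for k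
      using AE_nonzero_ball[of R] AE_space[of ?M]
    proof eventually_elim
      case (elim z)
      show ?case
        by (rule power_mono[OF radial_bound[OF c elim(1) _ _ _ a]])
          (use elim delta_seq(1,2)[of k] in auto)
    qed
  qed simp
  fix e :: complex assume e: "e \<in> Basis"
  have LU': "radial' c b D (delta_seq k) e \<in> L2_on (ball 0 R)" for k
    using continuous_L2_on_ball[OF Ck_pd_continuous[OF C e]] by (simp add: pd_radial[OF delta_seq(1)])
  define K where "K = c * (real D + 2 * \<bar>b\<bar>)"
  define K' where "K' = K * ((R\<^sup>2 + 1) powr \<bar>b\<bar> * R ^ (D - 1))"
  show "L2_lim (ball 0 R) (\<lambda>k. pd (radial c b D (delta_seq k)) e) (radial' c b D 0 e)"
    unfolding pd_radial[OF delta_seq(1)]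
  proof (rule L2_lim_dominated[OF LU' _ _ _ L'])
    show "radial' c b D 0 e \<in> borel_measurable ?M" by (rule measurable_lebesgue_on_borel[OF radial_measurable(2)])
    show "integrable ?M (\<lambda>z. 2 * (K\<^sup>2 * norm z powr (2 * (2 * b + real D) - 2)) + 2 * K'\<^sup>2)"
      using integrable_norm_powr[OF a, of R]
      by (intro Bochner_Integration.integrable_add integrable_mult_right integrable_const)
    show "AE z in ?M. (norm (radial' c b D (delta_seq k) e z))\<^sup>2
       \<le> 2 * (K\<^sup>2 * norm z powr (2 * (2 * b + real D) - 2)) + 2 * K'\<^sup>2" for k
      using AE_nonzero_ball[of R] AE_space[of ?M]
    proof eventually_elim
      case (elim z)
      have "norm (radial' c b D (delta_seq k) e z) \<le> K * norm z powr (2 * b + real D - 1) + K'"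
        unfolding K_def K'_def by (rule radial'_bound[OF c elim(1) _ _ _ D])
          (use elim delta_seq(1,2)[of k] e in auto)
      then have "(norm (radial' c b D (delta_seq k) e z))\<^sup>2 \<le> (K * norm z powr (2 * b + real D - 1) + K')\<^sup>2"
        by (rule power_mono) simp
      also have "\<dots> \<le> 2 * (K * norm z powr (2 * b + real D - 1))\<^sup>2 + 2 * K'\<^sup>2"
        using norm_sum_sq_le[of "K * norm z powr (2 * b + real D - 1)" K'] by simp
      also have "(K * norm z powr (2 * b + real D - 1))\<^sup>2 = K\<^sup>2 * norm z powr (2 * (2 * b + real D) - 2)"
        using elim(1) by (simp add: power_mult_distrib powr_power algebra_simps)
      finally show ?case .
    qed
  qed
qed

lemma inner_wedge_times:
  fixes v w :: complex
  shows "v \<bullet> (v * w) = (norm v)\<^sup>2 * Re w" "wedge v (v * w) = (norm v)\<^sup>2 * Im w"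
  unfolding cmod_power2 inner_complex_def wedge_def by (simp_all add: power2_eq_square algebra_simps)

text \<open>Relative to the value of the map, the derivative in the radial direction is \<open>a / r\<close>, and in the angular direction it is \<open>\<i> D / r\<close>.\<close>

lemma radial'_eq:
  assumes z: "z \<noteq> 0" and D: "D \<ge> 1" and a: "2 * b + real D = a"
  shows "radial' c b D 0 1 z = radial c b D 0 z * ((a * Re z) / (z \<bullet> z) - \<i> * ((real D * Im z) / (z \<bullet> z)))"
    and "radial' c b D 0 \<i> z = radial c b D 0 z * ((a * Im z) / (z \<bullet> z) + \<i> * ((real D * Re z) / (z \<bullet> z)))"
proof -
  define N where "N = z \<bullet> z"
  have N: "N > 0" using z by (simp add: N_def)
  have zN: "of_real N = z * cnj z" by (simp add: N_def dot_square_norm complex_norm_square[symmetric])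
  have zD: "z ^ (D - 1) = z ^ D * cnj z / of_real N" using z D by (cases D) (auto simp: zN)
  have powr1: "N powr (b - 1) = N powr b / N" using N by (simp add: powr_diff)
  have b: "2 * b = a - real D" using a by simp
  have gen: "radial' c b D 0 e z = radial c b D 0 z * ((of_nat D * cnj z * e + of_real ((a - real D) * (z \<bullet> e))) / of_real N)" for e
    unfolding radial'_def radial_def N_def[symmetric] add_0_right powr1 zD b
    by (simp add: scaleR_conv_of_real algebra_simps add_divide_distrib diff_divide_distrib)
  show "radial' c b D 0 1 z = radial c b D 0 z * ((a * Re z) / (z \<bullet> z) - \<i> * ((real D * Im z) / (z \<bullet> z)))"
    unfolding gen N_def[symmetric] using N
    by (intro arg_cong2[of _ _ _ _ "(*)"] refl) (simp add: complex_eq_iff inner_complex_def field_simps)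
  show "radial' c b D 0 \<i> z = radial c b D 0 z * ((a * Im z) / (z \<bullet> z) + \<i> * ((real D * Re z) / (z \<bullet> z)))"
    unfolding gen N_def[symmetric] using N
    by (intro arg_cong2[of _ _ _ _ "(*)"] refl) (simp add: complex_eq_iff inner_complex_def field_simps)
qed

text \<open>The equations say that the two squares in \<open>energy_density_eq\<close> vanish.\<close>

lemma radial_calibrated:
  assumes c: "c > 0" and z: "z \<noteq> 0" and D: "D \<ge> 1" and a: "2 * b + real D = real D * \<epsilon>"
  defines "v \<equiv> radial c b D 0 z"
  shows "v \<noteq> 0" "v \<bullet> radial' c b D 0 1 z = \<epsilon> * wedge v (radial' c b D 0 \<i> z)"
    "v \<bullet> radial' c b D 0 \<i> z = - \<epsilon> * wedge v (radial' c b D 0 1 z)"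
proof -
  show "v \<noteq> 0" using c z by (simp add: v_def radial_def)
  show "v \<bullet> radial' c b D 0 1 z = \<epsilon> * wedge v (radial' c b D 0 \<i> z)"
    "v \<bullet> radial' c b D 0 \<i> z = - \<epsilon> * wedge v (radial' c b D 0 1 z)"
    unfolding radial'_eq[OF z D a] v_def[symmetric] inner_wedge_times by simp_all
qed

lemma radial_eq_rcis:
  assumes R: "R > 0" and D: "D \<ge> 1" and b: "2 * b + real D = a" and a: "a > 0" and r: "0 \<le> r"
  shows "radial (R powr - a) b D 0 (rcis r \<theta>) = of_real ((r / R) powr a) * cis (real D * \<theta>)"
proof (cases "r = 0")
  case True
  then show ?thesis using D by (simp add: radial_def)
next
  case False
  then have r: "r > 0" using r by simp
  have "(rcis r \<theta> \<bullet> rcis r \<theta>) powr b * r ^ D = r powr a"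
    using r by (simp add: powr_inner_self powr_add[symmetric] powr_realpow[symmetric] b)
  then have "R powr - a * (rcis r \<theta> \<bullet> rcis r \<theta>) powr b * r ^ D = (r / R) powr a"
    using R r by (simp add: powr_minus_divide powr_divide mult.assoc)
  then show ?thesis
    unfolding radial_def DeMoivre2 rcis_scaleR[of "r ^ D"] by (simp add: scaleR_conv_of_real flip: of_real_mult of_real_power)
qed

lemma radial_trace:
  assumes R: "R > 0" and D: "D \<ge> 1" and b: "2 * b + real D = a" and a: "a > 0"
    and g: "\<And>\<theta>. g (rcis R \<theta>) = cis (real D * \<theta>)"
  shows "g \<in> circle_L2 R"
    and "L2_lim {0..2 * pi} (\<lambda>k \<theta>. radial (R powr - a) b D (delta_seq k) (rcis R \<theta>)) (\<lambda>\<theta>. g (rcis R \<theta>))"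
proof -
  let ?I = "{0..2 * pi}"
  define t where "t = (\<lambda>d. R powr - a * (R\<^sup>2 + d) powr b * R ^ D)"
  have L: "(\<lambda>\<theta>. k *\<^sub>R cis (real D * \<theta>)) \<in> L2_on ?I" for k
  proof -
    have "continuous_on UNIV (\<lambda>\<theta>. k *\<^sub>R cis (real D * \<theta>))"
      unfolding cis_conv_exp by (intro continuous_intros)
    then show ?thesis
      using continuous_measurable_lebesgue_on by (simp add: L2_on_def)
  qed
  have rad: "radial (R powr - a) b D d (rcis R \<theta>) = t d *\<^sub>R cis (real D * \<theta>)" for d \<theta>
  proof -
    have "rcis R \<theta> \<bullet> rcis R \<theta> = R\<^sup>2" by (simp add: dot_square_norm)
    moreover have "rcis R \<theta> ^ D = R ^ D *\<^sub>R cis (real D * \<theta>)" unfolding DeMoivre2 by (rule rcis_scaleR)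
    ultimately show ?thesis by (simp add: radial_def t_def)
  qed
  have t0: "t 0 = 1"
  proof -
    have "(R\<^sup>2) powr b = R powr (2 * b)" using R by (simp add: powr_powr[symmetric])
    moreover have "R ^ D = R powr real D" using R by (simp add: powr_realpow)
    ultimately have "(R\<^sup>2) powr b * R ^ D = R powr a" by (simp only: powr_add[symmetric] b)
    then show ?thesis using R by (simp add: t_def mult.assoc powr_add[symmetric])
  qed
  have tt: "(\<lambda>k. t (delta_seq k)) \<longlonglongrightarrow> 1"
  proof -
    have "(\<lambda>k. t (delta_seq k)) \<longlonglongrightarrow> R powr - a * (R\<^sup>2 + 0) powr b * R ^ D"
      unfolding t_def by (intro tendsto_intros delta_seq) (use R in simp)
    then show ?thesis using t0 by (simp add: t_def)
  qed
  show "g \<in> circle_L2 R" using L[of 1] by (simp add: circle_L2_def g)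
  have "(norm (t d *\<^sub>R cis (real D * \<theta>) - cis (real D * \<theta>)))\<^sup>2 = (t d - 1)\<^sup>2" for d \<theta>
  proof -
    have "t d *\<^sub>R cis (real D * \<theta>) - cis (real D * \<theta>) = (t d - 1) *\<^sub>R cis (real D * \<theta>)"
      by (simp add: scaleR_diff_left)
    then show ?thesis by simp
  qed
  moreover have "(\<lambda>k. LINT \<theta>|lebesgue_on ?I. (t (delta_seq k) - 1)\<^sup>2) \<longlonglongrightarrow> 0"
  proof -
    have "(\<lambda>k. measure (lebesgue_on ?I) ?I * (t (delta_seq k) - 1)\<^sup>2) \<longlonglongrightarrow> measure (lebesgue_on ?I) ?I * (1 - 1)\<^sup>2"
      by (intro tendsto_intros tt)
    then show ?thesis by simp
  qed
  ultimately show "L2_lim ?I (\<lambda>k \<theta>. radial (R powr - a) b D (delta_seq k) (rcis R \<theta>)) (\<lambda>\<theta>. g (rcis R \<theta>))"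
    using L L[of 1] by (simp add: L2_lim_def rad g)
qed

section \<open>Minimality\<close>

theorem corollary3p4:
  fixes R \<epsilon> :: real and D :: nat and g u :: "complex \<Rightarrow> complex"
  assumes "R > 0" and "D \<ge> 1" and "\<epsilon> > 0"
    and g: "\<And>\<theta>. g (rcis R \<theta>) = cis (real D * \<theta>)"
    and u: "\<And>r \<theta>. 0 \<le> r \<Longrightarrow> r < R \<Longrightarrow>
              u (rcis r \<theta>) = of_real ((r / R) powr (real D * \<epsilon>)) * cis (real D * \<theta>)"
  shows "is_arg_min (energy \<epsilon> (ball 0 R)) (\<lambda>v. v \<in> H1_boundary R g) u"
proof -
  note R = \<open>R > 0\<close> and D = \<open>D \<ge> 1\<close> and \<epsilon> = \<open>\<epsilon> > 0\<close>
  define a where "a = real D * \<epsilon>"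
  \<comment> \<open>So that \<open>(z \<bullet> z) powr b * z ^ D\<close> has modulus \<open>norm z powr a\<close>.\<close>
  define b where "b = (a - real D) / 2"
  define c where "c = R powr - a"
  have a: "a > 0" and c: "c > 0" using R D \<epsilon> by (auto simp: a_def c_def)
  have b: "2 * b + real D = a" by (simp add: b_def field_simps)
  let ?U = "\<lambda>k. radial c b D (delta_seq k)"
  let ?u' = "radial' c b D 0"
  have ur: "u z = radial c b D 0 z" if "norm z < R" for z
    using u[of "norm z" "Arg z"] radial_eq_rcis[OF R D b a, of "norm z" "Arg z"] that
    by (simp add: rcis_cmod_Arg a_def c_def)
  have U: "smooth_approx (ball 0 R) ?U u ?u'"
    by (rule smooth_approx_radial[OF c R D _ ur]) (use a b in simp)
  note tr = radial_trace[OF R D b a g, folded c_def]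
  have uH: "u \<in> H1_boundary R g" unfolding H1_boundary_iff[OF R] using U tr by blast
  have ball: "open (ball 0 R :: complex set)" "ball 0 R \<in> (lmeasurable :: complex set set)" by auto
  have "AE z in lebesgue_on (ball 0 R). u z \<noteq> 0 \<and> u z \<bullet> ?u' 1 z = \<epsilon> * wedge (u z) (?u' \<i> z) \<and>
      u z \<bullet> ?u' \<i> z = - \<epsilon> * wedge (u z) (?u' 1 z)"
    using AE_nonzero_ball[of R] AE_space[of "lebesgue_on (ball 0 R)"]
  proof eventually_elim
    case (elim z)
    then have "u z = radial c b D 0 z" using ur by simp
    then show ?case using radial_calibrated[OF c elim(1) D b[unfolded a_def]] by simp
  qed
  then have eq: "energy \<epsilon> (ball 0 R) u = 2 / \<epsilon> * (LINT z|lebesgue_on (ball 0 R). wedge (?u' 1 z) (?u' \<i> z))"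
    by (rule energy_eq_wedge[OF ball U \<epsilon>])
  have "energy \<epsilon> (ball 0 R) u \<le> energy \<epsilon> (ball 0 R) v" if vH: "v \<in> H1_boundary R g" for v
  proof -
    obtain V v' where V: "smooth_approx (ball 0 R) V v v'"
      and trV: "L2_lim {0..2 * pi} (\<lambda>k \<theta>. V k (rcis R \<theta>)) (\<lambda>\<theta>. g (rcis R \<theta>))"
      using vH unfolding H1_boundary_iff[OF R] by blast
    show ?thesis
      unfolding eq integral_wedge_boundary_values[OF R U V tr(2) trV] by (rule energy_ge_wedge[OF ball V \<epsilon>])
  qed
  then show ?thesis using uH by (auto simp: is_arg_min_def not_less)
qed

end
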